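(* The set $\{e_JC^{\dagger}_{r^-(\mathcal{D})}e_J\}_{\mathcal{D}\in W_J\backslash W/W_J}$ is a basis of the parabolic Hecke algebra $H^J(W)$ over $A$, and for every $\mathcal{D}\in W_J\backslash W/W_J$ we have $$e_JC^{\dagger}_{r^-(\mathcal{D})}e_J=\sum_{\mathcal{D}'\leq\mathcal{D}}a_{\mathcal{D}',\mathcal{D}}\,e_JT_{r^-(\mathcal{D}')}e_J\ ,\qquad\text{where}\quad a_{\mathcal{D}',\mathcal{D}}=\sum_{y\in\mathcal{D}'}(-1)^{\ell(y)}q^{\ell(y)-\ell(r^-(\mathcal{D}'))}\,\overline{p}_{y,r^-(\mathcal{D})}\ .$$ Moreover, $e_JC^{\dagger}_{r^-(\mathcal{D})}e_J$ is the unique element $B_{\mathcal{D}}$ of $H^J(W)$ satisfying $$\overline{B_{\mathcal{D}}}=B_{\mathcal{D}}\quad\text{and}\quad B_{\mathcal{D}}=(-1)^{\ell(r^-(\mathcal{D}))}e_JT_{r^-(\mathcal{D})}e_J+\sum_{\mathcal{D}'<\mathcal{D}}\alpha_{\mathcal{D}'\mathcal{D}}\,e_JT_{r^-(\mathcal{D}')}e_J\ \ \text{with } \alpha_{\mathcal{D}'\mathcal{D}}\in q\mathbb{Z}[q].$$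
   Context: $(W,S)$ is a Coxeter system with length function $\ell$ and strong Bruhat order $\leq$; $J\subseteq S$ is non-empty and the parabolic subgroup $W_J$ generated by $J$ is assumed finite. Each double coset $\mathcal{D}\in W_J\backslash W/W_J$ has a unique element $r^-(\mathcal{D})$ of minimal length. Double cosets are ordered by $\mathcal{D}\leq\mathcal{D}'$ iff $r^-(\mathcal{D})\leq r^-(\mathcal{D}')$ in the Bruhat order. Let $q$ be an indeterminate, $W_J(q^2)=\sum_{w\in W_J}q^{2\ell(w)}$ and $A=\mathbb{Z}[q,q^{-1},W_J(q^2)^{-1}]$. The Hecke algebra $H(W)$ is the $A$-algebra with basis $\{T_w\}_{w\in W}$ and multiplication, for $s\in S$: $T_sT_w=T_{sw}$ if $\ell(sw)>\ell(w)$, and $T_sT_w=(q-q^{-1})T_w+T_{sw}$ if $\ell(sw)<\ell(w)$. The bar involution is the ring automorphism of $H(W)$ with $\overline{q}=q^{-1}$, $\overline{T_s}=T_s^{-1}$. The first Kazhdan--Lusztig basis $\{C_w\}_{w\in W}$ is the unique basis with $\overline{C_w}=C_w$ and $C_w=T_w+\sum_{x<w}p_{x,w}T_x$ with $p_{x,w}\in q^{-1}\mathbb{Z}[q^{-1}]$; set $p_{w,w}=1$ and $p_{x,w}=0$ if $x\not\leq w$. The polynomial $\overline{p}_{x,w}$ is obtained from $p_{x,w}$ by $q\mapsto q^{-1}$. The second Kazhdan--Lusztig basis $\{C^{\dagger}_w\}_{w\in W}$ is the image of $\{C_w\}$ under the ring automorphism $T_s\mapsto -T_s$, $q\mapsto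 q^{-1}$; thus $\overline{C^\dagger_w}=C^\dagger_w$ and $C^{\dagger}_w=(-1)^{\ell(w)}T_w+\sum_{x<w}(-1)^{\ell(x)}\overline{p}_{x,w}T_x$. Let $e_J=\frac{1}{W_J(q^2)}\sum_{w\in W_J}q^{\ell(w)}T_w$ (an idempotent). The parabolic Hecke algebra is $H^J(W)=e_JH(W)e_J$, with unit $e_J$. The elements $\{e_JT_{r^-(\mathcal{D})}e_J\}_{\mathcal{D}\in W_J\backslash W/W_J}$ form an $A$-basis of it. *)

theory Defs
  imports
    "HOL-Algebra.Module"
    "HOL-Algebra.QuotRing"
    "HOL-Algebra.Generated_Rings"
    "HOL-Algebra.Generated_Groups"
    "HOL-Algebra.Multiplicative_Group"
    "HOL-Computational_Algebra.Polynomial_Factorial"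
begin

section \<open>Coxeter systems\<close>

definition word_prod :: "('w, 'm) monoid_scheme \<Rightarrow> 'w list \<Rightarrow> 'w" where
  "word_prod W ws = foldr (\<otimes>\<^bsub>W\<^esub>) ws \<one>\<^bsub>W\<^esub>"

text \<open>
  Insertion of a Coxeter relator \<open>(s t)\<^sup>m\<close>, where \<open>m\<close> is the order of \<open>s t\<close>, into a word over \<open>S\<close>.
  The order is 0 if \<open>s t\<close> has infinite order, so that no relator is imposed in that case.
  For \<open>s = t\<close> the relator is \<open>s s\<close>.
\<close>

definition relator_insertions :: "('w, 'm) monoid_scheme \<Rightarrow> 'w set \<Rightarrow> ('w list \<times> 'w list) set" where
  "relator_insertions W S =
     {(us @ vs, us @ concat (replicate (group.ord W (s \<otimes>\<^bsub>W\<^esub> t)) [s, t]) @ vs) | us vs s t.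
        us \<in> lists S \<and> vs \<in> lists S \<and> s \<in> S \<and> t \<in> S}"

text \<open>
  \<open>W\<close> has the presentation with generators \<open>S\<close> and relations \<open>(s t)\<^sup>m = 1\<close>, with \<open>m\<close> the order of
  \<open>s t\<close> (for the pairs where it is finite). As the relations \<open>s s = 1\<close> are among these,
  the group so presented is the quotient of the free monoid on \<open>S\<close> by the congruence generated by
  the relators, and no formal inverses of generators are needed. \<open>S\<close> may be infinite.
\<close>

locale coxeter_system = group W for W (structure) +
  fixes S
  assumes generators_closed: "S \<subseteq> carrier W"
    and generators_generate: "generate W S = carrier W"
    and generators_nontrivial: "s \<in> S \<Longrightarrow> s \<noteq> \<one>"
    and generators_involutive: "s \<in> S \<Longrightarrow> s \<otimes> s = \<one>"
    and presentation:
      "\<lbrakk>us \<in> lists S; vs \<in> lists S; word_prod W us = word_prod W vs\<rbrakk> \<Longrightarrow>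
         (us, vs) \<in> (relator_insertions W S \<union> (relator_insertions W S)\<inverse>)\<^sup>*"

definition cox_length :: "('w, 'm) monoid_scheme \<Rightarrow> 'w set \<Rightarrow> 'w \<Rightarrow> nat" where
  "cox_length W S w = (LEAST n. \<exists>ws \<in> lists S. length ws = n \<and> word_prod W ws = w)"

definition reflections :: "('w, 'm) monoid_scheme \<Rightarrow> 'w set \<Rightarrow> 'w set" where
  "reflections W S = {w \<otimes>\<^bsub>W\<^esub> s \<otimes>\<^bsub>W\<^esub> inv\<^bsub>W\<^esub> w | w s. w \<in> carrier W \<and> s \<in> S}"

definition bruhat_le :: "('w, 'm) monoid_scheme \<Rightarrow> 'w set \<Rightarrow> 'w \<Rightarrow> 'w \<Rightarrow> bool" where
  "bruhat_le W S x w \<longleftrightarrow> x \<in> carrier W \<and> w \<in> carrier W \<and>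
     (x, w) \<in> {(u, u \<otimes>\<^bsub>W\<^esub> t) | u t. u \<in> carrier W \<and> t \<in> reflections W S \<and>
                  cox_length W S u < cox_length W S (u \<otimes>\<^bsub>W\<^esub> t)}\<^sup>*"

definition bruhat_less :: "('w, 'm) monoid_scheme \<Rightarrow> 'w set \<Rightarrow> 'w \<Rightarrow> 'w \<Rightarrow> bool" where
  "bruhat_less W S x w \<longleftrightarrow> bruhat_le W S x w \<and> x \<noteq> w"

locale parabolic_coxeter_system = coxeter_system W S for W (structure) and S +
  fixes J
  assumes parabolic_generators: "J \<subseteq> S"
    and parabolic_nonempty: "J \<noteq> {}"
    and parabolic_finite: "finite (generate W J)"

definition double_cosets :: "('w, 'm) monoid_scheme \<Rightarrow> 'w set \<Rightarrow> 'w set set" where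
  "double_cosets W J = {(generate W J #>\<^bsub>W\<^esub> w) <#>\<^bsub>W\<^esub> generate W J | w. w \<in> carrier W}"

definition min_rep :: "('w, 'm) monoid_scheme \<Rightarrow> 'w set \<Rightarrow> 'w set \<Rightarrow> 'w" where
  "min_rep W S D = (THE x. x \<in> D \<and> (\<forall>y \<in> D. cox_length W S x \<le> cox_length W S y))"

definition coset_le :: "('w, 'm) monoid_scheme \<Rightarrow> 'w set \<Rightarrow> 'w set \<Rightarrow> 'w set \<Rightarrow> bool" where
  "coset_le W S D' D \<longleftrightarrow> bruhat_le W S (min_rep W S D') (min_rep W S D)"

definition coset_less :: "('w, 'm) monoid_scheme \<Rightarrow> 'w set \<Rightarrow> 'w set \<Rightarrow> 'w set \<Rightarrow> bool" where
  "coset_less W S D' D \<longleftrightarrow> coset_le W S D' D \<and> D' \<noteq> D"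


section \<open>The coefficient ring\<close>

text \<open>All coefficients live in \<open>Frac(\<int>[q]) = \<rat>(q)\<close>.\<close>

definition qvar :: "int poly fract" where
  "qvar = to_fract [:0, 1:]"

definition q_field :: "int poly fract ring" where
  "q_field = \<lparr>carrier = UNIV, monoid.mult = (*), one = 1, zero = 0, add = (+)\<rparr>"

text \<open>The set \<open>u \<int>[u]\<close>; it is used for \<open>u = q\<close> and \<open>u = q\<inverse>\<close>.\<close>

definition multiples_int_poly :: "int poly fract \<Rightarrow> int poly fract set" where
  "multiples_int_poly u = (\<lambda>f. u * f) ` generate_ring q_field {u}"

text \<open>The substitution \<open>q \<mapsto> q\<inverse>\<close> in a rational function, written as numerator over denominator.\<close>

definition q_invert :: "int poly fract \<Rightarrow> int poly fract" where
  "q_invert f = (case quot_of_fract f of (a, b) \<Rightarrow>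
     poly (map_poly of_int a) (inverse qvar) / poly (map_poly of_int b) (inverse qvar))"

text \<open>The Poincare polynomial \<open>W\<^sub>J(q\<^sup>2)\<close>.\<close>

definition poincare :: "('w, 'm) monoid_scheme \<Rightarrow> 'w set \<Rightarrow> 'w set \<Rightarrow> int poly fract" where
  "poincare W S J = (\<Sum>w \<in> generate W J. qvar ^ (2 * cox_length W S w))"

definition hecke_coeffs :: "('w, 'm) monoid_scheme \<Rightarrow> 'w set \<Rightarrow> 'w set \<Rightarrow> int poly fract ring" where
  "hecke_coeffs W S J =
     q_field\<lparr>carrier := generate_ring q_field {qvar, inverse qvar, inverse (poincare W S J)}\<rparr>"


section \<open>Algebras and bases\<close>

text \<open>The library locale \<open>algebra\<close> is restricted to commutative algebras.\<close>

locale assoc_algebra = module R M + ring M for R (structure) and M (structure) +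
  assumes smult_mult_left:
      "\<lbrakk>a \<in> carrier R; x \<in> carrier M; y \<in> carrier M\<rbrakk> \<Longrightarrow>
         (a \<odot>\<^bsub>M\<^esub> x) \<otimes>\<^bsub>M\<^esub> y = a \<odot>\<^bsub>M\<^esub> (x \<otimes>\<^bsub>M\<^esub> y)"
    and smult_mult_right:
      "\<lbrakk>a \<in> carrier R; x \<in> carrier M; y \<in> carrier M\<rbrakk> \<Longrightarrow>
         x \<otimes>\<^bsub>M\<^esub> (a \<odot>\<^bsub>M\<^esub> y) = a \<odot>\<^bsub>M\<^esub> (x \<otimes>\<^bsub>M\<^esub> y)"

text \<open>
  The family \<open>b\<close> indexed by \<open>I\<close> is a basis of the \<open>R\<close>-module \<open>M\<close>; in particular the
  \<open>b i\<close> are pairwise distinct unless \<open>R\<close> is trivial.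
\<close>

definition module_basis ::
  "('a, 'x) ring_scheme \<Rightarrow> ('a, 'b, 'y) module_scheme \<Rightarrow> 'i set \<Rightarrow> ('i \<Rightarrow> 'b) \<Rightarrow> bool" where
  "module_basis R M I b \<longleftrightarrow>
     b \<in> I \<rightarrow> carrier M \<and>
     (\<forall>x \<in> carrier M. \<exists>F c. finite F \<and> F \<subseteq> I \<and> c \<in> F \<rightarrow> carrier R \<and>
        x = (\<Oplus>\<^bsub>M\<^esub>i\<in>F. c i \<odot>\<^bsub>M\<^esub> b i)) \<and>
     (\<forall>F c. finite F \<and> F \<subseteq> I \<and> c \<in> F \<rightarrow> carrier R \<and>
        (\<Oplus>\<^bsub>M\<^esub>i\<in>F. c i \<odot>\<^bsub>M\<^esub> b i) = \<zero>\<^bsub>M\<^esub> \<longrightarrow> (\<forall>i \<in> F. c i = \<zero>\<^bsub>R\<^esub>))"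


section \<open>Hecke algebras and Kazhdan--Lusztig bases\<close>

text \<open>
  \<open>H\<close> is any algebra over the coefficient ring with a basis \<open>T\<close> multiplying by the stated rule;
  this determines \<open>(H, T)\<close> up to unique isomorphism.
\<close>

locale hecke_algebra = parabolic_coxeter_system W S J +
    assoc_algebra "hecke_coeffs W S J" H
  for W :: "('w, 'm) monoid_scheme" and S and J and H :: "(int poly fract, 'h) module" +
  fixes T :: "'w \<Rightarrow> 'h"
  assumes standard_basis: "module_basis (hecke_coeffs W S J) H (carrier W) T"
    and mult_ascent:
      "\<lbrakk>s \<in> S; w \<in> carrier W; cox_length W S (s \<otimes>\<^bsub>W\<^esub> w) > cox_length W S w\<rbrakk> \<Longrightarrow>
         T s \<otimes>\<^bsub>H\<^esub> T w = T (s \<otimes>\<^bsub>W\<^esub> w)"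
    and mult_descent:
      "\<lbrakk>s \<in> S; w \<in> carrier W; cox_length W S (s \<otimes>\<^bsub>W\<^esub> w) < cox_length W S w\<rbrakk> \<Longrightarrow>
         T s \<otimes>\<^bsub>H\<^esub> T w = (qvar - inverse qvar) \<odot>\<^bsub>H\<^esub> T w \<oplus>\<^bsub>H\<^esub> T (s \<otimes>\<^bsub>W\<^esub> w)"

text \<open>
  \<open>bar\<close> is the bar involution, \<open>C\<close> is the first Kazhdan--Lusztig basis with polynomials \<open>p\<close>
  (the first argument of \<open>p\<close> is the smaller element), and \<open>dagger\<close> is the ring automorphism
  carrying \<open>C\<close> to the second Kazhdan--Lusztig basis.
\<close>

locale kazhdan_lusztig = hecke_algebra W S J H T
  for W :: "('w, 'm) monoid_scheme" and S and J
    and H :: "(int poly fract, 'h) module" and T :: "'w \<Rightarrow> 'h" +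
  fixes bar :: "'h \<Rightarrow> 'h"
    and C :: "'w \<Rightarrow> 'h"
    and p :: "'w \<Rightarrow> 'w \<Rightarrow> int poly fract"
    and dagger :: "'h \<Rightarrow> 'h"
  assumes bar_automorphism: "bar \<in> ring_iso H H"
    and bar_q: "bar (qvar \<odot>\<^bsub>H\<^esub> \<one>\<^bsub>H\<^esub>) = inverse qvar \<odot>\<^bsub>H\<^esub> \<one>\<^bsub>H\<^esub>"
    and bar_generator: "s \<in> S \<Longrightarrow> bar (T s) = inv\<^bsub>H\<^esub> (T s)"
    and KL_basis: "module_basis (hecke_coeffs W S J) H (carrier W) C"
    and KL_bar: "w \<in> carrier W \<Longrightarrow> bar (C w) = C w"
    and KL_expansion: "w \<in> carrier W \<Longrightarrow>
      C w = T w \<oplus>\<^bsub>H\<^esub> (\<Oplus>\<^bsub>H\<^esub>x\<in>{x. bruhat_less W S x w}. p x w \<odot>\<^bsub>H\<^esub> T x)"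
    and KL_poly: "bruhat_less W S x w \<Longrightarrow> p x w \<in> multiples_int_poly (inverse qvar)"
    and KL_poly_refl: "w \<in> carrier W \<Longrightarrow> p w w = 1"
    and KL_poly_zero: "\<lbrakk>x \<in> carrier W; w \<in> carrier W; \<not> bruhat_le W S x w\<rbrakk> \<Longrightarrow> p x w = 0"
    and dagger_automorphism: "dagger \<in> ring_iso H H"
    and dagger_q: "dagger (qvar \<odot>\<^bsub>H\<^esub> \<one>\<^bsub>H\<^esub>) = inverse qvar \<odot>\<^bsub>H\<^esub> \<one>\<^bsub>H\<^esub>"
    and dagger_generator: "s \<in> S \<Longrightarrow> dagger (T s) = \<ominus>\<^bsub>H\<^esub> T s"


section \<open>The parabolic Hecke algebra\<close>

definition hecke_idem ::
  "('w, 'm) monoid_scheme \<Rightarrow> 'w set \<Rightarrow> 'w set \<Rightarrow> (int poly fract, 'h) module \<Rightarrow> ('w \<Rightarrow> 'h) \<Rightarrow> 'h" where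
  "hecke_idem W S J H T = inverse (poincare W S J) \<odot>\<^bsub>H\<^esub>
     (\<Oplus>\<^bsub>H\<^esub>w\<in>generate W J. qvar ^ cox_length W S w \<odot>\<^bsub>H\<^esub> T w)"

definition parabolic_hecke ::
  "('w, 'm) monoid_scheme \<Rightarrow> 'w set \<Rightarrow> 'w set \<Rightarrow> (int poly fract, 'h) module \<Rightarrow> ('w \<Rightarrow> 'h)
    \<Rightarrow> (int poly fract, 'h) module" where
  "parabolic_hecke W S J H T = (let e = hecke_idem W S J H T in
     H\<lparr>carrier := {e \<otimes>\<^bsub>H\<^esub> h \<otimes>\<^bsub>H\<^esub> e | h. h \<in> carrier H}, one := e\<rparr>)"

definition coset_coeff ::
  "('w, 'm) monoid_scheme \<Rightarrow> 'w set \<Rightarrow> ('w \<Rightarrow> 'w \<Rightarrow> int poly fract) \<Rightarrow> 'w set \<Rightarrow> 'w set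
    \<Rightarrow> int poly fract" where
  "coset_coeff W S p D' D = (\<Sum>y\<in>D'.
     (- 1) ^ cox_length W S y
     * qvar powi (int (cox_length W S y) - int (cox_length W S (min_rep W S D')))
     * q_invert (p y (min_rep W S D)))"

end

theory Submission
  imports Defs "HOL-Library.Sublist"
begin

text \<open>
  For \<open>s \<in> J\<close> one has \<open>T\<^sub>s e = q e = e T\<^sub>s\<close>. Every element \<open>y\<close> of a double coset \<open>D\<close> can be written
  \<open>y = u r v\<close> with \<open>u, v \<in> W\<^sub>J\<close>, \<open>r\<close> the minimal representative of \<open>D\<close>, and lengths adding up, so that
  \<open>e T\<^sub>y e\<close> is \<open>q\<close> to the power \<open>\<ell>(y) - \<ell>(r)\<close> times \<open>e T\<^sub>r e\<close>. Applying \<open>h \<mapsto> e h e\<close> to the expansion of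
  the second Kazhdan--Lusztig basis element at \<open>r(D)\<close> and collecting terms by double cosets gives the
  expansion of the theorem (\<open>eCe_expansion\<close>); only cosets below \<open>D\<close> occur because \<open>r(D') \<le> y \<le> r(D)\<close>
  for all terms \<open>y \<in> D'\<close>. The diagonal coefficient is a sign, since \<open>r(D)\<close> is the only element of \<open>D\<close>
  below \<open>r(D)\<close>, and the other coefficients lie in \<open>q\<int>[q]\<close>, since all exponents of \<open>q\<close> are nonnegative
  and the inverted Kazhdan--Lusztig polynomials lie in \<open>q\<int>[q]\<close>.

  Write \<open>e T e\<close> and \<open>e C e\<close> for the elements of the parabolic algebra that come from the standard and
  the second Kazhdan--Lusztig basis at the minimal representatives. The transition from the former to
  the latter is thus triangular over \<open>\<int>[q]\<close> with signs
  on the diagonal, so the latter span the parabolic algebra (\<open>eTe_integral_combination\<close>). They are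
  independent because of a family of linear functionals, one for each double coset \<open>D\<close>: the sum over
  \<open>y \<in> D\<close> of \<open>q\<^sup>\<ell>\<^sup>(\<^sup>y\<^sup>)\<close> times the coefficient at \<open>T\<^sub>y\<close>. Multiplication by \<open>T\<^sub>s\<close> with \<open>s \<in> J\<close>, on either side, scales
  this functional by \<open>q\<close>, hence it takes the same value on \<open>h\<close> and on \<open>e h e\<close>, and it separates the elements
  \<open>e T e\<close> (\<open>double_coset_functional\<close>).

  For bar invariance, \<open>bar e\<close> satisfies the same equations \<open>T\<^sub>s f = q f = f T\<^sub>s\<close> as \<open>e\<close>, which forces
  \<open>bar e = e\<close> (\<open>bar_e\<close>), and the bar involution commutes with the automorphism that defines the second
  basis (\<open>bar_dagger\<close>). For uniqueness, the difference of two candidates is a combination of the elements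
  \<open>e C e\<close> with coefficients in \<open>q\<int>[q]\<close> that is bar invariant; the coefficients are then fixed by
  \<open>q \<mapsto> q\<^sup>-\<^sup>1\<close>, hence zero (\<open>bar_invariant_zero\<close>).

  The group theory rests on the strong exchange condition, which is derived from the presentation: the
  parity of the number of times a reflection occurs along a word depends on the product of the
  word only (\<open>even_refl_count_cong\<close>). Two consequences are used: every word contains a reduced word
  with the same product (\<open>reduced_subword\<close>), which yields the factorisation \<open>y = u r v\<close>, and elements
  below \<open>w\<close> in the Bruhat order are products of subwords of a word for \<open>w\<close> (\<open>bruhat_le_subword\<close>),
  which makes all sums finite.
\<close>


section \<open>Words and reduced words\<close>

context coxeter_system
begin

abbreviation wp where "wp \<equiv> word_prod W"
abbreviation len (\<open>\<ell>\<close>) where "\<ell> \<equiv> cox_length W S"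

declare in_lists_conv_set [simp] ball_Un [simp]

lemma gen_carrier [simp]: "s \<in> S \<Longrightarrow> s \<in> carrier W"
  using generators_closed by blast

lemma wp_Nil [simp]: "wp [] = \<one>"
  by (simp add: word_prod_def)

lemma wp_Cons [simp]: "wp (s # ws) = s \<otimes> wp ws"
  by (simp add: word_prod_def)

lemma wp_closed [simp]: "ws \<in> lists S \<Longrightarrow> wp ws \<in> carrier W"
  by (induction ws) auto

lemma wp_append: "us \<in> lists S \<Longrightarrow> vs \<in> lists S \<Longrightarrow> wp (us @ vs) = wp us \<otimes> wp vs"
  by (induction us) (auto simp: m_assoc)

lemma inv_gen [simp]: "s \<in> S \<Longrightarrow> inv s = s"
  by (simp add: generators_involutive inv_equality)

lemma gen_cancel [simp]: "s \<in> S \<Longrightarrow> w \<in> carrier W \<Longrightarrow> s \<otimes> (s \<otimes> w) = w"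
  by (simp add: generators_involutive flip: m_assoc)

lemma gen_cancel_right [simp]: "s \<in> S \<Longrightarrow> w \<in> carrier W \<Longrightarrow> w \<otimes> s \<otimes> s = w"
  by (simp add: generators_involutive m_assoc)

lemma inv_cancel_left: "a \<in> carrier W \<Longrightarrow> x \<in> carrier W \<Longrightarrow> inv a \<otimes> (a \<otimes> x) = x"
  by (simp flip: m_assoc)

lemma wp_rev: "ws \<in> lists S \<Longrightarrow> wp (rev ws) = inv (wp ws)"
  by (induction ws) (auto simp: wp_append inv_mult_group)

lemma generate_word:
  assumes "K \<subseteq> S" "w \<in> generate W K"
  obtains ws where "ws \<in> lists K" "wp ws = w"
proof -
  have "\<exists>ws \<in> lists K. wp ws = w"
    using assms(2)
  proof (induction rule: generate.induct)
    case one
    then show ?case by (intro bexI[of _ "[]"]) auto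
  next
    case (incl h)
    then show ?case using assms(1) by (intro bexI[of _ "[h]"]) auto
  next
    case (inv h)
    then show ?case using assms(1) by (intro bexI[of _ "[h]"]) auto
  next
    case (eng g h)
    then obtain us vs where "us \<in> lists K" "vs \<in> lists K" "wp us = g" "wp vs = h" by blast
    moreover from this have "us \<in> lists S" "vs \<in> lists S" using assms(1) by auto
    ultimately show ?case by (intro bexI[of _ "us @ vs"]) (auto simp: wp_append)
  qed
  then show ?thesis using that by blast
qed

lemma wp_generate: "K \<subseteq> S \<Longrightarrow> ws \<in> lists K \<Longrightarrow> wp ws \<in> generate W K"
  by (induction ws) (auto intro: generate.intros)

lemma word_exists:
  assumes "w \<in> carrier W"
  obtains ws where "ws \<in> lists S" "wp ws = w"
  using generate_word[of S w] assms generators_generate by blast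

lemma len_le: "ws \<in> lists S \<Longrightarrow> \<ell> (wp ws) \<le> length ws"
  unfolding cox_length_def by (rule Least_le) auto

definition reduced :: "'a list \<Rightarrow> bool" where
  "reduced ws \<longleftrightarrow> ws \<in> lists S \<and> length ws = \<ell> (wp ws)"

lemma reduced_lists: "reduced ws \<Longrightarrow> ws \<in> lists S"
  by (simp add: reduced_def)

lemma reduced_word_exists:
  assumes "w \<in> carrier W"
  obtains ws where "reduced ws" "wp ws = w"
proof -
  obtain us where "us \<in> lists S" "wp us = w" using word_exists[OF assms] .
  then have "\<exists>n. \<exists>ws \<in> lists S. length ws = n \<and> wp ws = w" by blast
  from LeastI_ex[OF this] show ?thesis
    using that unfolding reduced_def cox_length_def by blast
qed

lemma len_mult_le:
  assumes "x \<in> carrier W" "y \<in> carrier W"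
  shows "\<ell> (x \<otimes> y) \<le> \<ell> x + \<ell> y"
proof -
  obtain us vs where u: "reduced us" "wp us = x" and v: "reduced vs" "wp vs = y"
    using reduced_word_exists assms by metis
  show ?thesis using len_le[of "us @ vs"] u v by (auto simp: reduced_def wp_append)
qed

lemma len_one [simp]: "\<ell> \<one> = 0"
  using len_le[of "[]"] by simp

lemma len_gen_le: "s \<in> S \<Longrightarrow> \<ell> s \<le> 1"
  using len_le[of "[s]"] by simp

lemma reduced_append:
  assumes "reduced (us @ vs)"
  shows "reduced us" "reduced vs"
proof -
  have l: "us \<in> lists S" "vs \<in> lists S" using assms by (auto simp: reduced_def)
  have "length us + length vs \<le> \<ell> (wp us) + \<ell> (wp vs)"
    using assms len_mult_le[of "wp us" "wp vs"] l by (simp add: reduced_def wp_append)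
  then show "reduced us" "reduced vs"
    using len_le[OF l(1)] len_le[OF l(2)] l by (auto simp: reduced_def)
qed


section \<open>The strong exchange condition\<close>

text \<open>
  The number of occurrences of \<open>t\<close> among the reflections
  \<open>s\<^sub>1 \<dots> s\<^sub>i\<^sub>-\<^sub>1 s\<^sub>i s\<^sub>i\<^sub>-\<^sub>1 \<dots> s\<^sub>1\<close> attached to the word \<open>s\<^sub>1 \<dots> s\<^sub>k\<close>. The reflections of the tail are
  conjugated by the first letter, hence the conjugation in the recursive call.
\<close>

primrec refl_count :: "'a list \<Rightarrow> 'a \<Rightarrow> nat" where
  "refl_count [] t = 0"
| "refl_count (s # ws) t = of_bool (t = s) + refl_count ws (s \<otimes> t \<otimes> s)"

lemma refl_count_append:
  assumes "us \<in> lists S" "vs \<in> lists S" "t \<in> carrier W"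
  shows "refl_count (us @ vs) t = refl_count us t + refl_count vs (inv (wp us) \<otimes> t \<otimes> wp us)"
  using assms by (induction us arbitrary: t) (auto simp: inv_mult_group m_assoc)

text \<open>
  The \<open>i\<close>-th reflection attached to the alternating word \<open>s t s t \<dots>\<close> is \<open>(s t)\<^sup>i s\<close>, counting from 0.
\<close>

lemma refl_count_dihedral:
  assumes "s \<in> S" "t \<in> S" "x \<in> carrier W"
  shows "refl_count (concat (replicate m [s, t])) x
           = (\<Sum>i<2*m. of_bool (x = (s \<otimes> t) [^] i \<otimes> s))"
  using assms(3)
proof (induction m arbitrary: x)
  case (Suc m)
  have c: "s \<in> carrier W" "t \<in> carrier W" "x \<in> carrier W" using assms Suc by auto
  have move: "(g \<otimes> x \<otimes> h = y) = (x = inv g \<otimes> y \<otimes> inv h)"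
    if "g \<in> carrier W" "h \<in> carrier W" "y \<in> carrier W" for g h y
    using that c by (metis inv_closed inv_solve_left inv_solve_right m_assoc m_closed)
  have e1: "(s \<otimes> x \<otimes> s = t) = (x = (s \<otimes> t) [^] Suc 0 \<otimes> s)"
    using assms c by (simp add: move)
  have e2: "(t \<otimes> (s \<otimes> x \<otimes> s) \<otimes> t = (s \<otimes> t) [^] i \<otimes> s)
      = (x = (s \<otimes> t) [^] Suc (Suc i) \<otimes> s)" for i
  proof -
    have "(t \<otimes> (s \<otimes> x \<otimes> s) \<otimes> t = (s \<otimes> t) [^] i \<otimes> s)
        = ((t \<otimes> s) \<otimes> x \<otimes> (s \<otimes> t) = (s \<otimes> t) [^] i \<otimes> s)"
      using c by (simp add: m_assoc)
    also have "\<dots> = (x = (s \<otimes> t) \<otimes> ((s \<otimes> t) [^] i \<otimes> s) \<otimes> (t \<otimes> s))"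
      using c assms by (subst move) (auto simp: inv_mult_group)
    also have "(s \<otimes> t) \<otimes> ((s \<otimes> t) [^] i \<otimes> s) \<otimes> (t \<otimes> s)
        = (s \<otimes> t) \<otimes> (s \<otimes> t) [^] i \<otimes> (s \<otimes> t) \<otimes> s"
      using c by (simp add: m_assoc)
    also have "\<dots> = (s \<otimes> t) [^] Suc (Suc i) \<otimes> s"
      using c by (simp only: nat_pow_Suc2[symmetric] m_closed nat_pow_Suc[symmetric])
    finally show ?thesis .
  qed
  have "refl_count (concat (replicate (Suc m) [s, t])) x
      = of_bool (x = s) + (of_bool (s \<otimes> x \<otimes> s = t)
        + refl_count (concat (replicate m [s, t])) (t \<otimes> (s \<otimes> x \<otimes> s) \<otimes> t))"
    by simp
  also have "refl_count (concat (replicate m [s, t])) (t \<otimes> (s \<otimes> x \<otimes> s) \<otimes> t)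
      = (\<Sum>i<2*m. of_bool (x = (s \<otimes> t) [^] Suc (Suc i) \<otimes> s))"
    using c by (subst Suc.IH) (auto simp: e2 simp del: nat_pow_Suc)
  also have "of_bool (x = s) + (of_bool (s \<otimes> x \<otimes> s = t) + \<dots>)
      = (\<Sum>i<2 * Suc m. of_bool (x = (s \<otimes> t) [^] i \<otimes> s))"
    using c by (simp add: e1 sum.lessThan_Suc_shift del: nat_pow_Suc sum.lessThan_Suc)
  finally show ?case .
qed simp

lemma wp_dihedral:
  assumes "s \<in> S" "t \<in> S"
  shows "wp (concat (replicate m [s, t])) = (s \<otimes> t) [^] m"
proof (induction m)
  case (Suc m)
  then show ?case using assms nat_pow_Suc2[of "s \<otimes> t" m] by (simp add: m_assoc)
qed simp

text \<open>
  If \<open>(s t)\<^sup>m = 1\<close>, the reflections attached to the relator repeat with period \<open>m\<close>, and the relator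
  has length \<open>2 m\<close>. A pair of infinite order gives the empty relator.
\<close>

lemma even_refl_count_relator:
  assumes "s \<in> S" "t \<in> S" "x \<in> carrier W"
  shows "even (refl_count (concat (replicate (ord (s \<otimes> t)) [s, t])) x)"
proof -
  define m where "m = ord (s \<otimes> t)"
  have p: "(s \<otimes> t) [^] (i + m) = (s \<otimes> t) [^] i" for i
    using assms pow_ord_eq_1[of "s \<otimes> t"] by (simp add: m_def flip: nat_pow_mult)
  have split: "(\<Sum>i<n+m. f i) = (\<Sum>i<n. f i) + (\<Sum>i<m. f (i + n))" for f :: "nat \<Rightarrow> nat" and n m
    by (induction m) (auto simp: add.commute)
  have "(\<Sum>i<2*m. of_bool (x = (s \<otimes> t) [^] i \<otimes> s)::nat)
     = (\<Sum>i<m. of_bool (x = (s \<otimes> t) [^] i \<otimes> s)) + (\<Sum>i<m. of_bool (x = (s \<otimes> t) [^] (i + m) \<otimes> s))"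
    unfolding mult_2 by (rule split)
  then show ?thesis
    using assms by (simp add: refl_count_dihedral m_def[symmetric] p)
qed

text \<open>
  A relator has product 1, so inserting it leaves the reflections of the letters behind it
  unchanged and adds only its own.
\<close>

lemma even_refl_count_insertion:
  assumes "(us, vs) \<in> relator_insertions W S" "x \<in> carrier W"
  shows "even (refl_count us x) = even (refl_count vs x)"
proof -
  obtain as bs s t where *: "as \<in> lists S" "bs \<in> lists S" "s \<in> S" "t \<in> S"
    "us = as @ bs" "vs = as @ concat (replicate (ord (s \<otimes> t)) [s, t]) @ bs"
    using assms(1) unfolding relator_insertions_def by blast
  define r where "r = concat (replicate (ord (s \<otimes> t)) [s, t])"
  have "set r \<subseteq> {s, t}" by (auto simp: r_def)
  then have r: "r \<in> lists S" using * by auto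
  have wr: "wp r = \<one>" using * pow_ord_eq_1[of "s \<otimes> t"] by (simp add: r_def wp_dihedral)
  let ?y = "inv (wp as) \<otimes> x \<otimes> wp as"
  have y: "?y \<in> carrier W" using * assms by simp
  have rb: "r @ bs \<in> lists S" using r *(2) by auto
  have "refl_count vs x = refl_count as x + refl_count (r @ bs) ?y"
    unfolding *(6) r_def[symmetric] using *(1) rb assms(2) by (rule refl_count_append)
  also have "refl_count (r @ bs) ?y = refl_count r ?y + refl_count bs ?y"
    using refl_count_append[OF r *(2) y] wr y by simp
  also have "refl_count as x + \<dots> = refl_count us x + refl_count r ?y"
    unfolding *(5) using refl_count_append[OF *(1,2) assms(2)] by simp
  finally have "refl_count vs x = refl_count us x + refl_count r ?y" .
  then show ?thesis using even_refl_count_relator[of s t ?y] * y by (simp add: r_def)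
qed

text \<open>
  Words with the same product are connected by insertions and deletions of relators. Parity of the
  count is therefore a function on the group.
\<close>

lemma even_refl_count_cong:
  assumes "us \<in> lists S" "vs \<in> lists S" "wp us = wp vs" "x \<in> carrier W"
  shows "even (refl_count us x) = even (refl_count vs x)"
  using presentation[OF assms(1-3)]
proof (induction rule: rtrancl_induct)
  case (step y z)
  then show ?case using even_refl_count_insertion assms(4) by (metis UnE converseD)
qed simp

text \<open>
  Multiplying by the \<open>i\<close>-th attached reflection deletes the \<open>i\<close>-th letter.
\<close>

lemma refl_count_deletion:
  assumes "ws \<in> lists S" "t \<in> carrier W" "refl_count ws t > 0"
  shows "\<exists>us s vs. ws = us @ s # vs \<and> t \<otimes> wp ws = wp (us @ vs)"
  using assms
proof (induction ws arbitrary: t rule: list.induct)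
  case (Cons s ws)
  have l: "s \<in> S" "ws \<in> lists S" using Cons.prems(1) by simp_all
  show ?case
  proof (cases "t = s")
    case True
    then show ?thesis using l by (intro exI[of _ "[]"]) simp
  next
    case False
    have c: "s \<in> carrier W" "s \<otimes> t \<otimes> s \<in> carrier W" using l Cons.prems(2) by simp_all
    then obtain us s' vs where *: "ws = us @ s' # vs" "(s \<otimes> t \<otimes> s) \<otimes> wp ws = wp (us @ vs)"
      using Cons.IH[OF l(2), of "s \<otimes> t \<otimes> s"] Cons.prems(3) False by auto
    have "t \<otimes> wp (s # ws) = s \<otimes> ((s \<otimes> t \<otimes> s) \<otimes> wp ws)"
      using l Cons.prems(2) by (simp add: m_assoc)
    then show ?thesis using * by (intro exI[of _ "s # us"]) auto
  qed
qed simp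

lemma reflectionE:
  assumes "t \<in> reflections W S"
  obtains us s where "us \<in> lists S" "s \<in> S" "t = wp (us @ s # rev us)"
proof -
  obtain w s where ws: "w \<in> carrier W" "s \<in> S" "t = w \<otimes> s \<otimes> inv w"
    using assms unfolding reflections_def by auto
  obtain us where "us \<in> lists S" "wp us = w" using word_exists ws by blast
  then show ?thesis using that[of us s] ws by (simp add: wp_append wp_rev m_assoc)
qed

lemma reflection_closed [simp]: "t \<in> reflections W S \<Longrightarrow> t \<in> carrier W"
  unfolding reflections_def by auto

lemma reflection_involutive: "t \<in> reflections W S \<Longrightarrow> t \<otimes> t = \<one>"
proof -
  assume "t \<in> reflections W S"
  then obtain w s where ws: "w \<in> carrier W" "s \<in> S" "t = w \<otimes> s \<otimes> inv w"
    unfolding reflections_def by auto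
  have "t \<otimes> t = w \<otimes> (s \<otimes> ((inv w \<otimes> w) \<otimes> (s \<otimes> inv w)))"
    unfolding ws(3) using ws(1,2) by (simp only: m_assoc m_closed inv_closed gen_carrier)
  then show ?thesis using ws(1,2) by simp
qed

lemma reflection_conj:
  assumes "t \<in> reflections W S" "w \<in> carrier W"
  shows "w \<otimes> t \<otimes> inv w \<in> reflections W S"
proof -
  obtain v s where vs: "v \<in> carrier W" "s \<in> S" "t = v \<otimes> s \<otimes> inv v"
    using assms unfolding reflections_def by auto
  have "w \<otimes> t \<otimes> inv w = (w \<otimes> v) \<otimes> s \<otimes> inv (w \<otimes> v)"
    using vs assms by (simp add: inv_mult_group m_assoc)
  then show ?thesis using vs assms unfolding reflections_def by blast
qed

lemma gen_reflection: "s \<in> S \<Longrightarrow> s \<in> reflections W S"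
  unfolding reflections_def by (auto intro!: exI[of _ \<one>] exI[of _ s])

text \<open>
  Deleting the middle letter of the palindrome leaves a word with product 1, in which \<open>t\<close> occurs an
  even number of times; the middle letter contributes one more occurrence.
\<close>

lemma odd_refl_count_reflection:
  assumes "us \<in> lists S" "s \<in> S" "t = wp (us @ s # rev us)"
  shows "odd (refl_count (us @ s # rev us) t)"
proof -
  have c: "wp us \<in> carrier W" "s \<in> carrier W" "t \<in> carrier W" using assms by (auto simp: wp_append wp_rev)
  have t: "inv (wp us) \<otimes> t \<otimes> wp us = s"
    using assms c by (simp add: wp_append wp_rev m_assoc inv_cancel_left)
  have "even (refl_count (us @ rev us) t)"
    using even_refl_count_cong[of "us @ rev us" "[]" t] assms c by (simp add: wp_append wp_rev)
  then show ?thesis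
    using assms c t by (simp add: refl_count_append m_assoc generators_involutive)
qed

text \<open>
  If \<open>t\<close> occurred an even number of times in \<open>ws\<close>, it would occur an odd number of times in a
  reduced word of \<open>t w\<close>, where \<open>w\<close> is the product of \<open>ws\<close>: the two parities differ by the one of a word for
  \<open>t\<close> itself. Deleting a letter there would make \<open>w\<close> shorter than \<open>t w\<close>. So the parity is odd, and \<open>t\<close> occurs in \<open>ws\<close>.
  Assuming \<open>\<le>\<close> instead of \<open><\<close> between the lengths makes the exclusion of equality a corollary.
\<close>

lemma strong_exchange:
  assumes t: "t \<in> reflections W S" and ws: "ws \<in> lists S"
    and le: "\<ell> (t \<otimes> wp ws) \<le> \<ell> (wp ws)"
  obtains us s vs where "ws = us @ s # vs" "t \<otimes> wp ws = wp (us @ vs)"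
proof -
  obtain as s where as: "as \<in> lists S" "s \<in> S" "t = wp (as @ s # rev as)"
    using reflectionE[OF t] .
  let ?r = "as @ s # rev as"
  have r: "?r \<in> lists S" using as by auto
  obtain zs where zs: "reduced zs" "wp zs = t \<otimes> wp ws"
    using reduced_word_exists[of "t \<otimes> wp ws"] t ws by auto
  have zl: "zs \<in> lists S" using zs by (simp add: reduced_def)
  have tt: "t \<otimes> (t \<otimes> wp ws) = wp ws"
    using t ws reflection_involutive[OF t] by (simp flip: m_assoc)
  have "odd (refl_count ws t)"
  proof
    assume ev: "even (refl_count ws t)"
    have "wp (?r @ zs) = wp ws"
      using wp_append[OF r zl] as(3) tt zs(2) by metis
    then have "even (refl_count (?r @ zs) t)"
      using even_refl_count_cong[of "?r @ zs" ws t] r zl ws t ev by auto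
    moreover have "refl_count (?r @ zs) t = refl_count ?r t + refl_count zs t"
    proof -
      have "inv (wp ?r) \<otimes> t \<otimes> wp ?r = t" unfolding as(3)[symmetric] using t by simp
      then show ?thesis using refl_count_append[OF r zl, of t] t by simp
    qed
    ultimately have "refl_count zs t > 0"
      using odd_refl_count_reflection[OF as] by (metis even_add gr0I even_zero)
    then obtain us s' vs where d: "zs = us @ s' # vs" "t \<otimes> wp zs = wp (us @ vs)"
      using refl_count_deletion[OF zl, of t] t by auto
    have "us @ vs \<in> lists S" using zl d(1) by auto
    then have "\<ell> (wp ws) \<le> length (us @ vs)"
      using d tt zs(2) len_le by metis
    also have "\<dots> < \<ell> (t \<otimes> wp ws)" using zs d(1) by (auto simp: reduced_def)
    finally show False using le by simp
  qed
  then have "refl_count ws t > 0" by (auto intro: gr0I)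
  from refl_count_deletion[OF ws _ this] t show ?thesis using that by auto
qed

lemma len_reflection_neq:
  assumes "t \<in> reflections W S" "w \<in> carrier W"
  shows "\<ell> (t \<otimes> w) \<noteq> \<ell> w"
proof
  assume eq: "\<ell> (t \<otimes> w) = \<ell> w"
  obtain ws where ws: "reduced ws" "wp ws = w" using reduced_word_exists assms by blast
  then obtain us s vs where d: "ws = us @ s # vs" "t \<otimes> w = wp (us @ vs)"
    using strong_exchange[OF assms(1), of ws] eq by (auto simp: reduced_def)
  have "us @ vs \<in> lists S" using ws d(1) by (auto simp: reduced_def)
  then have "\<ell> (t \<otimes> w) \<le> length us + length vs" using len_le d(2) by fastforce
  then show False using eq ws d(1) by (auto simp: reduced_def)
qed

lemma len_gen_mult:
  assumes "s \<in> S" "w \<in> carrier W"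
  shows "\<ell> (s \<otimes> w) = Suc (\<ell> w) \<or> \<ell> w = Suc (\<ell> (s \<otimes> w))"
proof -
  have "\<ell> (s \<otimes> w) \<le> 1 + \<ell> w" "\<ell> w \<le> 1 + \<ell> (s \<otimes> w)"
    using len_mult_le[of s w] len_mult_le[of s "s \<otimes> w"] len_gen_le[of s] assms by auto
  then show ?thesis using len_reflection_neq[OF gen_reflection, of s w] assms by linarith
qed

lemma len_inv_le:
  assumes "w \<in> carrier W"
  shows "\<ell> (inv w) \<le> \<ell> w"
proof -
  obtain ws where "reduced ws" "wp ws = w" using reduced_word_exists assms by blast
  then show ?thesis using len_le[of "rev ws"] by (auto simp: reduced_def wp_rev)
qed

lemma len_inv [simp]: "w \<in> carrier W \<Longrightarrow> \<ell> (inv w) = \<ell> w"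
  using len_inv_le[of w] len_inv_le[of "inv w"] by simp

lemma len_mult_gen:
  assumes "s \<in> S" "w \<in> carrier W"
  shows "\<ell> (w \<otimes> s) = Suc (\<ell> w) \<or> \<ell> w = Suc (\<ell> (w \<otimes> s))"
  using len_gen_mult[of s "inv w"] len_inv[of "w \<otimes> s"] assms by (simp add: inv_mult_group)

text \<open>
  Induction on the word: either prefixing the next letter to a reduced word keeps it
  reduced, or the exchange condition removes both that letter and another one.
\<close>

lemma reduced_subword:
  assumes "ws \<in> lists S"
  obtains vs where "subseq vs ws" "reduced vs" "wp vs = wp ws"
proof -
  have "\<exists>vs. subseq vs ws \<and> reduced vs \<and> wp vs = wp ws"
    using assms
  proof (induction ws rule: list.induct)
    case Nil
    then show ?case by (intro exI[of _ "[]"]) (auto simp: reduced_def)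
  next
    case (Cons s ws)
    then obtain vs where vs: "subseq vs ws" "reduced vs" "wp vs = wp ws" by auto
    have vl: "vs \<in> lists S" "s \<in> S" using vs(2) Cons.prems by (simp_all add: reduced_def)
    from len_gen_mult[of s "wp vs"] show ?case
    proof
      assume "\<ell> (s \<otimes> wp vs) = Suc (\<ell> (wp vs))"
      then show ?thesis using vs vl by (intro exI[of _ "s # vs"]) (auto simp: reduced_def)
    next
      assume a: "\<ell> (wp vs) = Suc (\<ell> (s \<otimes> wp vs))"
      then obtain us x us' where d: "vs = us @ x # us'" "s \<otimes> wp vs = wp (us @ us')"
        using strong_exchange[OF gen_reflection, of s vs] vl by auto
      have "subseq (us @ us') vs" unfolding d(1) by (intro list_emb_append_mono) auto
      then have "subseq (us @ us') (s # ws)"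
        using vs(1) by (meson list_emb_Cons subseq_order.order_trans)
      moreover have "reduced (us @ us')"
        using a d vl vs(2) by (auto simp: reduced_def)
      moreover have "wp (us @ us') = wp (s # ws)" using d(2) vs(3) by simp
      ultimately show ?thesis by blast
    qed (use vl in auto)
  qed
  then show ?thesis using that by blast
qed

section \<open>Bruhat order\<close>

lemma bruhat_le_refl [simp]: "w \<in> carrier W \<Longrightarrow> bruhat_le W S w w"
  by (simp add: bruhat_le_def)

lemma bruhat_le_trans: "bruhat_le W S x y \<Longrightarrow> bruhat_le W S y z \<Longrightarrow> bruhat_le W S x z"
  by (auto simp: bruhat_le_def intro: rtrancl_trans)

lemma bruhat_le_carrier: "bruhat_le W S x y \<Longrightarrow> x \<in> carrier W \<and> y \<in> carrier W"
  by (simp add: bruhat_le_def)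

lemma bruhat_le_len:
  assumes "bruhat_le W S x w"
  shows "x = w \<or> \<ell> x < \<ell> w"
proof -
  have "(x, w) \<in> {(u, u \<otimes> t) | u t. u \<in> carrier W \<and> t \<in> reflections W S \<and> \<ell> u < \<ell> (u \<otimes> t)}\<^sup>*"
    using assms by (simp add: bruhat_le_def)
  then show ?thesis by (induction rule: rtrancl_induct) auto
qed

text \<open>
  Each step down in the Bruhat order multiplies by a reflection and lowers the length, hence deletes
  a letter of any given word by strong exchange. The definition multiplies on the right,
  so the reflection is first conjugated to the left.
\<close>

lemma bruhat_le_subword:
  assumes "bruhat_le W S x w" "ws \<in> lists S" "wp ws = w"
  shows "\<exists>vs. subseq vs ws \<and> wp vs = x"
proof -
  have "(x, w) \<in> {(u, u \<otimes> t) | u t. u \<in> carrier W \<and> t \<in> reflections W S \<and> \<ell> u < \<ell> (u \<otimes> t)}\<^sup>*"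
    using assms by (simp add: bruhat_le_def)
  then have "\<forall>ws \<in> lists S. wp ws = w \<longrightarrow> (\<exists>vs. subseq vs ws \<and> wp vs = x)"
  proof (induction rule: rtrancl_induct)
    case base
    then show ?case by auto
  next
    case (step y z)
    then obtain t where t: "y \<in> carrier W" "t \<in> reflections W S" "z = y \<otimes> t" "\<ell> y < \<ell> (y \<otimes> t)" by blast
    show ?case
    proof (intro ballI impI)
      fix ws assume ws: "ws \<in> lists S" "wp ws = z"
      define r where "r = z \<otimes> t \<otimes> inv z"
      have c: "t \<in> carrier W" "z \<in> carrier W" using t by auto
      have r: "r \<in> reflections W S" using reflection_conj t c by (auto simp: r_def)
      have yt: "r \<otimes> wp ws = y"
        using c t reflection_involutive[OF t(2)] by (simp add: r_def ws(2) m_assoc)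
      obtain us s vs where d: "ws = us @ s # vs" "y = wp (us @ vs)"
        using strong_exchange[OF r ws(1)] unfolding yt using ws t by auto
      have "us @ vs \<in> lists S" using ws d by auto
      then obtain vs' where "subseq vs' (us @ vs)" "wp vs' = x" using step.IH d by blast
      moreover have "subseq (us @ vs) ws" unfolding d(1) by (intro list_emb_append_mono) auto
      ultimately show "\<exists>vs. subseq vs ws \<and> wp vs = x" by (blast intro: subseq_order.order_trans)
    qed
  qed
  then show ?thesis using assms by blast
qed

lemma finite_bruhat_le: "finite {x. bruhat_le W S x w}"
proof (cases "w \<in> carrier W")
  case True
  then obtain ws where ws: "ws \<in> lists S" "wp ws = w" using word_exists by blast
  have "{x. bruhat_le W S x w} \<subseteq> wp ` {vs. subseq vs ws}"
    using bruhat_le_subword ws by blast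
  moreover have "{vs. subseq vs ws} = set (subseqs ws)" by auto
  ultimately show ?thesis by (metis finite_imageI finite_set finite_subset)
qed (auto simp: bruhat_le_def)

lemma bruhat_le_gen_mult:
  assumes "s \<in> S" "w \<in> carrier W" "\<ell> w < \<ell> (s \<otimes> w)"
  shows "bruhat_le W S w (s \<otimes> w)"
proof -
  have "inv w \<otimes> s \<otimes> w \<in> reflections W S"
    using reflection_conj[OF gen_reflection[OF assms(1)], of "inv w"] assms by simp
  moreover have "w \<otimes> (inv w \<otimes> s \<otimes> w) = s \<otimes> w" using assms by (simp flip: m_assoc)
  ultimately show ?thesis using assms unfolding bruhat_le_def by (force intro!: r_into_rtrancl)
qed

lemma bruhat_le_mult_gen:
  assumes "s \<in> S" "w \<in> carrier W" "\<ell> w < \<ell> (w \<otimes> s)"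
  shows "bruhat_le W S w (w \<otimes> s)"
  using assms gen_reflection unfolding bruhat_le_def by (force intro!: r_into_rtrancl)

lemma bruhat_le_suffix: "reduced (us @ vs) \<Longrightarrow> bruhat_le W S (wp vs) (wp (us @ vs))"
proof (induction us)
  case (Cons s us)
  have r: "reduced (us @ vs)" using reduced_append(2)[of "[s]" "us @ vs"] Cons.prems by simp
  have "bruhat_le W S (wp (us @ vs)) (wp (s # us @ vs))"
    unfolding wp_Cons by (rule bruhat_le_gen_mult) (use Cons.prems r in \<open>auto simp: reduced_def\<close>)
  then show ?case using Cons.IH r bruhat_le_trans by simp
qed (auto simp: reduced_def)

lemma bruhat_le_prefix: "reduced (us @ vs) \<Longrightarrow> bruhat_le W S (wp us) (wp (us @ vs))"
proof (induction vs rule: rev_induct)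
  case (snoc s vs)
  have r: "reduced (us @ vs)" using reduced_append(1)[of "us @ vs" "[s]"] snoc.prems by simp
  have l: "us @ vs \<in> lists S" "s \<in> S" using snoc.prems by (auto simp: reduced_def)
  have e: "wp (us @ vs @ [s]) = wp (us @ vs) \<otimes> s" using wp_append[of "us @ vs" "[s]"] l by simp
  have "bruhat_le W S (wp (us @ vs)) (wp (us @ vs @ [s]))"
    unfolding e by (rule bruhat_le_mult_gen) (use snoc.prems r l e in \<open>auto simp: reduced_def\<close>)
  then show ?case using snoc.IH r bruhat_le_trans by blast
qed (auto simp: reduced_def)

end

section \<open>Double cosets and their minimal representatives\<close>

context parabolic_coxeter_system
begin

abbreviation WJ where "WJ \<equiv> generate W J"
abbreviation rep where "rep \<equiv> min_rep W S"
abbreviation DC where "DC \<equiv> double_cosets W J"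

lemma lists_J: "ws \<in> lists J \<Longrightarrow> ws \<in> lists S"
  using parabolic_generators by auto

lemma WJ_closed: "u \<in> WJ \<Longrightarrow> u \<in> carrier W"
  using generate_in_carrier[of J] parabolic_generators generators_closed by auto

lemma WJ_subgroup: "subgroup WJ W"
  using generate_is_subgroup[of J] parabolic_generators generators_closed by auto

lemma WJ_mult: "u \<in> WJ \<Longrightarrow> v \<in> WJ \<Longrightarrow> u \<otimes> v \<in> WJ"
  by (rule generate.eng)

lemma WJ_inv: "u \<in> WJ \<Longrightarrow> inv u \<in> WJ"
  by (rule subgroup.m_inv_closed[OF WJ_subgroup])

lemma WJ_one: "\<one> \<in> WJ" by (rule generate.one)

lemma WJ_J: "s \<in> J \<Longrightarrow> s \<in> WJ" by (rule generate.incl)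

text \<open>
  The double coset of \<open>w\<close> as a set of triple products, which is easier to take apart than nested coset
  products.
\<close>

definition dcoset :: "'a \<Rightarrow> 'a set" where
  "dcoset w = {u \<otimes> w \<otimes> v | u v. u \<in> WJ \<and> v \<in> WJ}"

lemma dcoset_eq: "(WJ #> w) <#> WJ = dcoset w"
proof -
  have "x \<in> (WJ #> w) <#> WJ \<longleftrightarrow> x \<in> dcoset w" for x
    unfolding dcoset_def set_mult_def r_coset_def by simp metis
  then show ?thesis by blast
qed

lemma DC_eq: "DC = dcoset ` carrier W"
  unfolding double_cosets_def dcoset_eq by (rule Setcompr_eq_image)

lemma dcoset_self [simp]: "w \<in> carrier W \<Longrightarrow> w \<in> dcoset w"
  unfolding dcoset_def mem_Collect_eq using WJ_one by (intro exI[of _ \<one>]) simp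

lemma dcoset_mono:
  assumes "w \<in> carrier W" "y \<in> dcoset w"
  shows "dcoset y \<subseteq> dcoset w" "w \<in> dcoset y" "y \<in> carrier W"
proof -
  obtain u v where uv: "u \<in> WJ" "v \<in> WJ" "y = u \<otimes> w \<otimes> v" using assms by (auto simp: dcoset_def)
  have c: "u \<in> carrier W" "v \<in> carrier W" using uv WJ_closed by auto
  show "dcoset y \<subseteq> dcoset w"
  proof
    fix z assume "z \<in> dcoset y"
    then obtain a b where ab: "a \<in> WJ" "b \<in> WJ" "z = a \<otimes> y \<otimes> b" by (auto simp: dcoset_def)
    have "z = (a \<otimes> u) \<otimes> w \<otimes> (v \<otimes> b)"
      using ab uv assms c WJ_closed[OF ab(1)] WJ_closed[OF ab(2)] by (simp add: m_assoc)
    then show "z \<in> dcoset w" unfolding dcoset_def using ab uv WJ_mult by blast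
  qed
  have "w = inv u \<otimes> y \<otimes> inv v" using uv(3) c assms(1) by (simp add: m_assoc inv_cancel_left)
  then show "w \<in> dcoset y" unfolding dcoset_def using uv WJ_inv by blast
  show "y \<in> carrier W" using uv c assms by simp
qed

lemma dcoset_eqI: "w \<in> carrier W \<Longrightarrow> y \<in> dcoset w \<Longrightarrow> dcoset y = dcoset w"
  by (meson dcoset_mono subset_antisym)

lemma dcoset_DC: "w \<in> carrier W \<Longrightarrow> dcoset w \<in> DC"
  by (simp add: DC_eq)

lemma DC_dcoset: "D \<in> DC \<Longrightarrow> y \<in> D \<Longrightarrow> D = dcoset y"
  unfolding DC_eq by (metis dcoset_eqI imageE)

lemma DC_carrier: "D \<in> DC \<Longrightarrow> y \<in> D \<Longrightarrow> y \<in> carrier W"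
  unfolding DC_eq by (metis dcoset_mono(3) imageE)

lemma DC_finite: "D \<in> DC \<Longrightarrow> finite D"
proof -
  assume "D \<in> DC"
  then obtain w where D: "D = dcoset w" by (auto simp: DC_eq)
  have "dcoset w = (\<lambda>(u, v). u \<otimes> w \<otimes> v) ` (WJ \<times> WJ)"
    unfolding dcoset_def by force
  then show ?thesis unfolding D using parabolic_finite by simp
qed

lemma DC_mult_J:
  assumes "D \<in> DC" "s \<in> J" "w \<in> carrier W"
  shows "s \<otimes> w \<in> D \<longleftrightarrow> w \<in> D" "w \<otimes> s \<in> D \<longleftrightarrow> w \<in> D"
proof -
  have s: "s \<in> S" "s \<in> carrier W" using assms parabolic_generators by auto
  have c: "s \<otimes> y \<in> D" "y \<otimes> s \<in> D" if "y \<in> D" for y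
  proof -
    have y: "y \<in> carrier W" and D: "D = dcoset y" using DC_carrier DC_dcoset assms that by auto
    have "s \<otimes> y = s \<otimes> y \<otimes> \<one>" "y \<otimes> s = \<one> \<otimes> y \<otimes> s" using s y by simp_all
    then show "s \<otimes> y \<in> D" "y \<otimes> s \<in> D"
      unfolding D dcoset_def using WJ_one WJ_J[OF assms(2)] by blast+
  qed
  show "s \<otimes> w \<in> D \<longleftrightarrow> w \<in> D" "w \<otimes> s \<in> D \<longleftrightarrow> w \<in> D"
    using c[of w] c(1)[of "s \<otimes> w"] c(2)[of "w \<otimes> s"] gen_cancel[of s w] gen_cancel_right[of s w]
      assms(3) s by metis+
qed

lemma lists_subseq: "subseq vs ws \<Longrightarrow> ws \<in> lists K \<Longrightarrow> vs \<in> lists K"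
  by (auto elim: list_emb_set)

lemma reduced_WJ:
  assumes "u \<in> WJ"
  obtains us where "us \<in> lists J" "reduced us" "wp us = u"
proof -
  obtain us where us: "us \<in> lists J" "wp us = u"
    using generate_word[OF parabolic_generators assms] .
  obtain vs where "subseq vs us" "reduced vs" "wp vs = wp us"
    using reduced_subword lists_J us(1) by blast
  moreover have "vs \<in> lists J" using calculation(1) us(1) by (rule lists_subseq)
  ultimately show ?thesis using that us by auto
qed

text \<open>
  Write \<open>y = u x v\<close> and pass to a reduced subword of a word for the right-hand side. Whatever
  remains of the word of \<open>x\<close> still has its product in the double coset, so by minimality of \<open>x\<close> no letter of it was
  deleted.
\<close>

lemma min_length_factorisation:
  assumes D: "D \<in> DC" and x: "x \<in> D" and min: "\<forall>y \<in> D. \<ell> x \<le> \<ell> y" and y: "y \<in> D"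
  shows "\<exists>us xs vs. us \<in> lists J \<and> vs \<in> lists J \<and> reduced (us @ xs @ vs) \<and> wp xs = x
      \<and> wp (us @ xs @ vs) = y"
proof -
  have xc: "x \<in> carrier W" using DC_carrier D x by auto
  obtain u v where uv: "u \<in> WJ" "v \<in> WJ" "y = u \<otimes> x \<otimes> v"
    using DC_dcoset[OF D x] y by (auto simp: dcoset_def)
  obtain us vs where us: "us \<in> lists J" "wp us = u" and vs: "vs \<in> lists J" "wp vs = v"
    using generate_word[OF parabolic_generators] uv by metis
  obtain xs where xs: "reduced xs" "wp xs = x" using reduced_word_exists xc by blast
  have l: "us \<in> lists S" "vs \<in> lists S" "xs \<in> lists S" using us vs xs lists_J by (auto simp: reduced_def)
  have y': "wp (us @ xs @ vs) = y"
    using uv us vs xs l by (auto simp: wp_append m_assoc)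
  obtain zs where zs: "subseq zs (us @ xs @ vs)" "reduced zs" "wp zs = y"
    using reduced_subword[of "us @ xs @ vs"] l y' by auto
  obtain us' xs' vs' where z: "zs = us' @ xs' @ vs'" "subseq us' us" "subseq xs' xs" "subseq vs' vs"
    using zs(1) by (metis subseq_append_iff)
  have J': "us' \<in> lists J" "vs' \<in> lists J"
    using lists_subseq[OF z(2) us(1)] lists_subseq[OF z(4) vs(1)] by auto
  have l': "us' \<in> lists S" "vs' \<in> lists S" "xs' \<in> lists S" using zs(2) z(1) by (auto simp: reduced_def)
  have yx: "y = wp us' \<otimes> wp xs' \<otimes> wp vs'" using zs z l' by (auto simp: wp_append m_assoc)
  have "wp us' \<in> WJ" "wp vs' \<in> WJ" using wp_generate[OF parabolic_generators] J' by simp_all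
  then have "y \<in> dcoset (wp xs')" unfolding dcoset_def yx by blast
  then have "wp xs' \<in> D" using dcoset_mono(2)[of "wp xs'" y] l' DC_dcoset[OF D y] by simp
  then have "length xs \<le> length xs'"
    using min xs len_le[OF l'(3)] unfolding reduced_def by (metis le_trans)
  then have "xs' = xs"
    using list_emb_length[OF z(3)] subseq_same_length[OF z(3)] by simp
  then show ?thesis using J' zs z xs by blast
qed

lemma min_length_unique:
  assumes D: "D \<in> DC" and x: "x \<in> D" "\<forall>y \<in> D. \<ell> x \<le> \<ell> y" and x': "x' \<in> D" "\<forall>y \<in> D. \<ell> x' \<le> \<ell> y"
  shows "x' = x"
proof -
  obtain us xs vs where f: "reduced (us @ xs @ vs)" "wp xs = x" "wp (us @ xs @ vs) = x'"
    using min_length_factorisation[OF D x x'(1)] by blast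
  have "\<ell> x' = \<ell> x" using x x' by (meson le_antisym)
  moreover have "length (us @ xs @ vs) = \<ell> x'" using f by (simp add: reduced_def)
  moreover have "\<ell> x = length xs"
    using f reduced_append[of us "xs @ vs"] reduced_append[of xs vs] by (simp add: reduced_def)
  ultimately have "us = []" "vs = []" by auto
  then show ?thesis using f by simp
qed

lemma rep_min:
  assumes D: "D \<in> DC"
  shows "rep D \<in> D" "\<And>y. y \<in> D \<Longrightarrow> \<ell> (rep D) \<le> \<ell> y"
proof -
  obtain w where "w \<in> D" using D unfolding DC_eq by (metis dcoset_self imageE)
  then obtain x where x: "x \<in> D" "\<forall>y \<in> D. \<ell> x \<le> \<ell> y"
    using ex_has_least_nat[of "\<lambda>x. x \<in> D" w \<ell>] by auto
  have "rep D = x"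
    unfolding min_rep_def
  proof (rule the_equality)
    show "x \<in> D \<and> (\<forall>y \<in> D. \<ell> x \<le> \<ell> y)" using x by simp
    show "x' = x" if "x' \<in> D \<and> (\<forall>y \<in> D. \<ell> x' \<le> \<ell> y)" for x'
      using min_length_unique[OF D x] that by simp
  qed
  then show "rep D \<in> D" "\<And>y. y \<in> D \<Longrightarrow> \<ell> (rep D) \<le> \<ell> y" using x by simp_all
qed

lemma rep_carrier [simp]: "D \<in> DC \<Longrightarrow> rep D \<in> carrier W"
  by (rule DC_carrier[OF _ rep_min(1)])

lemma rep_inj: "D \<in> DC \<Longrightarrow> D' \<in> DC \<Longrightarrow> rep D = rep D' \<Longrightarrow> D = D'"
  using DC_dcoset[OF _ rep_min(1), of D] DC_dcoset[OF _ rep_min(1), of D'] by simp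

lemma rep_factorisation:
  assumes "D \<in> DC" "y \<in> D"
  obtains us xs vs where "us \<in> lists J" "vs \<in> lists J" "reduced (us @ xs @ vs)" "wp xs = rep D"
    "wp (us @ xs @ vs) = y"
proof -
  have "\<forall>z \<in> D. \<ell> (rep D) \<le> \<ell> z" using rep_min(2)[OF assms(1)] by simp
  from min_length_factorisation[OF assms(1) rep_min(1)[OF assms(1)] this assms(2)] that
  show ?thesis by (elim exE conjE)
qed

text \<open>
  The minimal representative appears as a consecutive piece of a reduced word of \<open>y\<close>.
\<close>

lemma rep_bruhat_le:
  assumes "D \<in> DC" "y \<in> D"
  shows "bruhat_le W S (rep D) y"
proof -
  obtain us xs vs where f: "reduced (us @ xs @ vs)" "wp xs = rep D" "wp (us @ xs @ vs) = y"
    using rep_factorisation[OF assms] .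
  have "reduced (xs @ vs)" by (rule reduced_append(2)[OF f(1)])
  then show ?thesis using bruhat_le_trans[OF bruhat_le_prefix[of xs vs] bruhat_le_suffix[OF f(1)]] f by simp
qed

lemma coset_le_len: "coset_le W S D' D \<Longrightarrow> D \<in> DC \<Longrightarrow> D' \<in> DC \<Longrightarrow> D' = D \<or> \<ell> (rep D') < \<ell> (rep D)"
  unfolding coset_le_def using bruhat_le_len[of "rep D'" "rep D"] rep_inj[of D' D] by auto

lemma finite_coset_le: "finite {D' \<in> DC. coset_le W S D' D}"
proof (rule inj_on_finite)
  show "inj_on rep {D' \<in> DC. coset_le W S D' D}" 
    by (rule inj_onI) (simp add: rep_inj)
  show "rep ` {D' \<in> DC. coset_le W S D' D} \<subseteq> {x. bruhat_le W S x (rep D)}" by (auto simp: coset_le_def)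
qed (rule finite_bruhat_le)

end

section \<open>Rational functions and the substitution of the inverse variable\<close>

lemma cring_q_field: "cring q_field"
proof (intro cringI abelian_groupI comm_monoidI)
  fix x assume "x \<in> carrier q_field"
  then show "\<exists>y\<in>carrier q_field. y \<oplus>\<^bsub>q_field\<^esub> x = \<zero>\<^bsub>q_field\<^esub>"
    by (intro bexI[of _ "- x"]) (auto simp: q_field_def)
qed (auto simp: q_field_def algebra_simps)

lemma q_field_minus: "\<ominus>\<^bsub>q_field\<^esub> x = - x"
proof -
  interpret cring q_field by (rule cring_q_field)
  show ?thesis using minus_equality[of "- x" x] by (simp add: q_field_def)
qed

lemma generate_q_field_closed:
  shows "1 \<in> generate_ring q_field G" "0 \<in> generate_ring q_field G"
    and "x \<in> generate_ring q_field G \<Longrightarrow> - x \<in> generate_ring q_field G"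
    and "x \<in> generate_ring q_field G \<Longrightarrow> y \<in> generate_ring q_field G \<Longrightarrow> x + y \<in> generate_ring q_field G"
    and "x \<in> generate_ring q_field G \<Longrightarrow> y \<in> generate_ring q_field G \<Longrightarrow> x * y \<in> generate_ring q_field G"
    and "x \<in> G \<Longrightarrow> x \<in> generate_ring q_field G"
proof -
  interpret cring q_field by (rule cring_q_field)
  show "1 \<in> generate_ring q_field G" using generate_ring.one[of q_field G] by (simp add: q_field_def)
  show "0 \<in> generate_ring q_field G" using zero_in_generate[of G] by (simp add: q_field_def)
  show "x \<in> generate_ring q_field G \<Longrightarrow> - x \<in> generate_ring q_field G"
    using generate_ring.a_inv[of x q_field G] by (simp add: q_field_minus)
  show "x \<in> generate_ring q_field G \<Longrightarrow> y \<in> generate_ring q_field G \<Longrightarrow> x + y \<in> generate_ring q_field G"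
    using generate_ring.eng_add[of x q_field G y] by (simp add: q_field_def)
  show "x \<in> generate_ring q_field G \<Longrightarrow> y \<in> generate_ring q_field G \<Longrightarrow> x * y \<in> generate_ring q_field G"
    using generate_ring.eng_mult[of x q_field G y] by (simp add: q_field_def)
  show "x \<in> G \<Longrightarrow> x \<in> generate_ring q_field G" by (rule generate_ring.incl)
qed

lemma generate_q_field_induct [consumes 1, case_names one incl uminus add mult]:
  assumes "x \<in> generate_ring q_field G"
    and "P 1" "\<And>x. x \<in> G \<Longrightarrow> P x"
    and "\<And>x. x \<in> generate_ring q_field G \<Longrightarrow> P x \<Longrightarrow> P (- x)"
    and "\<And>x y. x \<in> generate_ring q_field G \<Longrightarrow> y \<in> generate_ring q_field G \<Longrightarrow> P x \<Longrightarrow> P y \<Longrightarrow> P (x + y)"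
    and "\<And>x y. x \<in> generate_ring q_field G \<Longrightarrow> y \<in> generate_ring q_field G \<Longrightarrow> P x \<Longrightarrow> P y \<Longrightarrow> P (x * y)"
  shows "P x"
  using assms(1)
proof (induction rule: generate_ring.induct)
  case one
  then show ?case using assms(2) by (simp add: q_field_def)
next
  case (incl h)
  then show ?case by (rule assms(3))
next
  case (a_inv h)
  then show ?case using assms(4)[of h] by (simp add: q_field_minus)
next
  case (eng_add h1 h2)
  then show ?case using assms(5)[of h1 h2] by (simp add: q_field_def)
next
  case (eng_mult h1 h2)
  then show ?case using assms(6)[of h1 h2] by (simp add: q_field_def)
qed

lemma generate_q_field_mono:
  assumes "G \<subseteq> generate_ring q_field G'"
  shows "generate_ring q_field G \<subseteq> generate_ring q_field G'"
proof
  fix x assume "x \<in> generate_ring q_field G"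
  then show "x \<in> generate_ring q_field G'"
    by (induction rule: generate_q_field_induct) (use assms in \<open>auto intro: generate_q_field_closed\<close>)
qed

lemma generate_q_field_power:
  "x \<in> generate_ring q_field G \<Longrightarrow> x ^ n \<in> generate_ring q_field G"
  by (induction n) (auto intro: generate_q_field_closed)

lemma to_fract_of_int: "to_fract [:c:] = (of_int c :: int poly fract)"
proof -
  have nat: "to_fract [:int n:] = (of_nat n :: int poly fract)" for n
  proof (induction n)
    case (Suc n)
    have "[:int (Suc n):] = 1 + [:int n:]" by (simp add: one_pCons)
    then show ?case using Suc by (simp only: to_fract_add to_fract_1 of_nat_Suc)
  qed simp
  show ?thesis
  proof (cases c)
    case (nonneg n)
    then show ?thesis by (simp add: nat)
  next
    case (neg n)
    have "to_fract [:c:] = - to_fract [:int (Suc n):]"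
      unfolding neg by (simp flip: to_fract_uminus)
    then show ?thesis using neg nat[of "Suc n"] by simp
  qed
qed

lemma to_fract_pCons: "to_fract (pCons c a) = of_int c + qvar * to_fract a"
proof -
  have "pCons c a = [:c:] + [:0, 1:] * a" by simp
  then show ?thesis by (simp only: to_fract_add to_fract_mult to_fract_of_int qvar_def)
qed

lemma qvar_nonzero [simp]: "qvar \<noteq> 0"
  by (simp add: qvar_def)

lemma qvar_power: "qvar ^ n = to_fract (monom 1 n)"
  by (induction n) (simp_all add: monom_Suc to_fract_pCons)

text \<open>
  Numerators and denominators in \<open>q_invert\<close> have this form.
\<close>

definition eval_inverse :: "int poly \<Rightarrow> int poly fract" where
  "eval_inverse a = poly (map_poly of_int a) (inverse qvar)"

lemma eval_inverse_0 [simp]: "eval_inverse 0 = 0"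
  by (simp add: eval_inverse_def)

lemma eval_inverse_pCons: "eval_inverse (pCons c a) = of_int c + inverse qvar * eval_inverse a"
  by (simp add: eval_inverse_def map_poly_pCons)

lemma eval_inverse_1 [simp]: "eval_inverse 1 = 1"
  by (simp add: one_pCons eval_inverse_pCons)

lemma eval_inverse_add: "eval_inverse (a + b) = eval_inverse a + eval_inverse b"
  by (induction a b rule: poly_induct2) (auto simp: eval_inverse_pCons algebra_simps)

lemma eval_inverse_smult: "eval_inverse (Polynomial.smult c a) = of_int c * eval_inverse a"
  by (induction a) (auto simp: eval_inverse_pCons algebra_simps)

lemma eval_inverse_mult: "eval_inverse (a * b) = eval_inverse a * eval_inverse b"
  by (induction a) (auto simp: eval_inverse_pCons eval_inverse_add eval_inverse_smult algebra_simps)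

text \<open>
  Multiplying \<open>b(q\<^sup>-\<^sup>1)\<close> by the top power of \<open>q\<close> gives the reversed polynomial, whose constant term is the
  leading coefficient of \<open>b\<close>. This shows that denominators stay nonzero under \<open>q \<mapsto> q\<^sup>-\<^sup>1\<close>, and that no
  nonzero element of \<open>q\<int>[q]\<close> is fixed.
\<close>

lemma eval_inverse_reverse:
  assumes "b \<noteq> 0"
  shows "\<exists>r. qvar ^ degree b * eval_inverse b = to_fract r \<and> coeff r 0 = lead_coeff b"
  using assms
proof (induction b)
  case (pCons c b)
  show ?case
  proof (cases "b = 0")
    case True
    then show ?thesis by (intro exI[of _ "[:c:]"]) (auto simp: eval_inverse_pCons to_fract_of_int)
  next
    case False
    then obtain r where r: "qvar ^ degree b * eval_inverse b = to_fract r" "coeff r 0 = lead_coeff b"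
      using pCons.IH by blast
    have "qvar ^ degree (pCons c b) * eval_inverse (pCons c b)
        = of_int c * qvar ^ Suc (degree b) + qvar ^ degree b * eval_inverse b"
      using False by (simp add: eval_inverse_pCons algebra_simps)
    also have "\<dots> = to_fract ([:c:] * monom 1 (Suc (degree b)) + r)"
      unfolding r(1) by (simp only: to_fract_add to_fract_mult to_fract_of_int qvar_power)
    finally have "qvar ^ degree (pCons c b) * eval_inverse (pCons c b)
        = to_fract ([:c:] * monom 1 (Suc (degree b)) + r)" .
    moreover have "coeff ([:c:] * monom 1 (Suc (degree b)) + r) 0 = lead_coeff (pCons c b)"
      using r(2) False by simp
    ultimately show ?thesis by blast
  qed
qed simp

lemma eval_inverse_nonzero: "b \<noteq> 0 \<Longrightarrow> eval_inverse b \<noteq> 0"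
  using eval_inverse_reverse[of b] by auto

text \<open>
  \<open>q_invert\<close> is defined through the normalised fraction; this makes any fraction admissible,
  from which the homomorphism properties follow.
\<close>

lemma q_invert_divide:
  assumes "b \<noteq> 0"
  shows "q_invert (to_fract a / to_fract b) = eval_inverse a / eval_inverse b"
proof -
  define f where "f = to_fract a / to_fract b"
  obtain a' b' where ab: "quot_of_fract f = (a', b')" by (cases "quot_of_fract f")
  have f: "f = to_fract a' / to_fract b'" "b' \<noteq> 0"
    using Fract_quot_of_fract[of f] snd_quot_of_fract_nonzero[of f] ab by (simp_all add: Fract_conv_to_fract)
  have "to_fract (a * b') = to_fract (a' * b)"
    using f assms unfolding f_def by (simp add: frac_eq_eq)
  then have "a * b' = a' * b" by (simp only: to_fract_eq_iff)
  then have "eval_inverse a * eval_inverse b' = eval_inverse a' * eval_inverse b"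
    by (simp flip: eval_inverse_mult)
  then have "eval_inverse a' / eval_inverse b' = eval_inverse a / eval_inverse b"
    using f(2) assms by (simp add: eval_inverse_nonzero frac_eq_eq)
  then show ?thesis by (simp add: q_invert_def ab f_def[symmetric] eval_inverse_def)
qed

lemma fract_cases:
  obtains a b where "f = to_fract a / to_fract b" "b \<noteq> (0 :: int poly)"
  using Fract_quot_of_fract[of f] snd_quot_of_fract_nonzero[of f]
  by (metis Fract_conv_to_fract)

lemma q_invert_to_fract: "q_invert (to_fract a) = eval_inverse a"
  using q_invert_divide[of 1 a] by simp

lemma q_invert_0 [simp]: "q_invert 0 = 0" and q_invert_1 [simp]: "q_invert 1 = 1"
  using q_invert_to_fract[of 0] q_invert_to_fract[of 1] by simp_all

lemma q_invert_mult: "q_invert (f * g) = q_invert f * q_invert g"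
proof -
  obtain a b where f: "f = to_fract a / to_fract b" "b \<noteq> 0" by (rule fract_cases)
  obtain c d where g: "g = to_fract c / to_fract d" "d \<noteq> 0" by (rule fract_cases)
  have "f * g = to_fract (a * c) / to_fract (b * d)" using f g by simp
  then show ?thesis using f g q_invert_divide[of "b * d" "a * c"]
    by (simp add: q_invert_divide eval_inverse_mult)
qed

lemma q_invert_add: "q_invert (f + g) = q_invert f + q_invert g"
proof -
  obtain a b where f: "f = to_fract a / to_fract b" "b \<noteq> 0" by (rule fract_cases)
  obtain c d where g: "g = to_fract c / to_fract d" "d \<noteq> 0" by (rule fract_cases)
  have "f + g = to_fract (a * d + c * b) / to_fract (b * d)" using f g by (simp add: add_frac_eq)
  then show ?thesis using f g q_invert_divide[of "b * d" "a * d + c * b"]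
    by (simp add: q_invert_divide eval_inverse_mult eval_inverse_add eval_inverse_nonzero add_frac_eq)
qed

lemma q_invert_uminus: "q_invert (- f) = - q_invert f"
  using q_invert_add[of f "- f"] by (simp add: eq_neg_iff_add_eq_0 add.commute)

lemma q_invert_qvar [simp]: "q_invert qvar = inverse qvar"
  unfolding qvar_def[of ] using q_invert_to_fract[of "[:0, 1:]"]
  by (simp add: qvar_def[symmetric] eval_inverse_pCons)

lemma q_invert_inverse_qvar [simp]: "q_invert (inverse qvar) = qvar"
  using q_invert_mult[of qvar "inverse qvar"] by (simp add: field_simps)

lemma q_invert_generate:
  assumes "x \<in> generate_ring q_field G" "q_invert ` G \<subseteq> generate_ring q_field G'"
  shows "q_invert x \<in> generate_ring q_field G'"
  using assms(1)
  by (induction rule: generate_q_field_induct)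
    (use assms(2) in \<open>auto simp: q_invert_add q_invert_mult q_invert_uminus intro: generate_q_field_closed\<close>)

lemma generate_qvar_to_fract:
  "x \<in> generate_ring q_field {qvar} \<Longrightarrow> \<exists>a. x = to_fract a"
proof (induction rule: generate_q_field_induct)
  case one
  show ?case by (metis to_fract_1)
next
  case (incl x)
  then show ?case by (auto simp: qvar_def)
next
  case (uminus x)
  then show ?case by (metis to_fract_uminus)
next
  case (add x y)
  then show ?case by (metis to_fract_add)
next
  case (mult x y)
  then show ?case by (metis to_fract_mult)
qed

text \<open>
  If \<open>b(q\<^sup>-\<^sup>1) = b(q)\<close>, the reversal of \<open>b\<close> equals \<open>b\<close> times a power of \<open>q\<close>. For \<open>b\<close> without constant term
  the product has constant term zero, whereas the reversal has the leading coefficient of \<open>b\<close> there.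
\<close>

lemma q_invert_fixed_zero:
  assumes "x \<in> multiples_int_poly qvar" "q_invert x = x"
  shows "x = 0"
proof (rule ccontr)
  assume nz: "x \<noteq> 0"
  obtain a where "x = qvar * to_fract a"
    using assms(1) generate_qvar_to_fract unfolding multiples_int_poly_def by blast
  then have x: "x = to_fract (pCons 0 a)" by (simp add: to_fract_pCons)
  let ?b = "pCons 0 a"
  have b: "?b \<noteq> 0" using x nz by (metis to_fract_0)
  obtain r where r: "qvar ^ degree ?b * eval_inverse ?b = to_fract r" "coeff r 0 = lead_coeff ?b"
    using eval_inverse_reverse[OF b] by blast
  have "eval_inverse ?b = to_fract ?b" using assms(2) x by (simp only: q_invert_to_fract)
  then have "to_fract (monom 1 (degree ?b) * ?b) = to_fract r"
    using r by (simp only: to_fract_mult qvar_power)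
  then have "monom 1 (degree ?b) * ?b = r" by (simp only: to_fract_eq_iff)
  then have "coeff r 0 = 0" by (auto simp: mult_pCons_right)
  then show False using r(2) b by (simp only: leading_coeff_0_iff)
qed

lemma qvar_multiples_subset: "multiples_int_poly qvar \<subseteq> generate_ring q_field {qvar}"
  unfolding multiples_int_poly_def by (auto intro: generate_q_field_closed)

lemma multiples_int_poly_closed:
  shows "0 \<in> multiples_int_poly u"
    and "x \<in> multiples_int_poly u \<Longrightarrow> y \<in> multiples_int_poly u \<Longrightarrow> x + y \<in> multiples_int_poly u"
    and "x \<in> multiples_int_poly u \<Longrightarrow> - x \<in> multiples_int_poly u"
    and "x \<in> multiples_int_poly u \<Longrightarrow> y \<in> generate_ring q_field {u} \<Longrightarrow> x * y \<in> multiples_int_poly u"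
    and "y \<in> generate_ring q_field {u} \<Longrightarrow> x \<in> multiples_int_poly u \<Longrightarrow> y * x \<in> multiples_int_poly u"
proof -
  have I: "u * f \<in> multiples_int_poly u" if "f \<in> generate_ring q_field {u}" for f
    using that unfolding multiples_int_poly_def by (rule imageI)
  have E: "\<exists>f \<in> generate_ring q_field {u}. x = u * f" if "x \<in> multiples_int_poly u" for x
    using that by (auto simp: multiples_int_poly_def)
  show "0 \<in> multiples_int_poly u" using I[of 0] generate_q_field_closed by simp
  show "x + y \<in> multiples_int_poly u" if xy: "x \<in> multiples_int_poly u" "y \<in> multiples_int_poly u"
  proof -
    obtain f g where "f \<in> generate_ring q_field {u}" "g \<in> generate_ring q_field {u}" "x = u * f" "y = u * g"
      using E xy by blast
    then show ?thesis using I[of "f + g"] generate_q_field_closed(4)[of f "{u}" g] by (simp add: algebra_simps)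
  qed
  show "- x \<in> multiples_int_poly u" if x: "x \<in> multiples_int_poly u"
  proof -
    obtain f where "f \<in> generate_ring q_field {u}" "x = u * f" using E x by blast
    then show ?thesis using I[of "- f"] generate_q_field_closed(3)[of f "{u}"] by simp
  qed
  show *: "x * y \<in> multiples_int_poly u" if x: "x \<in> multiples_int_poly u" "y \<in> generate_ring q_field {u}" for x y
  proof -
    obtain f where "f \<in> generate_ring q_field {u}" "x = u * f" using E x by blast
    then show ?thesis using I[of "f * y"] generate_q_field_closed(5)[of f "{u}" y] x by (simp add: mult.assoc)
  qed
  show "y * x \<in> multiples_int_poly u" if "y \<in> generate_ring q_field {u}" "x \<in> multiples_int_poly u"
    using *[OF that(2,1)] by (simp add: mult.commute)
qed

lemma q_invert_multiples:
  assumes "x \<in> multiples_int_poly (inverse qvar)"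
  shows "q_invert x \<in> multiples_int_poly qvar"
proof -
  obtain f where f: "f \<in> generate_ring q_field {inverse qvar}" "x = inverse qvar * f"
    using assms unfolding multiples_int_poly_def by blast
  have "q_invert f \<in> generate_ring q_field {qvar}"
    by (rule q_invert_generate[OF f(1)]) (simp add: generate_q_field_closed)
  then show ?thesis using f(2) by (simp add: q_invert_mult multiples_int_poly_def)
qed

context parabolic_coxeter_system
begin

text \<open>
  At \<open>q = 1\<close> the Poincare polynomial takes the value \<open>|W\<^sub>J|\<close>.
\<close>

lemma poincare_nonzero: "poincare W S J \<noteq> 0"
proof -
  have P: "poincare W S J = to_fract (\<Sum>w\<in>WJ. monom 1 (2 * \<ell> w))"
    by (simp add: poincare_def qvar_power)
  have "poly (\<Sum>w\<in>WJ. monom (1::int) (2 * \<ell> w)) 1 = int (card WJ)"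
    by (simp add: poly_sum poly_monom)
  moreover have "card WJ \<noteq> 0" using parabolic_finite WJ_one by auto
  ultimately have "(\<Sum>w\<in>WJ. monom (1::int) (2 * \<ell> w)) \<noteq> 0" by (metis of_nat_eq_0_iff poly_0)
  then show ?thesis unfolding P by (simp only: to_fract_eq_0_iff not_False_eq_True)
qed

end

section \<open>Scalars and linear functionals of the Hecke algebra\<close>

lemma hecke_coeffs_simps [simp]:
  "x \<otimes>\<^bsub>hecke_coeffs W S J\<^esub> y = x * y" "x \<oplus>\<^bsub>hecke_coeffs W S J\<^esub> y = x + y"
  "\<one>\<^bsub>hecke_coeffs W S J\<^esub> = 1" "\<zero>\<^bsub>hecke_coeffs W S J\<^esub> = 0"
  by (simp_all add: hecke_coeffs_def q_field_def)

context hecke_algebra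
begin

abbreviation hmult (infixl \<open>\<cdot>\<close> 70) where "x \<cdot> y \<equiv> x \<otimes>\<^bsub>H\<^esub> y"
abbreviation hplus (infixl \<open>\<boxplus>\<close> 65) where "x \<boxplus> y \<equiv> x \<oplus>\<^bsub>H\<^esub> y"
abbreviation hscale (infixr \<open>\<bullet>\<close> 75) where "a \<bullet> x \<equiv> a \<odot>\<^bsub>H\<^esub> x"
abbreviation wmult (infixl \<open>\<star>\<close> 70) where "v \<star> w \<equiv> v \<otimes>\<^bsub>W\<^esub> w"
abbreviation coeffs (\<open>\<A>\<close>) where "\<A> \<equiv> carrier (hecke_coeffs W S J)"
abbreviation qdiff (\<open>\<xi>\<close>) where "\<xi> \<equiv> qvar - inverse qvar"

lemma coeffs_eq:
  "\<A> = generate_ring q_field {qvar, inverse qvar, inverse (poincare W S J)}"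
  by (simp add: hecke_coeffs_def)

lemma coeffs_closed [simp, intro]:
  "1 \<in> \<A>" "0 \<in> \<A>" "qvar \<in> \<A>" "inverse qvar \<in> \<A>" "inverse (poincare W S J) \<in> \<A>"
  "a \<in> \<A> \<Longrightarrow> b \<in> \<A> \<Longrightarrow> a + b \<in> \<A>" "a \<in> \<A> \<Longrightarrow> b \<in> \<A> \<Longrightarrow> a * b \<in> \<A>"
  "a \<in> \<A> \<Longrightarrow> - a \<in> \<A>" "a \<in> \<A> \<Longrightarrow> a ^ n \<in> \<A>"
  unfolding coeffs_eq by (auto intro: generate_q_field_closed generate_q_field_power)

lemma coeffs_diff [simp, intro]: "a \<in> \<A> \<Longrightarrow> b \<in> \<A> \<Longrightarrow> a - b \<in> \<A>"
  using coeffs_closed(6)[of a "- b"] by simp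

lemma coeffs_powi [simp, intro]: "qvar powi k \<in> \<A>"
  by (simp add: power_int_def)

lemma T_closed [simp, intro]: "w \<in> carrier W \<Longrightarrow> T w \<in> carrier H"
  using standard_basis by (auto simp: module_basis_def)

lemma scale_distrib_left: "a \<in> \<A> \<Longrightarrow> b \<in> \<A> \<Longrightarrow> x \<in> carrier H \<Longrightarrow> (a + b) \<bullet> x = a \<bullet> x \<boxplus> b \<bullet> x"
  using smult_l_distr[of a b x] by simp

lemma scale_scale: "a \<in> \<A> \<Longrightarrow> b \<in> \<A> \<Longrightarrow> x \<in> carrier H \<Longrightarrow> a \<bullet> (b \<bullet> x) = (a * b) \<bullet> x"
  using smult_assoc1[of a b x] by simp

lemma scale_one [simp]: "x \<in> carrier H \<Longrightarrow> 1 \<bullet> x = x"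
  using smult_one by simp

lemma scale_zero [simp]: "x \<in> carrier H \<Longrightarrow> 0 \<bullet> x = \<zero>\<^bsub>H\<^esub>"
  using smult_l_null by simp

lemma scale_minus_one: "x \<in> carrier H \<Longrightarrow> (- 1) \<bullet> x = \<ominus>\<^bsub>H\<^esub> x"
proof -
  assume x: "x \<in> carrier H"
  have "(- 1) \<bullet> x \<boxplus> x = (- 1 + 1) \<bullet> x"
    using x scale_distrib_left[of "-1" 1 x] by simp
  then show ?thesis using x by (intro minus_equality[symmetric]) auto
qed

lemma finite_sum_induct:
  assumes "finite F" "\<And>i. i \<in> F \<Longrightarrow> c i \<in> \<A>" "\<And>i. i \<in> F \<Longrightarrow> b i \<in> carrier H"
    and "P \<zero>\<^bsub>H\<^esub>"
    and "\<And>a i x. a \<in> \<A> \<Longrightarrow> i \<in> F \<Longrightarrow> x \<in> carrier H \<Longrightarrow> P x \<Longrightarrow> P (a \<bullet> b i \<boxplus> x)"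
  shows "P (\<Oplus>\<^bsub>H\<^esub>i\<in>F. c i \<bullet> b i)"
proof -
  have sub: "P (\<Oplus>\<^bsub>H\<^esub>i\<in>F'. c i \<bullet> b i)" if "finite F'" "F' \<subseteq> F" for F'
    using that
  proof (induction F' rule: finite_induct)
    case empty
    then show ?case using assms(4) by simp
  next
    case (insert x F')
    have "(\<Oplus>\<^bsub>H\<^esub>i\<in>F'. c i \<bullet> b i) \<in> carrier H"
      using insert.prems assms(2,3) by (intro finsum_closed Pi_I smult_closed) auto
    moreover have "(\<Oplus>\<^bsub>H\<^esub>i\<in>insert x F'. c i \<bullet> b i) = c x \<bullet> b x \<boxplus> (\<Oplus>\<^bsub>H\<^esub>i\<in>F'. c i \<bullet> b i)"
      using insert.hyps insert.prems assms(2,3) by (intro finsum_insert Pi_I smult_closed) auto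
    ultimately show ?case using insert assms(2,5) by simp
  qed
  show ?thesis using sub[OF assms(1)] by simp
qed

lemma standard_spanning:
  assumes "h \<in> carrier H"
  obtains F c where "finite F" "F \<subseteq> carrier W" "c \<in> F \<rightarrow> \<A>" "h = (\<Oplus>\<^bsub>H\<^esub>i\<in>F. c i \<bullet> T i)"
proof -
  have "\<forall>x \<in> carrier H. \<exists>F c. finite F \<and> F \<subseteq> carrier W \<and> c \<in> F \<rightarrow> \<A> \<and>
        x = (\<Oplus>\<^bsub>H\<^esub>i\<in>F. c i \<bullet> T i)"
    using standard_basis unfolding module_basis_def by (elim conjE)
  from bspec[OF this assms] that show ?thesis by (elim exE conjE)
qed

lemma basis_induct [consumes 1, case_names zero add]:
  assumes "h \<in> carrier H"
    and "P \<zero>\<^bsub>H\<^esub>"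
    and "\<And>a w x. a \<in> \<A> \<Longrightarrow> w \<in> carrier W \<Longrightarrow> x \<in> carrier H \<Longrightarrow> P x \<Longrightarrow> P (a \<bullet> T w \<boxplus> x)"
  shows "P h"
proof -
  obtain F c where F: "finite F" "F \<subseteq> carrier W" "c \<in> F \<rightarrow> \<A>" "h = (\<Oplus>\<^bsub>H\<^esub>i\<in>F. c i \<bullet> T i)"
    using standard_spanning[OF assms(1)] .
  show ?thesis unfolding F(4)
    by (rule finite_sum_induct) (use F(1-3) assms(2,3) in auto)
qed


lemma scale_sum_extend:
  assumes "finite F'" "F \<subseteq> F'" "F' \<subseteq> carrier W" "c \<in> F \<rightarrow> \<A>"
  shows "(\<Oplus>\<^bsub>H\<^esub>i\<in>F. c i \<bullet> T i) = (\<Oplus>\<^bsub>H\<^esub>i\<in>F'. (if i \<in> F then c i else 0) \<bullet> T i)"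
  using assms by (intro add.finprod_mono_neutral_cong_left) (auto simp: Pi_iff intro!: smult_closed)

text \<open>
  Values on a basis can be prescribed. The functional is constructed as a relation between
  elements and values, one pair for each presentation of an element as a linear combination. The relation is closed
  under linear operations and relates zero only to zero by linear independence, so it is a function.
\<close>

lemma linear_functional_exists:
  fixes f :: "'w \<Rightarrow> int poly fract"
  obtains L where "\<And>x y. x \<in> carrier H \<Longrightarrow> y \<in> carrier H \<Longrightarrow> L (x \<boxplus> y) = L x + L y"
    and "\<And>a x. a \<in> \<A> \<Longrightarrow> x \<in> carrier H \<Longrightarrow> L (a \<bullet> x) = a * L x"
    and "\<And>w. w \<in> carrier W \<Longrightarrow> L (T w) = f w"
proof -
  define G where "G x r \<longleftrightarrow> (\<exists>F c. finite F \<and> F \<subseteq> carrier W \<and> c \<in> F \<rightarrow> \<A> \<and>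
     x = (\<Oplus>\<^bsub>H\<^esub>i\<in>F. c i \<bullet> T i) \<and> r = (\<Sum>i\<in>F. c i * f i))" for x r
  have total: "\<exists>r. G x r" if "x \<in> carrier H" for x
    using standard_spanning[OF that] unfolding G_def by metis
  have add: "G (x \<boxplus> y) (r + s)" if "G x r" "G y s" for x y r s
  proof -
    obtain F c where F: "finite F" "F \<subseteq> carrier W" "c \<in> F \<rightarrow> \<A>"
      "x = (\<Oplus>\<^bsub>H\<^esub>i\<in>F. c i \<bullet> T i)" "r = (\<Sum>i\<in>F. c i * f i)" using \<open>G x r\<close> unfolding G_def by (elim exE conjE)
    obtain F' c' where F': "finite F'" "F' \<subseteq> carrier W" "c' \<in> F' \<rightarrow> \<A>"
      "y = (\<Oplus>\<^bsub>H\<^esub>i\<in>F'. c' i \<bullet> T i)" "s = (\<Sum>i\<in>F'. c' i * f i)" using \<open>G y s\<close> unfolding G_def by (elim exE conjE)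
    define U where "U = F \<union> F'"
    define d where "d i = (if i \<in> F then c i else 0)" for i
    define d' where "d' i = (if i \<in> F' then c' i else 0)" for i
    have U: "finite U" "F \<subseteq> U" "F' \<subseteq> U" "U \<subseteq> carrier W" using F F' by (auto simp: U_def)
    have d: "d i \<in> \<A>" "d' i \<in> \<A>" for i using F(3) F'(3) by (auto simp: d_def d'_def)
    have x: "x = (\<Oplus>\<^bsub>H\<^esub>i\<in>U. d i \<bullet> T i)" unfolding F(4) d_def by (rule scale_sum_extend) (use U F in auto)
    have y: "y = (\<Oplus>\<^bsub>H\<^esub>i\<in>U. d' i \<bullet> T i)" unfolding F'(4) d'_def by (rule scale_sum_extend) (use U F' in auto)
    have r: "r = (\<Sum>i\<in>U. d i * f i)" unfolding F(5) d_def
      by (rule sum.mono_neutral_cong_left) (use U in auto)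
    have s: "s = (\<Sum>i\<in>U. d' i * f i)" unfolding F'(5) d'_def
      by (rule sum.mono_neutral_cong_left) (use U in auto)
    have "x \<boxplus> y = (\<Oplus>\<^bsub>H\<^esub>i\<in>U. d i \<bullet> T i \<boxplus> d' i \<bullet> T i)"
      unfolding x y using U d by (subst finsum_addf) (auto intro!: smult_closed)
    also have "\<dots> = (\<Oplus>\<^bsub>H\<^esub>i\<in>U. (d i + d' i) \<bullet> T i)"
      using U d by (intro finsum_cong') (auto simp: scale_distrib_left intro!: smult_closed)
    finally have "x \<boxplus> y = (\<Oplus>\<^bsub>H\<^esub>i\<in>U. (d i + d' i) \<bullet> T i)" .
    moreover have "r + s = (\<Sum>i\<in>U. (d i + d' i) * f i)"
      unfolding r s by (simp add: algebra_simps sum.distrib)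
    ultimately show ?thesis unfolding G_def using U(1,4) d
      by (intro exI[of _ U] exI[of _ "\<lambda>i. d i + d' i"]) auto
  qed
  have scale: "G (a \<bullet> x) (a * r)" if "a \<in> \<A>" "G x r" for a x r
  proof -
    obtain F c where F: "finite F" "F \<subseteq> carrier W" "c \<in> F \<rightarrow> \<A>"
      "x = (\<Oplus>\<^bsub>H\<^esub>i\<in>F. c i \<bullet> T i)" "r = (\<Sum>i\<in>F. c i * f i)" using \<open>G x r\<close> unfolding G_def by (elim exE conjE)
    have c: "\<And>i. i \<in> F \<Longrightarrow> c i \<in> \<A>" "\<And>i. i \<in> F \<Longrightarrow> T i \<in> carrier H" using F by auto
    have "a \<bullet> x = (\<Oplus>\<^bsub>H\<^esub>i\<in>F. a \<bullet> (c i \<bullet> T i))"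
      unfolding F(4) using c that(1) F(1) by (intro finsum_smult_ldistr) auto
    also have "\<dots> = (\<Oplus>\<^bsub>H\<^esub>i\<in>F. (a * c i) \<bullet> T i)"
      using c that(1) by (intro finsum_cong') (auto simp: scale_scale)
    finally have "a \<bullet> x = (\<Oplus>\<^bsub>H\<^esub>i\<in>F. (a * c i) \<bullet> T i)" .
    moreover have "a * r = (\<Sum>i\<in>F. (a * c i) * f i)"
      unfolding F(5) by (simp add: sum_distrib_left mult.assoc)
    ultimately show ?thesis unfolding G_def using F(1,2) c that(1)
      by (intro exI[of _ F] exI[of _ "\<lambda>i. a * c i"]) auto
  qed
  have null: "r = 0" if z: "G \<zero>\<^bsub>H\<^esub> r" for r
  proof -
    obtain F c where F: "finite F" "F \<subseteq> carrier W" "c \<in> F \<rightarrow> \<A>"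
      "\<zero>\<^bsub>H\<^esub> = (\<Oplus>\<^bsub>H\<^esub>i\<in>F. c i \<bullet> T i)" "r = (\<Sum>i\<in>F. c i * f i)" using z unfolding G_def by (elim exE conjE)
    have "\<forall>F c. finite F \<and> F \<subseteq> carrier W \<and> c \<in> F \<rightarrow> \<A> \<and>
        (\<Oplus>\<^bsub>H\<^esub>i\<in>F. c i \<bullet> T i) = \<zero>\<^bsub>H\<^esub> \<longrightarrow> (\<forall>i \<in> F. c i = 0)"
      using standard_basis unfolding module_basis_def hecke_coeffs_simps by (elim conjE)
    then have "\<forall>i\<in>F. c i = 0" using F(1,2,3) F(4)[symmetric] by simp
    then show ?thesis using F(5) by simp
  qed
  have closed: "x \<in> carrier H" if "G x r" for x r
    using that unfolding G_def by (auto simp: Pi_iff subset_iff intro!: finsum_closed smult_closed)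
  have unique: "r = s" if rs: "G x r" "G x s" for x r s
  proof -
    have x: "x \<in> carrier H" using closed rs by blast
    have "G (x \<boxplus> (- 1) \<bullet> x) (r + (- 1) * s)" by (intro add scale) (use rs in auto)
    moreover have "x \<boxplus> (- 1) \<bullet> x = \<zero>\<^bsub>H\<^esub>" using x by (simp add: scale_minus_one r_neg)
    ultimately have "r + (- 1) * s = 0" using null[of "r + (- 1) * s"] by argo
    then show ?thesis by simp
  qed
  define L where "L x = (SOME r. G x r)" for x
  have GL: "G x (L x)" if "x \<in> carrier H" for x
    unfolding L_def by (rule someI_ex[OF total[OF that]])
  have L: "L x = r" if "G x r" for x r
    using unique[OF GL[OF closed[OF that]] that] .
  show ?thesis
  proof (rule that[of L])
    show "L (x \<boxplus> y) = L x + L y" if "x \<in> carrier H" "y \<in> carrier H" for x y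
      by (intro L add GL that)
    show "L (a \<bullet> x) = a * L x" if "a \<in> \<A>" "x \<in> carrier H" for a x
      by (intro L scale GL that)
    show "L (T w) = f w" if "w \<in> carrier W" for w
    proof (rule L)
      have "(\<Oplus>\<^bsub>H\<^esub>i\<in>{w}. 1 \<bullet> T i) = 1 \<bullet> T w \<boxplus> (\<Oplus>\<^bsub>H\<^esub>i\<in>{}. 1 \<bullet> T i)"
        using that by (intro finsum_insert) auto
      then show "G (T w) (f w)"
        unfolding G_def using that by (intro exI[of _ "{w}"] exI[of _ "\<lambda>_. 1"]) auto
    qed
  qed
qed

section \<open>Multiplication of standard basis elements\<close>

lemma W_one_closed [simp]: "\<one>\<^bsub>W\<^esub> \<in> carrier W"
  using wp_closed[of "[]"] by simp

lemma J_gen: "s \<in> J \<Longrightarrow> s \<in> S"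
  using parabolic_generators by auto

declare smult_mult_left [simp] smult_mult_right [simp]

text \<open>
  The quadratic relation, in the form in which both cases of the multiplication rule agree. It is
  stated by its action on the standard basis because \<open>T\<^sub>1\<close> is not yet known to be the unit.
\<close>

lemma T_gen_twice:
  assumes s: "s \<in> S" and w: "w \<in> carrier W"
  shows "T s \<cdot> (T s \<cdot> T w) = \<xi> \<bullet> (T s \<cdot> T w) \<boxplus> T w"
  using len_gen_mult[OF s w]
proof
  assume l: "\<ell> (s \<star> w) = Suc (\<ell> w)"
  have "T s \<cdot> T w = T (s \<star> w)" using mult_ascent[OF s w] l by simp
  moreover have "T s \<cdot> T (s \<star> w) = \<xi> \<bullet> T (s \<star> w) \<boxplus> T w"
    using mult_descent[OF s, of "s \<star> w"] l s w by simp
  ultimately show ?thesis by simp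
next
  assume l: "\<ell> w = Suc (\<ell> (s \<star> w))"
  have 1: "T s \<cdot> T w = \<xi> \<bullet> T w \<boxplus> T (s \<star> w)" using mult_descent[OF s w] l by simp
  have "T s \<cdot> (T s \<cdot> T w) = \<xi> \<bullet> (T s \<cdot> T w) \<boxplus> T s \<cdot> T (s \<star> w)"
    using s w by (subst 1) (simp add: r_distr)
  also have "T s \<cdot> T (s \<star> w) = T w"
    using mult_ascent[OF s, of "s \<star> w"] l s w by simp
  finally show ?thesis .
qed

lemma T_gen_square_T_one:
  assumes s: "s \<in> S"
  shows "T s \<cdot> T s = \<xi> \<bullet> T s \<boxplus> T \<one>\<^bsub>W\<^esub>"
proof -
  have n: "\<ell> s \<noteq> 0"
  proof
    assume "\<ell> s = 0"
    then obtain ws where "ws \<in> lists S" "length ws = 0" "wp ws = s"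
      using reduced_word_exists[OF gen_carrier[OF s]] by (metis reduced_def)
    then show False using generators_nontrivial[OF s] by simp
  qed
  show ?thesis using mult_descent[OF s, of s] s n generators_involutive[OF s] by simp
qed

text \<open>
  The rule for ascents only says that \<open>T\<^sub>1\<close> is neutral to the right of generators. But \<open>T\<^sub>1 = T\<^sub>s\<^sup>2 - (q - q\<^sup>-\<^sup>1) T\<^sub>s\<close> for any generator \<open>s\<close>, and the
  right-hand side acts as the identity on the standard basis; one generator exists as \<open>J\<close> is
  nonempty.
\<close>

lemma T_one: "T \<one>\<^bsub>W\<^esub> = \<one>\<^bsub>H\<^esub>"
proof -
  obtain s where s: "s \<in> S" using parabolic_nonempty parabolic_generators by blast
  have *: "T \<one>\<^bsub>W\<^esub> \<cdot> T w = T w" if w: "w \<in> carrier W" for w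
  proof -
    have "\<xi> \<bullet> (T s \<cdot> T w) \<boxplus> T w = (T s \<cdot> T s) \<cdot> T w"
      using s w by (simp add: m_assoc T_gen_twice)
    also have "\<dots> = \<xi> \<bullet> (T s \<cdot> T w) \<boxplus> T \<one>\<^bsub>W\<^esub> \<cdot> T w"
      using s w by (simp add: T_gen_square_T_one l_distr)
    finally have "T w \<boxplus> \<xi> \<bullet> (T s \<cdot> T w) = T \<one>\<^bsub>W\<^esub> \<cdot> T w \<boxplus> \<xi> \<bullet> (T s \<cdot> T w)"
      using s w by (simp add: a_comm)
    then show ?thesis using s w by (simp add: add.right_cancel)
  qed
  have "T \<one>\<^bsub>W\<^esub> \<cdot> h = h" if "h \<in> carrier H" for h
    using that by (induction rule: basis_induct) (auto simp: r_distr *)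
  from this[of "\<one>\<^bsub>H\<^esub>"] show ?thesis by simp
qed

lemma T_gen_square: "s \<in> S \<Longrightarrow> T s \<cdot> T s = \<xi> \<bullet> T s \<boxplus> \<one>\<^bsub>H\<^esub>"
  using T_gen_square_T_one T_one by simp

primrec T_word :: "'w list \<Rightarrow> 'h" where
  "T_word [] = \<one>\<^bsub>H\<^esub>"
| "T_word (s # ws) = T s \<cdot> T_word ws"

lemma T_word_closed [simp]: "ws \<in> lists S \<Longrightarrow> T_word ws \<in> carrier H"
  by (induction ws) auto

lemma T_word_append:
  "us \<in> lists S \<Longrightarrow> vs \<in> lists S \<Longrightarrow> T_word (us @ vs) = T_word us \<cdot> T_word vs"
  by (induction us) (auto simp: m_assoc)

lemma T_reduced: "reduced ws \<Longrightarrow> T (wp ws) = T_word ws"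
proof (induction ws)
  case Nil
  then show ?case by (simp add: T_one)
next
  case (Cons s ws)
  have r: "reduced ws" using reduced_append(2)[of "[s]" ws] Cons.prems by simp
  have "s \<in> S" "wp ws \<in> carrier W" "\<ell> (wp ws) < \<ell> (s \<star> wp ws)"
    using Cons.prems r by (auto simp: reduced_def)
  then show ?case using mult_ascent[of s "wp ws"] Cons.IH[OF r] by simp
qed

text \<open>
  The multiplication rule is given for multiplication from the left only; the
  rule on the right follows since \<open>T\<^sub>w\<close> is the product of the \<open>T\<^sub>s\<close> along a reduced word.
\<close>

lemma mult_ascent_right:
  assumes "s \<in> S" "w \<in> carrier W" "\<ell> (w \<star> s) = Suc (\<ell> w)"
  shows "T w \<cdot> T s = T (w \<star> s)"
proof -
  obtain ws where ws: "reduced ws" "wp ws = w" using reduced_word_exists[OF assms(2)] .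
  have l: "ws \<in> lists S" "[s] \<in> lists S" using ws(1) assms(1) by (auto simp: reduced_def)
  have w: "wp (ws @ [s]) = w \<star> s" using wp_append[OF l] ws(2) gen_carrier[OF assms(1)]
    by simp
  then have "reduced (ws @ [s])" using ws l assms(3) by (simp add: reduced_def)
  then show ?thesis using T_reduced[of "ws @ [s]"] T_reduced[OF ws(1)] ws(2) w l assms(1)
    by (simp add: T_word_append)
qed

lemma mult_descent_right:
  assumes "s \<in> S" "w \<in> carrier W" "\<ell> w = Suc (\<ell> (w \<star> s))"
  shows "T w \<cdot> T s = \<xi> \<bullet> T w \<boxplus> T (w \<star> s)"
proof -
  have ws: "w \<star> s \<star> s = w" by (rule gen_cancel_right[OF assms(1,2)])
  have *: "T (w \<star> s) \<cdot> T s = T w"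
    using mult_ascent_right[OF assms(1), of "w \<star> s"] assms ws by simp
  have "T w \<cdot> T s = T (w \<star> s) \<cdot> (T s \<cdot> T s)"
    unfolding *[symmetric] using assms by (simp add: m_assoc)
  also have "\<dots> = \<xi> \<bullet> T w \<boxplus> T (w \<star> s)"
    unfolding T_gen_square[OF assms(1)] using assms * by (simp add: r_distr)
  finally show ?thesis .
qed

lemma T_gen_Unit:
  assumes s: "s \<in> S"
  shows "T s \<in> Units H"
proof -
  let ?i = "T s \<boxplus> (- \<xi>) \<bullet> \<one>\<^bsub>H\<^esub>"
  have c: "(- \<xi>) \<in> \<A>" by (rule coeffs_closed) simp
  have z: "\<xi> \<bullet> T s \<boxplus> (- \<xi>) \<bullet> T s = \<zero>\<^bsub>H\<^esub>"
    using s c scale_distrib_left[of \<xi> "- \<xi>" "T s"] by simp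
  have e: "\<xi> \<bullet> T s \<boxplus> \<one>\<^bsub>H\<^esub> \<boxplus> (- \<xi>) \<bullet> T s = \<one>\<^bsub>H\<^esub>"
  proof -
    have "\<xi> \<bullet> T s \<boxplus> \<one>\<^bsub>H\<^esub> \<boxplus> (- \<xi>) \<bullet> T s = (\<xi> \<bullet> T s \<boxplus> (- \<xi>) \<bullet> T s) \<boxplus> \<one>\<^bsub>H\<^esub>"
      using s c by (simp add: a_ac)
    then show ?thesis using z by simp
  qed
  have "T s \<cdot> ?i = \<one>\<^bsub>H\<^esub>" "?i \<cdot> T s = \<one>\<^bsub>H\<^esub>"
    using s c e by (simp_all add: r_distr l_distr T_gen_square)
  then show ?thesis using s c unfolding Units_def by auto
qed

section \<open>The idempotent of the parabolic subgroup\<close>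

abbreviation e where "e \<equiv> hecke_idem W S J H T"

declare WJ_closed [simp]

text \<open>
  The idempotent before division by the Poincare polynomial.
\<close>

definition sumJ :: 'h where
  "sumJ = (\<Oplus>\<^bsub>H\<^esub>w\<in>WJ. qvar ^ \<ell> w \<bullet> T w)"

lemma sumJ_closed [simp]: "sumJ \<in> carrier H"
  unfolding sumJ_def by (rule finsum_closed) auto

lemma e_eq: "e = inverse (poincare W S J) \<bullet> sumJ"
  by (simp add: hecke_idem_def sumJ_def)

lemma e_closed [simp]: "e \<in> carrier H"
  unfolding e_eq by simp

text \<open>
  Both cases of the multiplication rule in the form \<open>T\<^sub>s g\<^sub>w = a\<^sub>w g\<^sub>w + b\<^sub>w g\<^sub>s\<^sub>w\<close>, with
  \<open>g\<^sub>w = q\<^sup>\<ell>\<^sup>(\<^sup>w\<^sup>) T\<^sub>w\<close>.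
\<close>

lemma scaled_T_gen:
  assumes s: "s \<in> S" and w: "w \<in> carrier W"
  shows "T s \<cdot> (qvar ^ \<ell> w \<bullet> T w)
    = (if \<ell> (s \<star> w) < \<ell> w then \<xi> else 0) \<bullet> (qvar ^ \<ell> w \<bullet> T w)
      \<boxplus> (if \<ell> (s \<star> w) < \<ell> w then qvar else inverse qvar) \<bullet> (qvar ^ \<ell> (s \<star> w) \<bullet> T (s \<star> w))"
  using len_gen_mult[OF s w]
proof
  assume l: "\<ell> (s \<star> w) = Suc (\<ell> w)"
  have "T s \<cdot> T w = T (s \<star> w)" using mult_ascent[OF s w] l by simp
  then show ?thesis using l s w by (simp add: scale_scale mult.assoc[symmetric])
next
  assume l: "\<ell> w = Suc (\<ell> (s \<star> w))"
  have "T s \<cdot> T w = \<xi> \<bullet> T w \<boxplus> T (s \<star> w)" using mult_descent[OF s w] l by simp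
  then show ?thesis using l s w
    by (simp add: scale_scale smult_r_distr mult.commute mult.left_commute)
qed

lemma scaled_T_gen_right:
  assumes s: "s \<in> S" and w: "w \<in> carrier W"
  shows "(qvar ^ \<ell> w \<bullet> T w) \<cdot> T s
    = (if \<ell> (w \<star> s) < \<ell> w then \<xi> else 0) \<bullet> (qvar ^ \<ell> w \<bullet> T w)
      \<boxplus> (if \<ell> (w \<star> s) < \<ell> w then qvar else inverse qvar) \<bullet> (qvar ^ \<ell> (w \<star> s) \<bullet> T (w \<star> s))"
  using len_mult_gen[OF s w]
proof
  assume l: "\<ell> (w \<star> s) = Suc (\<ell> w)"
  have "T w \<cdot> T s = T (w \<star> s)" using mult_ascent_right[OF s w] l by simp
  then show ?thesis using l s w by (simp add: scale_scale mult.assoc[symmetric])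
next
  assume l: "\<ell> w = Suc (\<ell> (w \<star> s))"
  have "T w \<cdot> T s = \<xi> \<bullet> T w \<boxplus> T (w \<star> s)" using mult_descent_right[OF s w] l by simp
  then show ?thesis using l s w
    by (simp add: scale_scale smult_r_distr mult.commute mult.left_commute)
qed

text \<open>
  The common computation for multiplication from the left and from the right: \<open>f\<close> is \<open>w \<mapsto> s w\<close> or
  \<open>w \<mapsto> w s\<close>. Reindexing the second part of the sum by the involution \<open>f\<close>, the coefficient of \<open>q\<^sup>\<ell>\<^sup>(\<^sup>w\<^sup>) T\<^sub>w\<close> becomes
  \<open>0 + q\<close> or \<open>(q - q\<^sup>-\<^sup>1) + q\<^sup>-\<^sup>1\<close>, which is \<open>q\<close> in both cases.
\<close>

lemma sumJ_involution:
  assumes f: "\<And>w. w \<in> WJ \<Longrightarrow> f w \<in> WJ \<and> f (f w) = w"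
    and l: "\<And>w. w \<in> WJ \<Longrightarrow> \<ell> (f w) = Suc (\<ell> w) \<or> \<ell> w = Suc (\<ell> (f w))"
    and x: "x = (\<Oplus>\<^bsub>H\<^esub>w\<in>WJ. (if \<ell> (f w) < \<ell> w then \<xi> else 0) \<bullet> (qvar ^ \<ell> w \<bullet> T w)
      \<boxplus> (if \<ell> (f w) < \<ell> w then qvar else inverse qvar) \<bullet> (qvar ^ \<ell> (f w) \<bullet> T (f w)))"
  shows "x = qvar \<bullet> sumJ"
proof -
  let ?g = "\<lambda>w. qvar ^ \<ell> w \<bullet> T w"
  let ?a = "\<lambda>w. if \<ell> (f w) < \<ell> w then \<xi> else 0"
  let ?b = "\<lambda>w. if \<ell> (f w) < \<ell> w then qvar else inverse qvar"
  have ab: "?a w \<in> \<A>" "?b w \<in> \<A>" for w by auto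
  have g: "?g w \<in> carrier H" if "w \<in> WJ" for w using that by auto
  have fW: "f ` WJ = WJ" using f by force
  have inj: "inj_on f WJ" by (rule inj_onI) (metis f)
  have "x = (\<Oplus>\<^bsub>H\<^esub>w\<in>WJ. ?a w \<bullet> ?g w) \<boxplus> (\<Oplus>\<^bsub>H\<^esub>w\<in>WJ. ?b w \<bullet> ?g (f w))"
    unfolding x by (rule finsum_addf) (use ab g f in \<open>auto intro!: smult_closed\<close>)
  also have "(\<Oplus>\<^bsub>H\<^esub>w\<in>WJ. ?b w \<bullet> ?g (f w)) = (\<Oplus>\<^bsub>H\<^esub>w\<in>WJ. ?b (f (f w)) \<bullet> ?g (f w))"
    by (rule finsum_cong') (use ab g f in \<open>auto intro!: smult_closed\<close>)
  also have "\<dots> = (\<Oplus>\<^bsub>H\<^esub>w\<in>f ` WJ. ?b (f w) \<bullet> ?g w)"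
    by (rule finsum_reindex[symmetric, OF _ inj]) (use ab g f in \<open>auto simp: fW intro!: smult_closed\<close>)
  also have "\<dots> = (\<Oplus>\<^bsub>H\<^esub>w\<in>WJ. ?b (f w) \<bullet> ?g w)" by (simp only: fW)
  also have "(\<Oplus>\<^bsub>H\<^esub>w\<in>WJ. ?a w \<bullet> ?g w) \<boxplus> \<dots> = (\<Oplus>\<^bsub>H\<^esub>w\<in>WJ. ?a w \<bullet> ?g w \<boxplus> ?b (f w) \<bullet> ?g w)"
    by (rule finsum_addf[symmetric]) (use ab g f in \<open>auto intro!: smult_closed\<close>)
  also have "\<dots> = (\<Oplus>\<^bsub>H\<^esub>w\<in>WJ. qvar \<bullet> ?g w)"
  proof (rule finsum_cong')
    fix w assume w: "w \<in> WJ"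
    have "?a w \<bullet> ?g w \<boxplus> ?b (f w) \<bullet> ?g w = (?a w + ?b (f w)) \<bullet> ?g w"
      using ab g[OF w] by (simp only: scale_distrib_left)
    also have "?a w + ?b (f w) = qvar"
    proof -
      have ff: "f (f w) = w" using f[OF w] by (rule conjunct2)
      show ?thesis unfolding ff using l[OF w] by (elim disjE) simp_all
    qed
    finally show "?a w \<bullet> ?g w \<boxplus> ?b (f w) \<bullet> ?g w = qvar \<bullet> ?g w" .
  qed (use g in auto)
  also have "\<dots> = qvar \<bullet> sumJ"
    unfolding sumJ_def by (rule finsum_smult_ldistr[symmetric]) (use parabolic_finite in auto)
  finally show ?thesis .
qed

lemma T_gen_sumJ:
  assumes "s \<in> J"
  shows "T s \<cdot> sumJ = qvar \<bullet> sumJ" "sumJ \<cdot> T s = qvar \<bullet> sumJ"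
proof -
  have s: "s \<in> S" "s \<in> WJ" using assms J_gen WJ_J by auto
  have "T s \<cdot> sumJ = (\<Oplus>\<^bsub>H\<^esub>w\<in>WJ. T s \<cdot> (qvar ^ \<ell> w \<bullet> T w))"
    unfolding sumJ_def by (rule finsum_rdistr) (use parabolic_finite s in auto)
  also have "\<dots> = (\<Oplus>\<^bsub>H\<^esub>w\<in>WJ. (if \<ell> (s \<star> w) < \<ell> w then \<xi> else 0) \<bullet> (qvar ^ \<ell> w \<bullet> T w)
      \<boxplus> (if \<ell> (s \<star> w) < \<ell> w then qvar else inverse qvar) \<bullet> (qvar ^ \<ell> (s \<star> w) \<bullet> T (s \<star> w)))"
    by (rule finsum_cong') (use s scaled_T_gen in auto)
  finally show "T s \<cdot> sumJ = qvar \<bullet> sumJ"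
    using s len_gen_mult WJ_mult by (intro sumJ_involution[of "\<lambda>w. s \<star> w"]) auto
  have "sumJ \<cdot> T s = (\<Oplus>\<^bsub>H\<^esub>w\<in>WJ. (qvar ^ \<ell> w \<bullet> T w) \<cdot> T s)"
    unfolding sumJ_def by (rule finsum_ldistr) (use parabolic_finite s in auto)
  also have "\<dots> = (\<Oplus>\<^bsub>H\<^esub>w\<in>WJ. (if \<ell> (w \<star> s) < \<ell> w then \<xi> else 0) \<bullet> (qvar ^ \<ell> w \<bullet> T w)
      \<boxplus> (if \<ell> (w \<star> s) < \<ell> w then qvar else inverse qvar) \<bullet> (qvar ^ \<ell> (w \<star> s) \<bullet> T (w \<star> s)))"
    by (rule finsum_cong') (use s scaled_T_gen_right in auto)
  finally show "sumJ \<cdot> T s = qvar \<bullet> sumJ"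
    using s len_mult_gen WJ_mult by (intro sumJ_involution[of "\<lambda>w. w \<star> s"]) auto
qed

lemma T_gen_e:
  assumes "s \<in> J"
  shows "T s \<cdot> e = qvar \<bullet> e" "e \<cdot> T s = qvar \<bullet> e"
proof -
  have c: "inverse (poincare W S J) \<in> \<A>" "T s \<in> carrier H" using J_gen[OF assms] by simp_all
  have "T s \<cdot> e = inverse (poincare W S J) \<bullet> (qvar \<bullet> sumJ)"
    unfolding e_eq using c by (simp only: smult_mult_right sumJ_closed T_gen_sumJ[OF assms])
  then show "T s \<cdot> e = qvar \<bullet> e"
    unfolding e_eq using c by (simp add: scale_scale mult.commute)
  have "e \<cdot> T s = inverse (poincare W S J) \<bullet> (qvar \<bullet> sumJ)"
    unfolding e_eq using c by (simp only: smult_mult_left sumJ_closed T_gen_sumJ[OF assms])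
  then show "e \<cdot> T s = qvar \<bullet> e"
    unfolding e_eq using c by (simp add: scale_scale mult.commute)
qed



lemma T_word_absorb:
  assumes "f \<in> carrier H" "ws \<in> lists J"
  shows "(\<And>s. s \<in> J \<Longrightarrow> T s \<cdot> f = qvar \<bullet> f) \<Longrightarrow> T_word ws \<cdot> f = qvar ^ length ws \<bullet> f"
    and "(\<And>s. s \<in> J \<Longrightarrow> f \<cdot> T s = qvar \<bullet> f) \<Longrightarrow> f \<cdot> T_word ws = qvar ^ length ws \<bullet> f"
proof -
  have l: "s \<in> S" "us \<in> lists S" if "s # us \<in> lists J" for s us using that J_gen by auto
  assume A: "\<And>s. s \<in> J \<Longrightarrow> T s \<cdot> f = qvar \<bullet> f"
  show "T_word ws \<cdot> f = qvar ^ length ws \<bullet> f"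
    using assms(2)
  proof (induction ws rule: list.induct)
    case (Cons s us)
    then have IH: "T_word us \<cdot> f = qvar ^ length us \<bullet> f" and s: "s \<in> J" by auto
    show ?case using assms(1) l[OF Cons.prems] A[OF s] IH by (simp add: m_assoc scale_scale mult.commute)
  qed (use assms in simp)
next
  have l: "s \<in> S" "us \<in> lists S" if "s # us \<in> lists J" for s us using that J_gen by auto
  assume A: "\<And>s. s \<in> J \<Longrightarrow> f \<cdot> T s = qvar \<bullet> f"
  show "f \<cdot> T_word ws = qvar ^ length ws \<bullet> f"
    using assms(2)
  proof (induction ws rule: list.induct)
    case (Cons s us)
    then have IH: "f \<cdot> T_word us = qvar ^ length us \<bullet> f" and s: "s \<in> J" by auto
    have "f \<cdot> T_word (s # us) = (f \<cdot> T s) \<cdot> T_word us"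
      using assms(1) l[OF Cons.prems] by (simp add: m_assoc)
    then show ?case using assms(1) l[OF Cons.prems] A[OF s] IH by (simp add: scale_scale)
  qed (use assms in simp)
qed

lemma T_WJ_absorb:
  assumes "f \<in> carrier H" "u \<in> WJ"
  shows "(\<And>s. s \<in> J \<Longrightarrow> T s \<cdot> f = qvar \<bullet> f) \<Longrightarrow> T u \<cdot> f = qvar ^ \<ell> u \<bullet> f"
    and "(\<And>s. s \<in> J \<Longrightarrow> f \<cdot> T s = qvar \<bullet> f) \<Longrightarrow> f \<cdot> T u = qvar ^ \<ell> u \<bullet> f"
proof -
  obtain us where us: "us \<in> lists J" "reduced us" "wp us = u" using reduced_WJ[OF assms(2)] .
  have l: "length us = \<ell> u" using us by (simp add: reduced_def)
  have t: "T u = T_word us" using T_reduced[OF us(2)] us(3) by simp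
  show "(\<And>s. s \<in> J \<Longrightarrow> T s \<cdot> f = qvar \<bullet> f) \<Longrightarrow> T u \<cdot> f = qvar ^ \<ell> u \<bullet> f"
    unfolding t l[symmetric] by (rule T_word_absorb(1)[OF assms(1) us(1)])
  show "(\<And>s. s \<in> J \<Longrightarrow> f \<cdot> T s = qvar \<bullet> f) \<Longrightarrow> f \<cdot> T u = qvar ^ \<ell> u \<bullet> f"
    unfolding t l[symmetric] by (rule T_word_absorb(2)[OF assms(1) us(1)])
qed

lemma finsum_scale_const:
  assumes "finite F" "f \<in> carrier H" "\<And>i. i \<in> F \<Longrightarrow> c i \<in> \<A>"
  shows "(\<Oplus>\<^bsub>H\<^esub>i\<in>F. c i \<bullet> f) = (\<Sum>i\<in>F. c i) \<bullet> f \<and> (\<Sum>i\<in>F. c i) \<in> \<A>"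
  using assms(1,3)
proof (induction F rule: finite_induct)
  case (insert i F)
  then have "(\<Oplus>\<^bsub>H\<^esub>i\<in>insert i F. c i \<bullet> f) = c i \<bullet> f \<boxplus> (\<Oplus>\<^bsub>H\<^esub>i\<in>F. c i \<bullet> f)"
    using assms(2) by (intro finsum_insert) auto
  then show ?case using insert assms(2) by (simp add: scale_distrib_left)
qed (use assms(2) in simp)

lemma poincare_scale:
  assumes "f \<in> carrier H"
  shows "(\<Oplus>\<^bsub>H\<^esub>w\<in>WJ. qvar ^ \<ell> w \<bullet> (qvar ^ \<ell> w \<bullet> f)) = poincare W S J \<bullet> f"
proof -
  have "(\<Oplus>\<^bsub>H\<^esub>w\<in>WJ. qvar ^ \<ell> w \<bullet> (qvar ^ \<ell> w \<bullet> f)) = (\<Oplus>\<^bsub>H\<^esub>w\<in>WJ. qvar ^ (2 * \<ell> w) \<bullet> f)"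
    by (rule finsum_cong') (use assms in \<open>auto simp: scale_scale mult_2 power_add\<close>)
  then show ?thesis using finsum_scale_const[OF parabolic_finite assms, of "\<lambda>w. qvar ^ (2 * \<ell> w)"]
    by (simp add: poincare_def)
qed

lemma sumJ_absorb:
  assumes "f \<in> carrier H"
  shows "(\<And>s. s \<in> J \<Longrightarrow> T s \<cdot> f = qvar \<bullet> f) \<Longrightarrow> sumJ \<cdot> f = poincare W S J \<bullet> f"
    and "(\<And>s. s \<in> J \<Longrightarrow> f \<cdot> T s = qvar \<bullet> f) \<Longrightarrow> f \<cdot> sumJ = poincare W S J \<bullet> f"
proof -
  assume A: "\<And>s. s \<in> J \<Longrightarrow> T s \<cdot> f = qvar \<bullet> f"
  have "sumJ \<cdot> f = (\<Oplus>\<^bsub>H\<^esub>w\<in>WJ. (qvar ^ \<ell> w \<bullet> T w) \<cdot> f)"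
    unfolding sumJ_def by (rule finsum_ldistr) (use parabolic_finite assms in auto)
  also have "\<dots> = (\<Oplus>\<^bsub>H\<^esub>w\<in>WJ. qvar ^ \<ell> w \<bullet> (qvar ^ \<ell> w \<bullet> f))"
    by (rule finsum_cong') (use assms T_WJ_absorb(1)[OF assms _ A] in auto)
  finally show "sumJ \<cdot> f = poincare W S J \<bullet> f" using poincare_scale[OF assms] by simp
next
  assume A: "\<And>s. s \<in> J \<Longrightarrow> f \<cdot> T s = qvar \<bullet> f"
  have "f \<cdot> sumJ = (\<Oplus>\<^bsub>H\<^esub>w\<in>WJ. f \<cdot> (qvar ^ \<ell> w \<bullet> T w))"
    unfolding sumJ_def by (rule finsum_rdistr) (use parabolic_finite assms in auto)
  also have "\<dots> = (\<Oplus>\<^bsub>H\<^esub>w\<in>WJ. qvar ^ \<ell> w \<bullet> (qvar ^ \<ell> w \<bullet> f))"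
    by (rule finsum_cong') (use assms T_WJ_absorb(2)[OF assms _ A] in auto)
  finally show "f \<cdot> sumJ = poincare W S J \<bullet> f" using poincare_scale[OF assms] by simp
qed

lemma poincare_coeff [simp]: "poincare W S J \<in> \<A>"
  using finsum_scale_const[OF parabolic_finite one_closed, of "\<lambda>w. qvar ^ (2 * \<ell> w)"]
  by (simp add: poincare_def)

text \<open>
  On elements on which the \<open>T\<^sub>s\<close> act by \<open>q\<close>, each \<open>T\<^sub>w\<close> with \<open>w \<in> W\<^sub>J\<close> acts by \<open>q\<^sup>\<ell>\<^sup>(\<^sup>w\<^sup>)\<close>, so the sum acts by the Poincare
  polynomial. Applied to \<open>e\<close> this gives idempotence, applied to \<open>bar e\<close> it gives bar invariance of \<open>e\<close>.
\<close>

lemma e_absorb: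
  assumes "f \<in> carrier H"
  shows "(\<And>s. s \<in> J \<Longrightarrow> T s \<cdot> f = qvar \<bullet> f) \<Longrightarrow> e \<cdot> f = f"
    and "(\<And>s. s \<in> J \<Longrightarrow> f \<cdot> T s = qvar \<bullet> f) \<Longrightarrow> f \<cdot> e = f"
  using sumJ_absorb[OF assms] assms poincare_nonzero unfolding e_eq
  by (simp_all add: scale_scale)

lemma e_idem: "e \<cdot> e = e"
  by (rule e_absorb(1)) (simp_all add: T_gen_e)

text \<open>
  In the factorisation \<open>y = u r v\<close> the outer factors are absorbed by \<open>e\<close> at the cost of
  powers of \<open>q\<close>.
\<close>

lemma e_T_e:
  assumes D: "D \<in> DC" and y: "y \<in> D"
  shows "e \<cdot> T y \<cdot> e = qvar ^ (\<ell> y - \<ell> (rep D)) \<bullet> (e \<cdot> T (rep D) \<cdot> e)" "\<ell> (rep D) \<le> \<ell> y"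
proof -
  obtain us xs vs where f: "us \<in> lists J" "vs \<in> lists J" "reduced (us @ xs @ vs)" "wp xs = rep D"
    "wp (us @ xs @ vs) = y" using rep_factorisation[OF assms] .
  have r: "reduced xs" using reduced_append(2)[OF f(3)] reduced_append(1) by blast
  have l: "us \<in> lists S" "xs \<in> lists S" "vs \<in> lists S" "xs @ vs \<in> lists S"
    using f(3) by (auto simp: reduced_def)
  have len: "\<ell> y = length us + \<ell> (rep D) + length vs"
    using f r by (simp add: reduced_def)
  have Ty: "T y = T_word us \<cdot> (T (rep D) \<cdot> T_word vs)"
    using T_reduced[OF f(3)] T_reduced[OF r] f(4,5) l by (simp add: T_word_append)
  have c: "T_word us \<in> carrier H" "T_word vs \<in> carrier H" "T (rep D) \<in> carrier H"
    using l D by simp_all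
  have "e \<cdot> T y \<cdot> e = (e \<cdot> T_word us) \<cdot> T (rep D) \<cdot> (T_word vs \<cdot> e)"
    unfolding Ty using c by (simp add: m_assoc)
  also have "e \<cdot> T_word us = qvar ^ length us \<bullet> e"
    by (rule T_word_absorb(2)) (use f T_gen_e in auto)
  also have "T_word vs \<cdot> e = qvar ^ length vs \<bullet> e"
    by (rule T_word_absorb(1)) (use f T_gen_e in auto)
  also have "(qvar ^ length us \<bullet> e) \<cdot> T (rep D) \<cdot> (qvar ^ length vs \<bullet> e)
      = qvar ^ (\<ell> y - \<ell> (rep D)) \<bullet> (e \<cdot> T (rep D) \<cdot> e)"
    using c by (simp add: scale_scale len power_add mult.commute)
  finally show "e \<cdot> T y \<cdot> e = qvar ^ (\<ell> y - \<ell> (rep D)) \<bullet> (e \<cdot> T (rep D) \<cdot> e)" .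
  show "\<ell> (rep D) \<le> \<ell> y" using len by simp
qed

section \<open>Functionals attached to double cosets\<close>

text \<open>
  Take the functional with \<open>T\<^sub>w \<mapsto> q\<^sup>\<ell>\<^sup>(\<^sup>w\<^sup>)\<close> for \<open>w \<in> D\<close> and \<open>T\<^sub>w \<mapsto> 0\<close> otherwise. As \<open>D\<close> is stable
  under multiplication by \<open>J\<close>, the multiplication rule shows that multiplying by \<open>T\<^sub>s\<close> with \<open>s \<in> J\<close> on
  either side scales the functional by \<open>q\<close>; for a descent this is \<open>(q - q\<^sup>-\<^sup>1) + q\<^sup>-\<^sup>1 = q\<close>. Consequently
  multiplication by \<open>e\<close> does not change its value.
\<close>

lemma double_coset_functional:
  assumes D: "D \<in> DC"
  obtains L where "\<And>x y. x \<in> carrier H \<Longrightarrow> y \<in> carrier H \<Longrightarrow> L (x \<boxplus> y) = L x + L y"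
    and "\<And>a x. a \<in> \<A> \<Longrightarrow> x \<in> carrier H \<Longrightarrow> L (a \<bullet> x) = a * L x"
    and "\<And>D'. D' \<in> DC \<Longrightarrow> L (e \<cdot> T (rep D') \<cdot> e) = (if D' = D then qvar ^ \<ell> (rep D) else 0)"
proof -
  obtain L where L_add: "\<And>x y. x \<in> carrier H \<Longrightarrow> y \<in> carrier H \<Longrightarrow> L (x \<boxplus> y) = L x + L y"
    and scale: "\<And>a x. a \<in> \<A> \<Longrightarrow> x \<in> carrier H \<Longrightarrow> L (a \<bullet> x) = a * L x"
    and LT: "\<And>w. w \<in> carrier W \<Longrightarrow> L (T w) = (if w \<in> D then qvar ^ \<ell> w else 0)"
    using linear_functional_exists[of "\<lambda>w. if w \<in> D then qvar ^ \<ell> w else 0"] by blast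
  have L0: "L \<zero>\<^bsub>H\<^esub> = 0" using scale[of 0 "\<one>\<^bsub>H\<^esub>"] by simp
  have left: "L (T s \<cdot> h) = qvar * L h" if s: "s \<in> J" and h: "h \<in> carrier H" for s h
    using h
  proof (induction rule: basis_induct)
    case (add a w x)
    have sS: "s \<in> S" using J_gen[OF s] .
    have "L (T s \<cdot> T w) = qvar * L (T w)"
      using len_gen_mult[OF sS add(2)]
    proof
      assume l: "\<ell> (s \<star> w) = Suc (\<ell> w)"
      have "T s \<cdot> T w = T (s \<star> w)" using mult_ascent[OF sS add(2)] l by simp
      then show ?thesis using l sS add(2) DC_mult_J(1)[OF D s add(2)] by (simp add: LT)
    next
      assume l: "\<ell> w = Suc (\<ell> (s \<star> w))"
      have "T s \<cdot> T w = \<xi> \<bullet> T w \<boxplus> T (s \<star> w)" using mult_descent[OF sS add(2)] l by simp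
      then have "L (T s \<cdot> T w) = \<xi> * L (T w) + L (T (s \<star> w))"
        using sS add(2) by (simp add: L_add scale)
      also have "\<dots> = qvar * L (T w)"
        using l sS add(2) DC_mult_J(1)[OF D s add(2)] by (simp add: LT) (simp add: field_simps)
      finally show ?thesis .
    qed
    then show ?case using add.hyps add.IH sS
      by (simp add: r_distr scale L_add algebra_simps)
  qed (use J_gen[OF s] L0 in simp)
  have right: "L (h \<cdot> T s) = qvar * L h" if s: "s \<in> J" and h: "h \<in> carrier H" for s h
    using h
  proof (induction rule: basis_induct)
    case (add a w x)
    have sS: "s \<in> S" using J_gen[OF s] .
    have "L (T w \<cdot> T s) = qvar * L (T w)"
      using len_mult_gen[OF sS add(2)]
    proof
      assume l: "\<ell> (w \<star> s) = Suc (\<ell> w)"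
      have "T w \<cdot> T s = T (w \<star> s)" using mult_ascent_right[OF sS add(2)] l by simp
      then show ?thesis using l sS add(2) DC_mult_J(2)[OF D s add(2)] by (simp add: LT)
    next
      assume l: "\<ell> w = Suc (\<ell> (w \<star> s))"
      have "T w \<cdot> T s = \<xi> \<bullet> T w \<boxplus> T (w \<star> s)" using mult_descent_right[OF sS add(2)] l by simp
      then have "L (T w \<cdot> T s) = \<xi> * L (T w) + L (T (w \<star> s))"
        using sS add(2) by (simp add: L_add scale)
      also have "\<dots> = qvar * L (T w)"
        using l sS add(2) DC_mult_J(2)[OF D s add(2)] by (simp add: LT) (simp add: field_simps)
      finally show ?thesis .
    qed
    then show ?case using add.hyps add.IH sS
      by (simp add: l_distr scale L_add algebra_simps)
  qed (use J_gen[OF s] L0 in simp)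
  have leftW: "L (T_word us \<cdot> h) = qvar ^ length us * L h" if "us \<in> lists J" "h \<in> carrier H" for us h
    using that(1)
  proof (induction us rule: list.induct)
    case (Cons s us)
    have "s \<in> J" "us \<in> lists J" "s \<in> S" "us \<in> lists S" using Cons.prems J_gen by auto
    then show ?case using Cons.IH left[of s "T_word us \<cdot> h"] that(2) by (simp add: m_assoc)
  qed (use that in simp)
  have rightW: "L (h \<cdot> T_word us) = qvar ^ length us * L h" if "us \<in> lists J" "h \<in> carrier H" for us h
    using that
  proof (induction us arbitrary: h rule: list.induct)
    case (Cons s us)
    have *: "s \<in> J" "us \<in> lists J" "s \<in> S" "us \<in> lists S" using Cons.prems J_gen by auto
    have "L (h \<cdot> T_word (s # us)) = L ((h \<cdot> T s) \<cdot> T_word us)"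
      using * Cons.prems(2) by (simp add: m_assoc)
    also have "\<dots> = qvar ^ length us * L (h \<cdot> T s)" by (rule Cons.IH) (use * Cons.prems in auto)
    finally show ?case using right[OF *(1) Cons.prems(2)] by simp
  qed simp
  have Lsum: "L (\<Oplus>\<^bsub>H\<^esub>i\<in>F. g i) = (\<Sum>i\<in>F. L (g i))" if "finite F" "g \<in> F \<rightarrow> carrier H" for F :: "'w set" and g
    using that
  proof (induction F rule: finite_induct)
    case (insert i F)
    then show ?case by (simp add: L_add)
  qed (simp add: L0)
  have absorb: "L (T u \<cdot> h) = qvar ^ \<ell> u * L h" "L (h \<cdot> T u) = qvar ^ \<ell> u * L h"
    if u: "u \<in> WJ" and h: "h \<in> carrier H" for u h
  proof -
    obtain us where us: "us \<in> lists J" "reduced us" "wp us = u" using reduced_WJ[OF u] .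
    have "length us = \<ell> u" "T u = T_word us"
      using us T_reduced[OF us(2)] by (simp_all add: reduced_def)
    then show "L (T u \<cdot> h) = qvar ^ \<ell> u * L h" "L (h \<cdot> T u) = qvar ^ \<ell> u * L h"
      using leftW[OF us(1) h] rightW[OF us(1) h] by simp_all
  qed
  have e_left: "L (e \<cdot> h) = L h" if h: "h \<in> carrier H" for h
  proof -
    have "sumJ \<cdot> h = (\<Oplus>\<^bsub>H\<^esub>w\<in>WJ. (qvar ^ \<ell> w \<bullet> T w) \<cdot> h)"
      unfolding sumJ_def by (rule finsum_ldistr) (use parabolic_finite h in auto)
    then have "L (sumJ \<cdot> h) = (\<Sum>w\<in>WJ. L ((qvar ^ \<ell> w \<bullet> T w) \<cdot> h))"
      using Lsum[OF parabolic_finite, of "\<lambda>w. (qvar ^ \<ell> w \<bullet> T w) \<cdot> h"] h by simp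
    also have "\<dots> = (\<Sum>w\<in>WJ. qvar ^ (2 * \<ell> w) * L h)"
      by (rule sum.cong) (use h in \<open>auto simp: scale absorb mult_2 power_add\<close>)
    finally show ?thesis unfolding e_eq using h poincare_nonzero
      by (simp add: scale sum_distrib_right[symmetric] poincare_def[symmetric])
  qed
  have e_right: "L (h \<cdot> e) = L h" if h: "h \<in> carrier H" for h
  proof -
    have "h \<cdot> sumJ = (\<Oplus>\<^bsub>H\<^esub>w\<in>WJ. h \<cdot> (qvar ^ \<ell> w \<bullet> T w))"
      unfolding sumJ_def by (rule finsum_rdistr) (use parabolic_finite h in auto)
    then have "L (h \<cdot> sumJ) = (\<Sum>w\<in>WJ. L (h \<cdot> (qvar ^ \<ell> w \<bullet> T w)))"
      using Lsum[OF parabolic_finite, of "\<lambda>w. h \<cdot> (qvar ^ \<ell> w \<bullet> T w)"] h by simp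
    also have "\<dots> = (\<Sum>w\<in>WJ. qvar ^ (2 * \<ell> w) * L h)"
      by (rule sum.cong) (use h in \<open>auto simp: scale absorb mult_2 power_add\<close>)
    finally show ?thesis unfolding e_eq using h poincare_nonzero
      by (simp add: scale sum_distrib_right[symmetric] poincare_def[symmetric])
  qed
  show ?thesis
  proof (rule that[OF L_add scale])
    fix D' assume D': "D' \<in> DC"
    have "rep D' \<in> D \<longleftrightarrow> D' = D"
      using DC_dcoset[OF D, of "rep D'"] DC_dcoset[OF D' rep_min(1)[OF D']] rep_min(1)[OF D'] by auto
    then show "L (e \<cdot> T (rep D') \<cdot> e) = (if D' = D then qvar ^ \<ell> (rep D) else 0)"
      using D' by (auto simp: e_left e_right LT)
  qed
qed



section \<open>Ring endomorphisms acting on scalars\<close>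

abbreviation laurent where "laurent \<equiv> generate_ring q_field {qvar, inverse qvar}"

lemma laurent_coeffs: "a \<in> laurent \<Longrightarrow> a \<in> \<A>"
  unfolding coeffs_eq
  by (rule subsetD[OF generate_q_field_mono]) (simp_all add: generate_q_field_closed(6))

lemma laurent_q_invert: "a \<in> laurent \<Longrightarrow> q_invert a \<in> laurent"
  by (rule q_invert_generate) (auto simp: generate_q_field_closed(6))

lemma q_poly_laurent: "a \<in> generate_ring q_field {qvar} \<Longrightarrow> a \<in> laurent"
  by (rule subsetD[OF generate_q_field_mono]) (simp_all add: generate_q_field_closed(6))

lemma hom_zero: "\<Phi> \<in> ring_hom H H \<Longrightarrow> \<Phi> \<zero>\<^bsub>H\<^esub> = \<zero>\<^bsub>H\<^esub>"
  by (rule ring_hom_zero[OF _ ring_axioms ring_axioms])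

lemma hom_uminus:
  assumes "\<Phi> \<in> ring_hom H H" "x \<in> carrier H"
  shows "\<Phi> (\<ominus>\<^bsub>H\<^esub> x) = \<ominus>\<^bsub>H\<^esub> \<Phi> x"
proof -
  have "\<Phi> (\<ominus>\<^bsub>H\<^esub> x) \<boxplus> \<Phi> x = \<zero>\<^bsub>H\<^esub>"
    using assms ring_hom_add[OF assms(1), of "\<ominus>\<^bsub>H\<^esub> x" x] by (simp add: l_neg hom_zero)
  then show ?thesis
    using assms ring_hom_closed[OF assms(1)] by (intro minus_equality[symmetric]) auto
qed

lemma hom_inv:
  assumes "\<Phi> \<in> ring_hom H H" "u \<in> Units H"
  shows "\<Phi> (inv\<^bsub>H\<^esub> u) = inv\<^bsub>H\<^esub> (\<Phi> u)"
proof -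
  have c: "u \<in> carrier H" "inv\<^bsub>H\<^esub> u \<in> carrier H" using assms(2) by auto
  have "\<Phi> u \<cdot> \<Phi> (inv\<^bsub>H\<^esub> u) = \<one>\<^bsub>H\<^esub>" "\<Phi> (inv\<^bsub>H\<^esub> u) \<cdot> \<Phi> u = \<one>\<^bsub>H\<^esub>"
    using assms c by (simp_all flip: ring_hom_mult[OF assms(1)] add: ring_hom_one)
  then show ?thesis
    using c ring_hom_closed[OF assms(1)] by (intro inv_unique') auto
qed

lemma scale_one_mult:
  "a \<in> \<A> \<Longrightarrow> x \<in> carrier H \<Longrightarrow> (a \<bullet> \<one>\<^bsub>H\<^esub>) \<cdot> x = a \<bullet> x"
  by simp

lemma uminus_scale: "a \<in> \<A> \<Longrightarrow> x \<in> carrier H \<Longrightarrow> (- a) \<bullet> x = \<ominus>\<^bsub>H\<^esub> (a \<bullet> x)"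
  using scale_scale[of "- 1" a x] by (simp add: scale_minus_one)

text \<open>
  Only the action on \<open>q\<close> is prescribed; on Laurent polynomials it is then determined, as \<open>q\<^sup>-\<^sup>1\<close> is
  an inverse. This suffices for the Kazhdan--Lusztig polynomials.
\<close>

lemma hom_semilinear:
  assumes h: "\<Phi> \<in> ring_hom H H" and q: "\<Phi> (qvar \<bullet> \<one>\<^bsub>H\<^esub>) = inverse qvar \<bullet> \<one>\<^bsub>H\<^esub>"
    and a: "a \<in> laurent" and x: "x \<in> carrier H"
  shows "\<Phi> (a \<bullet> x) = q_invert a \<bullet> \<Phi> x"
proof -
  have c: "\<Phi> y \<in> carrier H" if "y \<in> carrier H" for y using ring_hom_closed[OF h that] .
  have hom_one: "\<Phi> \<one>\<^bsub>H\<^esub> = \<one>\<^bsub>H\<^esub>" by (rule ring_hom_one[OF h])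
  have A: "b \<in> \<A>" "q_invert b \<in> \<A>" if "b \<in> laurent" for b
    using that laurent_coeffs laurent_q_invert by auto
  have "\<Phi> (a \<bullet> \<one>\<^bsub>H\<^esub>) = q_invert a \<bullet> \<one>\<^bsub>H\<^esub>"
    using a
  proof (induction rule: generate_q_field_induct)
    case one
    show ?case using hom_one by simp
  next
    case (incl y)
    then consider "y = qvar" | "y = inverse qvar" by blast
    then show ?case
    proof cases
      case 1
      then show ?thesis using q by simp
    next
      case 2
      let ?z = "\<Phi> (inverse qvar \<bullet> \<one>\<^bsub>H\<^esub>)"
      have z: "?z \<in> carrier H" by (rule c) simp
      have "inverse qvar \<bullet> ?z = (inverse qvar \<bullet> \<one>\<^bsub>H\<^esub>) \<cdot> ?z" using z by simp
      also have "\<dots> = \<Phi> ((qvar \<bullet> \<one>\<^bsub>H\<^esub>) \<cdot> (inverse qvar \<bullet> \<one>\<^bsub>H\<^esub>))"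
      proof -
        have "\<Phi> ((qvar \<bullet> \<one>\<^bsub>H\<^esub>) \<cdot> (inverse qvar \<bullet> \<one>\<^bsub>H\<^esub>))
            = \<Phi> (qvar \<bullet> \<one>\<^bsub>H\<^esub>) \<cdot> ?z"
          by (rule ring_hom_mult[OF h]) simp_all
        then show ?thesis unfolding q by (rule sym)
      qed
      also have "\<dots> = \<one>\<^bsub>H\<^esub>" by (simp add: scale_scale hom_one)
      finally have "qvar \<bullet> (inverse qvar \<bullet> ?z) = qvar \<bullet> \<one>\<^bsub>H\<^esub>" by simp
      then have "?z = qvar \<bullet> \<one>\<^bsub>H\<^esub>" using z by (simp add: scale_scale)
      then show ?thesis using 2 by simp
    qed
  next
    case (uminus y)
    then show ?case using A[OF uminus(1)] by (simp add: uminus_scale hom_uminus[OF h] q_invert_uminus)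
  next
    case (add y z)
    then show ?case using A[OF add(1)] A[OF add(2)]
      by (simp add: scale_distrib_left ring_hom_add[OF h] q_invert_add)
  next
    case (mult y z)
    have prod: "(y * z) \<bullet> \<one>\<^bsub>H\<^esub> = (y \<bullet> \<one>\<^bsub>H\<^esub>) \<cdot> (z \<bullet> \<one>\<^bsub>H\<^esub>)"
      using A[OF mult(1)] A[OF mult(2)] by (simp add: scale_scale mult.commute)
    have "\<Phi> ((y \<bullet> \<one>\<^bsub>H\<^esub>) \<cdot> (z \<bullet> \<one>\<^bsub>H\<^esub>)) = \<Phi> (y \<bullet> \<one>\<^bsub>H\<^esub>) \<cdot> \<Phi> (z \<bullet> \<one>\<^bsub>H\<^esub>)"
      by (rule ring_hom_mult[OF h]) (simp_all add: A[OF mult(1)] A[OF mult(2)])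
    then have "\<Phi> ((y * z) \<bullet> \<one>\<^bsub>H\<^esub>) = (q_invert y \<bullet> \<one>\<^bsub>H\<^esub>) \<cdot> (q_invert z \<bullet> \<one>\<^bsub>H\<^esub>)"
      unfolding prod mult.IH .
    also have "\<dots> = q_invert y \<bullet> (q_invert z \<bullet> \<one>\<^bsub>H\<^esub>)"
      using A[OF mult(1)] A[OF mult(2)] by (intro scale_one_mult) auto
    also have "\<dots> = q_invert (y * z) \<bullet> \<one>\<^bsub>H\<^esub>"
      unfolding q_invert_mult using A[OF mult(1)] A[OF mult(2)] by (intro scale_scale) auto
    finally show ?case .
  qed
  moreover have "\<Phi> (a \<bullet> x) = \<Phi> (a \<bullet> \<one>\<^bsub>H\<^esub>) \<cdot> \<Phi> x"
    using ring_hom_mult[OF h, of "a \<bullet> \<one>\<^bsub>H\<^esub>" x] A[OF a] x by simp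
  ultimately show ?thesis using A[OF a] c[OF x] by simp
qed

lemma poincare_q_poly: "poincare W S J \<in> generate_ring q_field {qvar}"
proof -
  have "(\<Sum>w\<in>F. qvar ^ (2 * \<ell> w)) \<in> generate_ring q_field {qvar}" for F
    by (induction F rule: infinite_finite_induct)
      (simp_all add: generate_q_field_closed(2,4,6) generate_q_field_power)
  then show ?thesis by (simp add: poincare_def)
qed

text \<open>
  The scalars \<open>q\<^sup>-\<^sup>1\<close> and \<open>W\<^sub>J(q\<^sup>2)\<^sup>-\<^sup>1\<close> are inverses of polynomials in \<open>q\<close>, and each \<open>T\<^sub>w\<close> is a product
  of generators, so agreement on \<open>q\<close> and on the generators propagates to the whole algebra.
\<close>

lemma hom_eqI:
  assumes h: "\<Phi> \<in> ring_hom H H" "\<Psi> \<in> ring_hom H H"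
    and q: "\<Phi> (qvar \<bullet> \<one>\<^bsub>H\<^esub>) = \<Psi> (qvar \<bullet> \<one>\<^bsub>H\<^esub>)"
    and T: "\<And>s. s \<in> S \<Longrightarrow> \<Phi> (T s) = \<Psi> (T s)"
    and x: "x \<in> carrier H"
  shows "\<Phi> x = \<Psi> x"
proof -
  define agree where "agree a \<longleftrightarrow> a \<in> \<A> \<and> \<Phi> (a \<bullet> \<one>\<^bsub>H\<^esub>) = \<Psi> (a \<bullet> \<one>\<^bsub>H\<^esub>)" for a
  have cl: "\<Phi> y \<in> carrier H" "\<Psi> y \<in> carrier H" if "y \<in> carrier H" for y
    using ring_hom_closed h that by metis+
  have one: "agree 1" by (simp add: agree_def ring_hom_one[OF h(1)] ring_hom_one[OF h(2)])
  have uminus: "agree (- a)" if "agree a" for a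
    using that by (simp add: agree_def uminus_scale hom_uminus[OF h(1)] hom_uminus[OF h(2)])
  have add: "agree (a + b)" if "agree a" "agree b" for a b
    using that by (simp add: agree_def scale_distrib_left ring_hom_add[OF h(1)] ring_hom_add[OF h(2)])
  have mult: "agree (a * b)" if "agree a" "agree b" for a b
  proof -
    have "(a * b) \<bullet> \<one>\<^bsub>H\<^esub> = (a \<bullet> \<one>\<^bsub>H\<^esub>) \<cdot> (b \<bullet> \<one>\<^bsub>H\<^esub>)"
      using that by (simp add: scale_scale agree_def mult.commute)
    then show ?thesis using that unfolding agree_def
      by (simp only: ring_hom_mult[OF h(1)] ring_hom_mult[OF h(2)] smult_closed one_closed coeffs_closed simp_thms)
  qed
  have inverse: "agree (inverse a)" if a: "agree a" "inverse a \<in> \<A>" "a \<noteq> 0" for a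
  proof -
    let ?u = "a \<bullet> \<one>\<^bsub>H\<^esub>" and ?v = "inverse a \<bullet> \<one>\<^bsub>H\<^esub>"
    have c: "a \<in> \<A>" "?u \<in> carrier H" "?v \<in> carrier H" using a by (auto simp: agree_def)
    have uv: "?u \<cdot> ?v = \<one>\<^bsub>H\<^esub>" "?v \<cdot> ?u = \<one>\<^bsub>H\<^esub>" using c a by (simp_all add: scale_scale)
    have "\<Phi> ?v = \<Phi> ?v \<cdot> \<Psi> (?u \<cdot> ?v)"
      using uv(1) cl[OF c(3)] ring_hom_one[OF h(2)] by simp
    also have "\<dots> = \<Phi> ?v \<cdot> (\<Phi> ?u \<cdot> \<Psi> ?v)"
      using a(1) ring_hom_mult[OF h(2) c(2,3)] by (simp add: agree_def)
    also have "\<dots> = \<Phi> (?v \<cdot> ?u) \<cdot> \<Psi> ?v"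
      using ring_hom_mult[OF h(1) c(3,2)] cl[OF c(2)] cl[OF c(3)] by (simp add: m_assoc)
    also have "\<dots> = \<Psi> ?v" using uv(2) cl[OF c(3)] ring_hom_one[OF h(1)] by simp
    finally show ?thesis using a by (simp add: agree_def)
  qed
  have aq: "agree qvar" using q by (simp add: agree_def)
  have poly: "agree a" if "a \<in> generate_ring q_field {qvar}" for a
    using that by (induction rule: generate_q_field_induct) (use one uminus add mult aq in auto)
  have agree: "agree a" if "a \<in> \<A>" for a
    using that unfolding coeffs_eq
  proof (induction rule: generate_q_field_induct)
    case (incl y)
    moreover have "agree (inverse qvar)" by (rule inverse[OF aq]) simp_all
    moreover have "agree (inverse (poincare W S J))"
      by (rule inverse[OF poly[OF poincare_q_poly]]) (simp_all add: poincare_nonzero)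
    ultimately show ?case using aq by blast
  qed (use one uminus add mult in auto)
  have word: "\<Phi> (T_word ws) = \<Psi> (T_word ws)" if "ws \<in> lists S" for ws
    using that
  proof (induction ws rule: list.induct)
    case Nil
    then show ?case by (simp add: ring_hom_one[OF h(1)] ring_hom_one[OF h(2)])
  next
    case (Cons s ws)
    then have "s \<in> S" "ws \<in> lists S" by auto
    then show ?case using Cons.IH T by (simp add: ring_hom_mult[OF h(1)] ring_hom_mult[OF h(2)])
  qed
  show ?thesis
    using x
  proof (induction rule: basis_induct)
    case zero
    then show ?case by (simp add: hom_zero h)
  next
    case (add a w x)
    obtain ws where ws: "reduced ws" "wp ws = w" using reduced_word_exists[OF add(2)] .
    have Tw: "\<Phi> (T w) = \<Psi> (T w)"
      using word[OF reduced_lists[OF ws(1)]] T_reduced[OF ws(1)] ws(2) by simp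
    have "\<Phi> ((a \<bullet> \<one>\<^bsub>H\<^esub>) \<cdot> T w) = \<Psi> ((a \<bullet> \<one>\<^bsub>H\<^esub>) \<cdot> T w)"
      using ring_hom_mult[OF h(1), of "a \<bullet> \<one>\<^bsub>H\<^esub>" "T w"] ring_hom_mult[OF h(2), of "a \<bullet> \<one>\<^bsub>H\<^esub>" "T w"]
        agree[OF add(1)] add(1,2) Tw by (simp add: agree_def)
    then have "\<Phi> (a \<bullet> T w) = \<Psi> (a \<bullet> T w)" using add(1,2) by simp
    then show ?case using add
      by (simp add: ring_hom_add[OF h(1)] ring_hom_add[OF h(2)])
  qed
qed

section \<open>Linear combinations with restricted coefficients\<close>

text \<open>
  Combinations of the \<open>b\<^sub>i\<close> with coefficients in a set \<open>K\<close> that need not be the whole ring: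
  below \<open>K\<close> is \<open>\<int>[q]\<close>, \<open>q\<int>[q]\<close> or the coefficient ring. An index may be used repeatedly, which makes
  closure under sums immediate.
\<close>

inductive_set combinations :: "int poly fract set \<Rightarrow> ('i \<Rightarrow> 'h) \<Rightarrow> 'i set \<Rightarrow> 'h set" for K b I where
  zero: "\<zero>\<^bsub>H\<^esub> \<in> combinations K b I"
| step: "a \<in> K \<Longrightarrow> i \<in> I \<Longrightarrow> x \<in> combinations K b I \<Longrightarrow> a \<bullet> b i \<boxplus> x \<in> combinations K b I"

lemma combinations_closed:
  assumes "x \<in> combinations K b I" "K \<subseteq> \<A>" "\<And>i. i \<in> I \<Longrightarrow> b i \<in> carrier H"
  shows "x \<in> carrier H"
  using assms(1) by induction (use assms(2,3) in \<open>auto intro!: smult_closed\<close>)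

lemma combinations_add:
  assumes "x \<in> combinations K b I" "y \<in> combinations K b I" "K \<subseteq> \<A>" "\<And>i. i \<in> I \<Longrightarrow> b i \<in> carrier H"
  shows "x \<boxplus> y \<in> combinations K b I"
  using assms(1)
proof induction
  case zero
  then show ?case using assms combinations_closed[OF assms(2-4)] by simp
next
  case (step a i x)
  have "a \<bullet> b i \<in> carrier H" "x \<in> carrier H" "y \<in> carrier H"
    using step assms combinations_closed[OF assms(2-4)] combinations_closed[OF step(3) assms(3,4)] by auto
  then show ?case using combinations.step[OF step(1,2,4)] by (simp add: a_assoc)
qed

lemma combinations_scale:
  assumes "x \<in> combinations K b I" "K \<subseteq> \<A>" "\<And>i. i \<in> I \<Longrightarrow> b i \<in> carrier H"
    and "a \<in> \<A>" "\<And>k. k \<in> K \<Longrightarrow> a * k \<in> K'"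
  shows "a \<bullet> x \<in> combinations K' b I"
  using assms(1)
proof induction
  case zero
  then show ?case using assms(4) smult_r_null[of a] combinations.zero by simp
next
  case (step k i x)
  have k: "k \<in> \<A>" "b i \<in> carrier H" "x \<in> carrier H"
    using step assms(2,3) combinations_closed[OF step(3) assms(2,3)] by auto
  have "a \<bullet> (k \<bullet> b i \<boxplus> x) = (a * k) \<bullet> b i \<boxplus> a \<bullet> x"
    using k assms(4) by (simp add: smult_r_distr scale_scale)
  then show ?case using combinations.step[OF assms(5)[OF step(1)] step(2,4)] by simp
qed

lemma combinations_finsum:
  assumes "finite F" "\<And>j. j \<in> F \<Longrightarrow> g j \<in> combinations K b I" "K \<subseteq> \<A>" "\<And>i. i \<in> I \<Longrightarrow> b i \<in> carrier H"
  shows "(\<Oplus>\<^bsub>H\<^esub>j\<in>F. g j) \<in> combinations K b I"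
  using assms(1,2)
proof (induction F rule: finite_induct)
  case empty
  then show ?case by (simp add: combinations.zero)
next
  case (insert j F)
  have "g k \<in> carrier H" if "k \<in> insert j F" for k
    by (rule combinations_closed[OF insert.prems[OF that] assms(3,4)])
  then have "(\<Oplus>\<^bsub>H\<^esub>j\<in>insert j F. g j) = g j \<boxplus> (\<Oplus>\<^bsub>H\<^esub>j\<in>F. g j)"
    using insert.hyps by (intro finsum_insert) auto
  moreover have "g j \<boxplus> (\<Oplus>\<^bsub>H\<^esub>j\<in>F. g j) \<in> combinations K b I"
    by (rule combinations_add) (use insert assms(3,4) in auto)
  ultimately show ?case by simp
qed

lemma combinations_representation:
  assumes "x \<in> combinations K b I" "K \<subseteq> \<A>" "\<And>i. i \<in> I \<Longrightarrow> b i \<in> carrier H"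
    and add: "\<And>k l. k \<in> K \<Longrightarrow> l \<in> K \<Longrightarrow> k + l \<in> K"
  shows "\<exists>F c. finite F \<and> F \<subseteq> I \<and> c \<in> F \<rightarrow> K \<and> x = (\<Oplus>\<^bsub>H\<^esub>i\<in>F. c i \<bullet> b i)"
  using assms(1)
proof induction
  case zero
  then show ?case by (intro exI[of _ "{}"]) auto
next
  case (step a i x)
  then obtain F c where F: "finite F" "F \<subseteq> I" "c \<in> F \<rightarrow> K" "x = (\<Oplus>\<^bsub>H\<^esub>i\<in>F. c i \<bullet> b i)" by blast
  have g: "c j \<bullet> b j \<in> carrier H" if "j \<in> F" for j
  proof (rule smult_closed)
    show "c j \<in> \<A>" using F(3) assms(2) that by auto
    show "b j \<in> carrier H" using F(2) assms(3) that by auto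
  qed
  have ai: "a \<in> \<A>" "b i \<in> carrier H" using step assms by auto
  show ?case
  proof (cases "i \<in> F")
    case False
    let ?c = "c(i := a)"
    have "(\<Oplus>\<^bsub>H\<^esub>j\<in>insert i F. ?c j \<bullet> b j) = a \<bullet> b i \<boxplus> (\<Oplus>\<^bsub>H\<^esub>j\<in>F. ?c j \<bullet> b j)"
      using F(1) False g ai by (subst finsum_insert) auto
    also have "(\<Oplus>\<^bsub>H\<^esub>j\<in>F. ?c j \<bullet> b j) = x"
      unfolding F(4) by (rule finsum_cong') (use g False in auto)
    finally show ?thesis using F step by (intro exI[of _ "insert i F"] exI[of _ ?c]) auto
  next
    case True
    let ?c = "c(i := a + c i)"
    have ci: "c i \<in> K" "c i \<in> \<A>" using F(3) True assms(2) by auto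
    have "x = (\<Oplus>\<^bsub>H\<^esub>j\<in>insert i (F - {i}). c j \<bullet> b j)"
      unfolding F(4) using True by (simp add: insert_absorb)
    also have "\<dots> = c i \<bullet> b i \<boxplus> (\<Oplus>\<^bsub>H\<^esub>j\<in>F - {i}. c j \<bullet> b j)"
      using F(1) g True by (intro finsum_insert) auto
    finally have x: "x = c i \<bullet> b i \<boxplus> (\<Oplus>\<^bsub>H\<^esub>j\<in>F - {i}. c j \<bullet> b j)" .
    have R: "(\<Oplus>\<^bsub>H\<^esub>j\<in>F - {i}. c j \<bullet> b j) \<in> carrier H" using g by (intro finsum_closed) auto
    have "(\<Oplus>\<^bsub>H\<^esub>j\<in>insert i (F - {i}). ?c j \<bullet> b j)
        = (a + c i) \<bullet> b i \<boxplus> (\<Oplus>\<^bsub>H\<^esub>j\<in>F - {i}. ?c j \<bullet> b j)"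
      using F(1) g ai ci by (subst finsum_insert) auto
    also have "(\<Oplus>\<^bsub>H\<^esub>j\<in>F - {i}. ?c j \<bullet> b j) = (\<Oplus>\<^bsub>H\<^esub>j\<in>F - {i}. c j \<bullet> b j)"
      by (rule finsum_cong') (use g in auto)
    also have "(a + c i) \<bullet> b i \<boxplus> \<dots> = a \<bullet> b i \<boxplus> x"
      unfolding x using ai ci R by (simp add: scale_distrib_left a_assoc)
    finally have "a \<bullet> b i \<boxplus> x = (\<Oplus>\<^bsub>H\<^esub>j\<in>F. ?c j \<bullet> b j)" using True by (simp add: insert_absorb)
    then show ?thesis using F step add ci by (intro exI[of _ F] exI[of _ ?c]) auto
  qed
qed

lemma linear_finsum:
  assumes "\<And>x y. x \<in> carrier H \<Longrightarrow> y \<in> carrier H \<Longrightarrow> L (x \<boxplus> y) = (L x + L y :: int poly fract)"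
    and "\<And>a x. a \<in> \<A> \<Longrightarrow> x \<in> carrier H \<Longrightarrow> L (a \<bullet> x) = a * L x"
    and "finite F" "\<And>i. i \<in> F \<Longrightarrow> c i \<in> \<A>" "\<And>i. i \<in> F \<Longrightarrow> b i \<in> carrier H"
  shows "L (\<Oplus>\<^bsub>H\<^esub>i\<in>F. c i \<bullet> b i) = (\<Sum>i\<in>F. c i * L (b i))"
  using assms(3-5)
proof (induction F rule: finite_induct)
  case empty
  then show ?case using assms(2)[of 0 "\<one>\<^bsub>H\<^esub>"] by simp
next
  case (insert i F)
  have "(\<Oplus>\<^bsub>H\<^esub>i\<in>insert i F. c i \<bullet> b i) = c i \<bullet> b i \<boxplus> (\<Oplus>\<^bsub>H\<^esub>i\<in>F. c i \<bullet> b i)"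
    using insert by (intro finsum_insert) auto
  moreover have "(\<Oplus>\<^bsub>H\<^esub>i\<in>F. c i \<bullet> b i) \<in> carrier H" using insert by (intro finsum_closed) auto
  ultimately show ?case using insert assms(1,2) by simp
qed

lemma hom_finsum:
  assumes h: "\<Phi> \<in> ring_hom H H" and q: "\<Phi> (qvar \<bullet> \<one>\<^bsub>H\<^esub>) = inverse qvar \<bullet> \<one>\<^bsub>H\<^esub>"
    and "finite F" "\<And>i. i \<in> F \<Longrightarrow> c i \<in> laurent" "\<And>i. i \<in> F \<Longrightarrow> b i \<in> carrier H"
  shows "\<Phi> (\<Oplus>\<^bsub>H\<^esub>i\<in>F. c i \<bullet> b i) = (\<Oplus>\<^bsub>H\<^esub>i\<in>F. q_invert (c i) \<bullet> \<Phi> (b i))"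
  using assms(3-5)
proof (induction F rule: finite_induct)
  case empty
  then show ?case by (simp add: hom_zero h)
next
  case (insert i F)
  have c: "c j \<in> \<A>" "q_invert (c j) \<in> \<A>" "b j \<in> carrier H" "\<Phi> (b j) \<in> carrier H" if "j \<in> insert i F" for j
    using that insert.prems laurent_coeffs laurent_q_invert ring_hom_closed[OF h] by auto
  have "(\<Oplus>\<^bsub>H\<^esub>i\<in>insert i F. c i \<bullet> b i) = c i \<bullet> b i \<boxplus> (\<Oplus>\<^bsub>H\<^esub>i\<in>F. c i \<bullet> b i)"
    using insert.hyps c by (intro finsum_insert) auto
  moreover have "(\<Oplus>\<^bsub>H\<^esub>i\<in>F. c i \<bullet> b i) \<in> carrier H" using c by (intro finsum_closed) auto
  moreover have "(\<Oplus>\<^bsub>H\<^esub>i\<in>insert i F. q_invert (c i) \<bullet> \<Phi> (b i))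
      = q_invert (c i) \<bullet> \<Phi> (b i) \<boxplus> (\<Oplus>\<^bsub>H\<^esub>i\<in>F. q_invert (c i) \<bullet> \<Phi> (b i))"
    using insert.hyps c by (intro finsum_insert) auto
  ultimately show ?case
    using insert c[of i] hom_semilinear[OF h q, of "c i" "b i"] by (simp add: ring_hom_add[OF h])
qed

lemma sandwich_finsum:
  assumes "finite F" "\<And>i. i \<in> F \<Longrightarrow> c i \<in> \<A>" "\<And>i. i \<in> F \<Longrightarrow> b i \<in> carrier H" "f \<in> carrier H"
  shows "f \<cdot> (\<Oplus>\<^bsub>H\<^esub>i\<in>F. c i \<bullet> b i) \<cdot> f = (\<Oplus>\<^bsub>H\<^esub>i\<in>F. c i \<bullet> (f \<cdot> b i \<cdot> f))"
proof -
  have "f \<cdot> (\<Oplus>\<^bsub>H\<^esub>i\<in>F. c i \<bullet> b i) = (\<Oplus>\<^bsub>H\<^esub>i\<in>F. f \<cdot> (c i \<bullet> b i))"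
    using assms by (intro finsum_rdistr) auto
  then have "f \<cdot> (\<Oplus>\<^bsub>H\<^esub>i\<in>F. c i \<bullet> b i) \<cdot> f = (\<Oplus>\<^bsub>H\<^esub>i\<in>F. f \<cdot> (c i \<bullet> b i) \<cdot> f)"
    using assms finsum_ldistr[OF assms(1,4), of "\<lambda>i. f \<cdot> (c i \<bullet> b i)"] by (simp add: Pi_iff)
  also have "\<dots> = (\<Oplus>\<^bsub>H\<^esub>i\<in>F. c i \<bullet> (f \<cdot> b i \<cdot> f))"
    by (rule finsum_cong') (use assms in auto)
  finally show ?thesis .
qed

section \<open>The parabolic Hecke algebra\<close>

abbreviation HJ where "HJ \<equiv> parabolic_hecke W S J H T"

lemma HJ_simps [simp]:
  "x \<oplus>\<^bsub>HJ\<^esub> y = x \<boxplus> y" "\<zero>\<^bsub>HJ\<^esub> = \<zero>\<^bsub>H\<^esub>" "a \<odot>\<^bsub>HJ\<^esub> x = a \<bullet> x"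
  by (simp_all add: parabolic_hecke_def Let_def)

lemma HJ_carrier: "carrier HJ = {x \<in> carrier H. e \<cdot> x \<cdot> e = x}"
proof -
  have "e \<cdot> (e \<cdot> h \<cdot> e) \<cdot> e = e \<cdot> h \<cdot> e" if "h \<in> carrier H" for h
  proof -
    have "e \<cdot> (e \<cdot> h \<cdot> e) \<cdot> e = (e \<cdot> e) \<cdot> h \<cdot> (e \<cdot> e)" using that by (simp add: m_assoc)
    then show ?thesis by (simp add: e_idem)
  qed
  moreover have "carrier HJ = {e \<cdot> h \<cdot> e | h. h \<in> carrier H}"
    by (simp add: parabolic_hecke_def Let_def)
  moreover have "\<exists>h. x = e \<cdot> h \<cdot> e \<and> h \<in> carrier H" if "x \<in> carrier H" "e \<cdot> x \<cdot> e = x" for x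
    by (rule exI[of _ x]) (simp add: that)
  ultimately show ?thesis by auto
qed

lemma HJ_memI: "h \<in> carrier H \<Longrightarrow> e \<cdot> h \<cdot> e \<in> carrier HJ"
  by (auto simp: parabolic_hecke_def Let_def)

lemma HJ_abelian_monoid: "abelian_monoid HJ"
proof (intro abelian_monoidI)
  fix x y assume "x \<in> carrier HJ" "y \<in> carrier HJ"
  then show "x \<oplus>\<^bsub>HJ\<^esub> y \<in> carrier HJ" by (auto simp: HJ_carrier l_distr r_distr)
qed (auto simp: HJ_carrier a_ac)

lemma HJ_scale: "a \<in> \<A> \<Longrightarrow> x \<in> carrier HJ \<Longrightarrow> a \<bullet> x \<in> carrier HJ"
  by (simp add: HJ_carrier)

text \<open>
  Finite sums are defined relative to the carrier, so the sums in the parabolic algebra have to be identified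
  with those of the ambient algebra.
\<close>

lemma HJ_finsum:
  assumes "finite F" "g \<in> F \<rightarrow> carrier HJ"
  shows "(\<Oplus>\<^bsub>HJ\<^esub>i\<in>F. g i) = (\<Oplus>\<^bsub>H\<^esub>i\<in>F. g i)"
proof -
  interpret HJ: abelian_monoid HJ by (rule HJ_abelian_monoid)
  have sub: "x \<in> carrier H" if "x \<in> carrier HJ" for x using that by (simp add: HJ_carrier)
  show ?thesis
    using assms
  proof (induction F rule: finite_induct)
    case (insert i F)
    have "(\<Oplus>\<^bsub>HJ\<^esub>i\<in>insert i F. g i) = g i \<oplus>\<^bsub>HJ\<^esub> (\<Oplus>\<^bsub>HJ\<^esub>i\<in>F. g i)"
      using insert by (intro HJ.finsum_insert) auto
    moreover have "(\<Oplus>\<^bsub>H\<^esub>i\<in>insert i F. g i) = g i \<boxplus> (\<Oplus>\<^bsub>H\<^esub>i\<in>F. g i)"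
      using insert sub by (intro finsum_insert) auto
    ultimately show ?case using insert by simp
  qed simp
qed

end

context kazhdan_lusztig
begin

section \<open>The bar involution and the dagger automorphism\<close>

lemma bar_hom: "bar \<in> ring_hom H H"
  using bar_automorphism by (simp add: ring_iso_def)

lemma dagger_hom: "dagger \<in> ring_hom H H"
  using dagger_automorphism by (simp add: ring_iso_def)

lemma bar_closed [simp]: "x \<in> carrier H \<Longrightarrow> bar x \<in> carrier H"
  by (rule ring_hom_closed[OF bar_hom])

lemma dagger_closed [simp]: "x \<in> carrier H \<Longrightarrow> dagger x \<in> carrier H"
  by (rule ring_hom_closed[OF dagger_hom])

lemmas bar_semilinear = hom_semilinear[OF bar_hom bar_q]
lemmas dagger_semilinear = hom_semilinear[OF dagger_hom dagger_q]

lemma laurent_qvar: "qvar \<in> laurent" "inverse qvar \<in> laurent"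
  by (simp_all add: generate_q_field_closed)

lemma bar_bar:
  assumes "x \<in> carrier H"
  shows "bar (bar x) = x"
proof -
  have id: "(\<lambda>x. x) \<in> ring_hom H H" by (rule ring_hom_memI) auto
  have "(bar \<circ> bar) x = (\<lambda>x. x) x"
  proof (rule hom_eqI[OF ring_hom_trans[OF bar_hom bar_hom] id])
    show "(bar \<circ> bar) (qvar \<bullet> \<one>\<^bsub>H\<^esub>) = qvar \<bullet> \<one>\<^bsub>H\<^esub>"
      using bar_semilinear[OF laurent_qvar(2), of "\<one>\<^bsub>H\<^esub>"] by (simp add: bar_q ring_hom_one[OF bar_hom])
    fix s assume s: "s \<in> S"
    have "bar (bar (T s)) = inv\<^bsub>H\<^esub> (bar (T s))"
      unfolding bar_generator[OF s] using hom_inv[OF bar_hom T_gen_Unit[OF s]] bar_generator[OF s] by simp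
    then show "(bar \<circ> bar) (T s) = T s" using s T_gen_Unit[OF s] by (simp add: bar_generator)
  qed (rule assms)
  then show ?thesis by simp
qed

text \<open>
  Both composites fix \<open>q\<close> and send \<open>T\<^sub>s\<close> to \<open>- T\<^sub>s\<^sup>-\<^sup>1\<close>.
\<close>

lemma bar_dagger:
  assumes "x \<in> carrier H"
  shows "bar (dagger x) = dagger (bar x)"
proof -
  have "(bar \<circ> dagger) x = (dagger \<circ> bar) x"
  proof (rule hom_eqI[OF ring_hom_trans[OF dagger_hom bar_hom] ring_hom_trans[OF bar_hom dagger_hom]])
    show "(bar \<circ> dagger) (qvar \<bullet> \<one>\<^bsub>H\<^esub>) = (dagger \<circ> bar) (qvar \<bullet> \<one>\<^bsub>H\<^esub>)"
      using bar_semilinear[OF laurent_qvar(2), of "\<one>\<^bsub>H\<^esub>"] dagger_semilinear[OF laurent_qvar(2), of "\<one>\<^bsub>H\<^esub>"]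
      by (simp add: bar_q dagger_q ring_hom_one[OF bar_hom] ring_hom_one[OF dagger_hom])
    fix s assume s: "s \<in> S"
    have u: "T s \<in> Units H" by (rule T_gen_Unit[OF s])
    have c: "T s \<in> carrier H" "inv\<^bsub>H\<^esub> (T s) \<in> carrier H" using u by auto
    have "\<ominus>\<^bsub>H\<^esub> (inv\<^bsub>H\<^esub> (T s)) = inv\<^bsub>H\<^esub> (\<ominus>\<^bsub>H\<^esub> T s)"
      by (rule inv_unique') (use c u in \<open>simp_all add: l_minus r_minus\<close>)
    moreover have "bar (dagger (T s)) = \<ominus>\<^bsub>H\<^esub> (inv\<^bsub>H\<^esub> (T s))"
      using s c by (simp add: dagger_generator bar_generator hom_uminus[OF bar_hom])
    moreover have "dagger (bar (T s)) = inv\<^bsub>H\<^esub> (\<ominus>\<^bsub>H\<^esub> T s)"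
      using s by (simp add: dagger_generator bar_generator hom_inv[OF dagger_hom u])
    ultimately show "(bar \<circ> dagger) (T s) = (dagger \<circ> bar) (T s)" by simp
  qed (rule assms)
  then show ?thesis by simp
qed

text \<open>
  Applying the bar involution to \<open>T\<^sub>s e = q e = e T\<^sub>s\<close> shows that \<open>f = bar e\<close> satisfies the same equations,
  hence \<open>e f = f = f e\<close>. Applying the involution to \<open>e f = f\<close> gives \<open>f e = e\<close>, and so \<open>f = e\<close>.
\<close>

lemma bar_e: "bar e = e"
proof -
  have q: "qvar \<bullet> (inverse qvar \<bullet> x) = x" if "x \<in> carrier H" for x using that by (simp add: scale_scale)
  have T: "T s \<cdot> bar e = qvar \<bullet> bar e" "bar e \<cdot> T s = qvar \<bullet> bar e" if s: "s \<in> J" for s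
  proof -
    have u: "T s \<in> Units H" using T_gen_Unit J_gen[OF s] by blast
    have c: "T s \<in> carrier H" "inv\<^bsub>H\<^esub> (T s) \<in> carrier H" using u by auto
    have bT: "bar (T s) = inv\<^bsub>H\<^esub> (T s)" using bar_generator J_gen[OF s] by blast
    have bq: "bar (qvar \<bullet> e) = inverse qvar \<bullet> bar e"
      using bar_semilinear[OF laurent_qvar(1) e_closed] by simp
    have "inv\<^bsub>H\<^esub> (T s) \<cdot> bar e = inverse qvar \<bullet> bar e"
      using ring_hom_mult[OF bar_hom c(1) e_closed] T_gen_e(1)[OF s] bq bT by simp
    then have "T s \<cdot> (inv\<^bsub>H\<^esub> (T s) \<cdot> bar e) = inverse qvar \<bullet> (T s \<cdot> bar e)"
      using c by simp
    then have "bar e = inverse qvar \<bullet> (T s \<cdot> bar e)"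
      using c u by (simp flip: m_assoc)
    then have "qvar \<bullet> bar e = qvar \<bullet> (inverse qvar \<bullet> (T s \<cdot> bar e))" by (rule arg_cong)
    then show "T s \<cdot> bar e = qvar \<bullet> bar e" using c q[of "T s \<cdot> bar e"] by simp
    have "bar e \<cdot> inv\<^bsub>H\<^esub> (T s) = inverse qvar \<bullet> bar e"
      using ring_hom_mult[OF bar_hom e_closed c(1)] T_gen_e(2)[OF s] bq bT by simp
    then have "(bar e \<cdot> inv\<^bsub>H\<^esub> (T s)) \<cdot> T s = inverse qvar \<bullet> (bar e \<cdot> T s)"
      using c by simp
    then have "bar e = inverse qvar \<bullet> (bar e \<cdot> T s)"
      using c u by (simp add: m_assoc)
    then have "qvar \<bullet> bar e = qvar \<bullet> (inverse qvar \<bullet> (bar e \<cdot> T s))" by (rule arg_cong)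
    then show "bar e \<cdot> T s = qvar \<bullet> bar e" using c q[of "bar e \<cdot> T s"] by simp
  qed
  have ef: "e \<cdot> bar e = bar e" "bar e \<cdot> e = bar e"
    by (rule e_absorb(1), simp, rule T, assumption) (rule e_absorb(2), simp, rule T, assumption)
  \<comment> \<open>The involution exchanges the two factors.\<close>
  have "bar (e \<cdot> bar e) = bar e \<cdot> e"
    using ring_hom_mult[OF bar_hom e_closed bar_closed[OF e_closed]] by (simp add: bar_bar)
  then show ?thesis using ef by (simp add: bar_bar)
qed

section \<open>Expansion of the second Kazhdan--Lusztig elements\<close>

lemma C_closed [simp]: "w \<in> carrier W \<Longrightarrow> C w \<in> carrier H"
  using KL_basis by (auto simp: module_basis_def)

lemma dagger_T:
  assumes "w \<in> carrier W"
  shows "dagger (T w) = (- 1) ^ \<ell> w \<bullet> T w"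
proof -
  have word: "dagger (T_word ws) = (- 1) ^ length ws \<bullet> T_word ws" if "ws \<in> lists S" for ws
    using that
  proof (induction ws rule: list.induct)
    case Nil
    then show ?case by (simp add: ring_hom_one[OF dagger_hom])
  next
    case (Cons s ws)
    then have l: "s \<in> S" "ws \<in> lists S" by auto
    have "dagger (T_word (s # ws)) = \<ominus>\<^bsub>H\<^esub> T s \<cdot> ((- 1) ^ length ws \<bullet> T_word ws)"
      using l Cons.IH by (simp add: ring_hom_mult[OF dagger_hom] dagger_generator)
    also have "\<dots> = (- 1) ^ length (s # ws) \<bullet> T_word (s # ws)"
      using l by (simp add: scale_minus_one[symmetric] scale_scale)
    finally show ?case .
  qed
  obtain ws where ws: "reduced ws" "wp ws = w" using reduced_word_exists[OF assms] .
  then show ?thesis using word[OF reduced_lists[OF ws(1)]] T_reduced[OF ws(1)]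
    by (simp add: reduced_def)
qed

lemma p_laurent:
  assumes "x \<in> carrier W" "w \<in> carrier W"
  shows "p x w \<in> laurent"
proof -
  have sub: "generate_ring q_field {inverse qvar} \<subseteq> laurent"
    using generate_q_field_mono[of "{inverse qvar}" "{qvar, inverse qvar}"] generate_q_field_closed(6) by blast
  consider "x = w" | "bruhat_less W S x w" | "\<not> bruhat_le W S x w"
    unfolding bruhat_less_def by blast
  then show ?thesis
  proof cases
    case 1
    then show ?thesis using KL_poly_refl assms by (simp add: generate_q_field_closed)
  next
    case 2
    obtain f where "f \<in> generate_ring q_field {inverse qvar}" "p x w = inverse qvar * f"
      using KL_poly[OF 2] unfolding multiples_int_poly_def by blast
    then show ?thesis using sub laurent_qvar(2) by (auto intro: generate_q_field_closed)
  next
    case 3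
    then show ?thesis using KL_poly_zero assms by (simp add: generate_q_field_closed)
  qed
qed

text \<open>
  With \<open>p\<^sub>w\<^sub>,\<^sub>w = 1\<close> the leading term joins the sum; finiteness of Bruhat intervals guarantees that the
  sum in the hypothesis is a genuine one.
\<close>

lemma C_expansion:
  assumes w: "w \<in> carrier W"
  shows "C w = (\<Oplus>\<^bsub>H\<^esub>x\<in>{x. bruhat_le W S x w}. p x w \<bullet> T x)"
proof -
  have car: "x \<in> carrier W" if "bruhat_le W S x w" for x using bruhat_le_carrier[OF that] by simp
  have eq: "{x. bruhat_le W S x w} = insert w {x. bruhat_less W S x w}"
    using w by (auto simp: bruhat_less_def)
  have fin: "finite {x. bruhat_less W S x w}"
    by (rule finite_subset[OF _ finite_bruhat_le[of w]]) (auto simp: bruhat_less_def)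
  have pA: "p x w \<in> \<A>" if "x \<in> carrier W" for x using p_laurent[OF that w] laurent_coeffs by blast
  show ?thesis
    unfolding KL_expansion[OF w] eq
  proof (subst finsum_insert)
    show "(\<lambda>x. p x w \<bullet> T x) \<in> {x. bruhat_less W S x w} \<rightarrow> carrier H"
      using car pA by (auto simp: bruhat_less_def)
  qed (use fin w pA KL_poly_refl in \<open>auto simp: bruhat_less_def\<close>)
qed

abbreviation eTe where "eTe D \<equiv> e \<cdot> T (rep D) \<cdot> e"
abbreviation eCe where "eCe D \<equiv> e \<cdot> dagger (C (rep D)) \<cdot> e"
abbreviation kl_coeff where "kl_coeff D' D \<equiv> coset_coeff W S p D' D"
abbreviation below where "below D \<equiv> {D' \<in> DC. coset_le W S D' D}"
abbreviation strictly_below where "strictly_below D \<equiv> {D' \<in> DC. coset_less W S D' D}"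

lemma eTe_closed [simp]: "D \<in> DC \<Longrightarrow> eTe D \<in> carrier H"
  by simp

lemma eCe_closed [simp]: "D \<in> DC \<Longrightarrow> eCe D \<in> carrier H"
  by simp

text \<open>
  On a double coset the exponent is nonnegative, so the integer power is an ordinary one.
\<close>

lemma coset_coeff_term:
  assumes "D \<in> DC" "D' \<in> DC" "y \<in> D'"
  shows "(- 1) ^ \<ell> y * qvar powi (int (\<ell> y) - int (\<ell> (rep D'))) * q_invert (p y (rep D))
     = (q_invert (p y (rep D)) * (- 1) ^ \<ell> y) * qvar ^ (\<ell> y - \<ell> (rep D'))"
proof -
  have "int (\<ell> y) - int (\<ell> (rep D')) = int (\<ell> y - \<ell> (rep D'))"
    using rep_min(2)[OF assms(2,3)] by simp
  then show ?thesis by (simp only: power_int_of_nat mult_ac)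
qed

lemma q_invert_p_coeff:
  "x \<in> carrier W \<Longrightarrow> w \<in> carrier W \<Longrightarrow> q_invert (p x w) \<in> \<A>"
  using p_laurent laurent_q_invert laurent_coeffs by blast

lemma coset_coeff_closed:
  assumes "D \<in> DC" "D' \<in> DC"
  shows "kl_coeff D' D \<in> \<A>"
proof -
  have "(\<Sum>y\<in>F. (- 1) ^ \<ell> y * qvar powi (int (\<ell> y) - int (\<ell> (rep D'))) * q_invert (p y (rep D))) \<in> \<A>"
    if "finite F" "F \<subseteq> D'" for F
    using that
  proof (induction F rule: finite_induct)
    case (insert y F)
    then have "y \<in> carrier W" using DC_carrier[OF assms(2)] by auto
    then show ?case using insert q_invert_p_coeff[of y "rep D"] assms(1)
      by (simp add: coeffs_closed(6-9) coeffs_powi)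
  qed simp
  then show ?thesis unfolding coset_coeff_def using DC_finite[OF assms(2)] by blast
qed

text \<open>
  The sum over the Bruhat interval below \<open>r(D)\<close> is extended by zeros to the union of all double cosets
  below \<open>D\<close>, which is disjoint, and then summed coset by coset.
\<close>

lemma eCe_expansion:
  assumes D: "D \<in> DC"
  shows "eCe D = (\<Oplus>\<^bsub>H\<^esub>D'\<in>below D. kl_coeff D' D \<bullet> eTe D')"
proof -
  let ?w = "rep D" and ?B = "{x. bruhat_le W S x (rep D)}"
  let ?d = "\<lambda>x. q_invert (p x (rep D)) * (- 1) ^ \<ell> x"
  let ?U = "\<Union>D'\<in>below D. D'"
  have w: "?w \<in> carrier W" using D by simp
  have car: "x \<in> carrier W" if "x \<in> ?B" for x using bruhat_le_carrier that by blast
  have finB: "finite ?B" by (rule finite_bruhat_le)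
  have pl: "p x ?w \<in> laurent" if "x \<in> carrier W" for x by (rule p_laurent[OF that w])
  have dA: "?d x \<in> \<A>" if "x \<in> carrier W" for x
    using q_invert_p_coeff[OF that w] by (intro coeffs_closed) auto
  have Ucar: "x \<in> carrier W" if "x \<in> ?U" for x using that DC_carrier by blast
  have finU: "finite ?U" using finite_coset_le DC_finite by (intro finite_UN_I) auto
  have BU: "?B \<subseteq> ?U"
  proof
    fix x assume x: "x \<in> ?B"
    have D': "dcoset x \<in> DC" "x \<in> dcoset x" using dcoset_DC car[OF x] by simp_all
    have "bruhat_le W S (rep (dcoset x)) ?w"
      by (rule bruhat_le_trans[OF rep_bruhat_le[OF D']]) (use x in simp)
    then show "x \<in> ?U" using D' by (auto simp: coset_le_def)
  qed
  have "dagger (C ?w) = (\<Oplus>\<^bsub>H\<^esub>x\<in>?B. q_invert (p x ?w) \<bullet> dagger (T x))"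
    unfolding C_expansion[OF w]
    by (rule hom_finsum[OF dagger_hom dagger_q finB]) (use car pl in auto)
  also have "\<dots> = (\<Oplus>\<^bsub>H\<^esub>x\<in>?B. ?d x \<bullet> T x)"
    by (rule finsum_cong')
      (use car dA q_invert_p_coeff[OF _ w] in \<open>auto simp: dagger_T scale_scale coeffs_closed(9)\<close>)
  finally have "eCe D = e \<cdot> (\<Oplus>\<^bsub>H\<^esub>x\<in>?B. ?d x \<bullet> T x) \<cdot> e" by simp
  also have "\<dots> = (\<Oplus>\<^bsub>H\<^esub>x\<in>?B. ?d x \<bullet> (e \<cdot> T x \<cdot> e))"
    by (rule sandwich_finsum) (use finB dA car in auto)
  also have "\<dots> = (\<Oplus>\<^bsub>H\<^esub>x\<in>?U. ?d x \<bullet> (e \<cdot> T x \<cdot> e))"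
  proof (rule add.finprod_mono_neutral_cong_left[OF finU BU])
    fix x assume x: "x \<in> ?U - ?B"
    then have "p x ?w = 0" using KL_poly_zero[OF Ucar w] by simp
    then show "?d x \<bullet> (e \<cdot> T x \<cdot> e) = \<zero>\<^bsub>H\<^esub>" using Ucar x by simp
  qed (use Ucar dA in auto)
  also have "\<dots> = (\<Oplus>\<^bsub>H\<^esub>D'\<in>below D. \<Oplus>\<^bsub>H\<^esub>x\<in>D'. ?d x \<bullet> (e \<cdot> T x \<cdot> e))"
  proof (rule add.finprod_UN_disjoint)
    show "pairwise (\<lambda>i j. disjnt i j) (below D)"
    proof (rule pairwiseI)
      fix D1 D2 assume *: "D1 \<in> below D" "D2 \<in> below D" "D1 \<noteq> D2"
      show "disjnt D1 D2"
        unfolding disjnt_iff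
      proof (intro allI notI, elim conjE)
        fix x assume "x \<in> D1" "x \<in> D2"
        then show False using * DC_dcoset[of D1 x] DC_dcoset[of D2 x] by simp
      qed
    qed
  qed (use finite_coset_le DC_finite DC_carrier dA in auto)
  also have "\<dots> = (\<Oplus>\<^bsub>H\<^esub>D'\<in>below D. kl_coeff D' D \<bullet> eTe D')"
  proof (rule finsum_cong')
    fix D' assume "D' \<in> below D"
    then have D': "D' \<in> DC" by simp
    have x: "x \<in> carrier W" if "x \<in> D'" for x using DC_carrier[OF D' that] .
    have "(\<Oplus>\<^bsub>H\<^esub>x\<in>D'. ?d x \<bullet> (e \<cdot> T x \<cdot> e)) = (\<Oplus>\<^bsub>H\<^esub>x\<in>D'. (?d x * qvar ^ (\<ell> x - \<ell> (rep D'))) \<bullet> eTe D')"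
    proof (rule finsum_cong')
      fix x assume x': "x \<in> D'"
      show "?d x \<bullet> (e \<cdot> T x \<cdot> e) = (?d x * qvar ^ (\<ell> x - \<ell> (rep D'))) \<bullet> eTe D'"
        unfolding e_T_e(1)[OF D' x'] using dA[OF x[OF x']] D' by (intro scale_scale) auto
    qed (use x dA D' in \<open>auto intro!: smult_closed coeffs_closed(7)\<close>)
    also have "\<dots> = (\<Sum>x\<in>D'. ?d x * qvar ^ (\<ell> x - \<ell> (rep D'))) \<bullet> eTe D'"
      using finsum_scale_const[OF DC_finite[OF D'] eTe_closed[OF D'],
          of "\<lambda>x. ?d x * qvar ^ (\<ell> x - \<ell> (rep D'))"] dA x by (auto intro: coeffs_closed(7))
    also have "(\<Sum>x\<in>D'. ?d x * qvar ^ (\<ell> x - \<ell> (rep D'))) = kl_coeff D' D"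
      unfolding coset_coeff_def by (rule sum.cong[OF refl], rule coset_coeff_term[OF D D', symmetric])
    finally show "(\<Oplus>\<^bsub>H\<^esub>x\<in>D'. ?d x \<bullet> (e \<cdot> T x \<cdot> e)) = kl_coeff D' D \<bullet> eTe D'" .
  qed (use D coset_coeff_closed in \<open>auto intro!: smult_closed\<close>)
  finally show ?thesis .
qed

text \<open>
  All other elements of \<open>D\<close> are longer than \<open>r(D)\<close>, so they are not below it and contribute zero.
\<close>

lemma coset_coeff_self:
  assumes D: "D \<in> DC"
  shows "kl_coeff D D = (- 1) ^ \<ell> (rep D)"
proof -
  have w: "rep D \<in> carrier W" "rep D \<in> D" using D rep_min by auto
  have zero: "p y (rep D) = 0" if "y \<in> D" "y \<noteq> rep D" for y
  proof (rule KL_poly_zero)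
    show "\<not> bruhat_le W S y (rep D)"
      using bruhat_le_len[of y "rep D"] rep_min(2)[OF D that(1)] that(2) by auto
  qed (use DC_carrier[OF D that(1)] w in auto)
  have "kl_coeff D D = (\<Sum>y\<in>{rep D}. (- 1) ^ \<ell> y * qvar powi (int (\<ell> y) - int (\<ell> (rep D))) * q_invert (p y (rep D)))"
    unfolding coset_coeff_def
    by (rule sum.mono_neutral_right) (use DC_finite[OF D] w zero in auto)
  then show ?thesis using KL_poly_refl w by simp
qed

text \<open>
  No element of \<open>D'\<close> equals \<open>r(D)\<close>, so every nonzero term involves a Kazhdan--Lusztig polynomial
  in \<open>q\<^sup>-\<^sup>1\<int>[q\<^sup>-\<^sup>1]\<close>, which \<open>q \<mapsto> q\<^sup>-\<^sup>1\<close> takes to \<open>q\<int>[q]\<close>.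
\<close>

lemma coset_coeff_off_diagonal:
  assumes D: "D \<in> DC" and D': "D' \<in> DC" and "D' \<noteq> D"
  shows "kl_coeff D' D \<in> multiples_int_poly qvar"
proof -
  have w: "rep D \<in> carrier W" using D by simp
  have P: "(- 1) ^ n * qvar ^ k \<in> generate_ring q_field {qvar}" for n k :: nat
    by (intro generate_q_field_closed(5) generate_q_field_power generate_q_field_closed(1,3,6)) simp
  have summand: "(- 1) ^ \<ell> y * qvar powi (int (\<ell> y) - int (\<ell> (rep D'))) * q_invert (p y (rep D))
      \<in> multiples_int_poly qvar" if y: "y \<in> D'" for y
  proof -
    have "q_invert (p y (rep D)) \<in> multiples_int_poly qvar"
    proof (cases "bruhat_le W S y (rep D)")
      case True
      have "y \<noteq> rep D" using DC_dcoset[OF D' y] DC_dcoset[OF D rep_min(1)[OF D]] assms(3) by auto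
      then have "bruhat_less W S y (rep D)" using True by (simp add: bruhat_less_def)
      then show ?thesis by (rule q_invert_multiples[OF KL_poly])
    next
      case False
      then have "p y (rep D) = 0" using KL_poly_zero DC_carrier[OF D' y] w by blast
      then show ?thesis by (simp add: multiples_int_poly_closed(1))
    qed
    from multiples_int_poly_closed(5)[OF P this, of "\<ell> y" "\<ell> y - \<ell> (rep D')"]
    show ?thesis unfolding coset_coeff_term[OF D D' y] by (simp only: mult_ac)
  qed
  have "(\<Sum>y\<in>F. (- 1) ^ \<ell> y * qvar powi (int (\<ell> y) - int (\<ell> (rep D'))) * q_invert (p y (rep D)))
     \<in> multiples_int_poly qvar" if "finite F" "F \<subseteq> D'" for F
    using that
    by (induction F rule: finite_induct) (simp_all add: multiples_int_poly_closed(1,2) summand)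
  then show ?thesis unfolding coset_coeff_def using DC_finite[OF D'] by blast
qed

lemma bar_eCe:
  assumes D: "D \<in> DC"
  shows "bar (eCe D) = eCe D"
proof -
  have "bar (dagger (C (rep D))) = dagger (C (rep D))"
    using bar_dagger[of "C (rep D)"] KL_bar[of "rep D"] D by simp
  then show ?thesis using D by (simp add: ring_hom_mult[OF bar_hom] bar_e)
qed



section \<open>Triangularity and independence\<close>

abbreviation q_poly where "q_poly \<equiv> generate_ring q_field {qvar}"

lemma q_poly_coeffs: "q_poly \<subseteq> \<A>"
  by (rule subsetI, rule laurent_coeffs, rule q_poly_laurent)

lemma multiples_coeffs: "multiples_int_poly qvar \<subseteq> \<A>"
  by (rule subset_trans[OF qvar_multiples_subset q_poly_coeffs])

lemma below_eq: "D \<in> DC \<Longrightarrow> below D = insert D (strictly_below D)"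
  by (auto simp: coset_less_def coset_le_def)

lemma finite_strictly_below: "finite (strictly_below D)"
  by (rule finite_subset[OF _ finite_coset_le[of D]]) (auto simp: coset_less_def)

lemma strictly_below_neq: "D' \<in> strictly_below D \<Longrightarrow> D' \<noteq> D" "D' \<in> strictly_below D \<Longrightarrow> D' \<in> DC"
  by (auto simp: coset_less_def)

lemma strictly_below_len: "D \<in> DC \<Longrightarrow> D' \<in> strictly_below D \<Longrightarrow> \<ell> (rep D') < \<ell> (rep D)"
  using coset_le_len[of D' D] by (auto simp: coset_less_def)

lemma coset_coeff_strictly_below: "D \<in> DC \<Longrightarrow> D' \<in> strictly_below D \<Longrightarrow> kl_coeff D' D \<in> multiples_int_poly qvar"
  by (rule coset_coeff_off_diagonal) (simp_all add: coset_less_def)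

lemma strictly_below_sum_closed:
  assumes "\<And>D'. D' \<in> strictly_below D \<Longrightarrow> c D' \<in> \<A>"
  shows "(\<Oplus>\<^bsub>H\<^esub>D'\<in>strictly_below D. c D' \<bullet> eTe D') \<in> carrier H"
  by (rule finsum_closed) (use assms in auto)

lemma eCe_leading_term:
  assumes D: "D \<in> DC"
  shows "eCe D = (- 1) ^ \<ell> (rep D) \<bullet> eTe D \<boxplus> (\<Oplus>\<^bsub>H\<^esub>D'\<in>strictly_below D. kl_coeff D' D \<bullet> eTe D')"
proof -
  have "eCe D = kl_coeff D D \<bullet> eTe D \<boxplus> (\<Oplus>\<^bsub>H\<^esub>D'\<in>strictly_below D. kl_coeff D' D \<bullet> eTe D')"
    unfolding eCe_expansion[OF D] below_eq[OF D]
  proof (rule finsum_insert[OF finite_strictly_below])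
    show "D \<notin> strictly_below D" by (simp add: coset_less_def)
    show "(\<lambda>D'. kl_coeff D' D \<bullet> eTe D') \<in> strictly_below D \<rightarrow> carrier H"
      using coset_coeff_closed[OF D] by (auto intro!: smult_closed)
    show "kl_coeff D D \<bullet> eTe D \<in> carrier H"
      by (rule smult_closed[OF coset_coeff_closed[OF D D] eTe_closed[OF D]])
  qed
  then show ?thesis by (simp only: coset_coeff_self[OF D])
qed

lemma sign_coeffs [simp]: "(- 1) ^ n \<in> \<A>"
  by (intro coeffs_closed(9,8,1))

lemma q_poly_sign: "(- 1) ^ n \<in> q_poly"
  by (intro generate_q_field_power generate_q_field_closed(1,3))

text \<open>
  Inversion of the triangular expansion, by induction on the length of \<open>r(D)\<close>. That the coefficients lie in
  \<open>\<int>[q]\<close>, and not merely in the coefficient ring, is needed for uniqueness: it makes \<open>q\<int>[q]\<close>-combinations of the \<open>e T e\<close>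
  into \<open>q\<int>[q]\<close>-combinations of the \<open>e C e\<close>.
\<close>

lemma eTe_integral_combination:
  assumes "D \<in> DC"
  shows "eTe D \<in> combinations q_poly eCe DC"
  using assms
proof (induction "\<ell> (rep D)" arbitrary: D rule: less_induct)
  case (less D)
  note D = less.prems
  let ?R = "\<Oplus>\<^bsub>H\<^esub>D'\<in>strictly_below D. kl_coeff D' D \<bullet> eTe D'"
  let ?s = "(- 1) ^ \<ell> (rep D) :: int poly fract"
  have b: "eCe D' \<in> carrier H" if "D' \<in> DC" for D' using that by (rule eCe_closed)
  have R: "?R \<in> combinations q_poly eCe DC"
  proof (rule combinations_finsum[OF finite_strictly_below _ q_poly_coeffs b])
    fix D' assume D': "D' \<in> strictly_below D"
    have kl_coeff: "kl_coeff D' D \<in> q_poly" using coset_coeff_strictly_below[OF D D'] qvar_multiples_subset by blast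
    have "eTe D' \<in> combinations q_poly eCe DC"
      by (rule less.hyps[OF strictly_below_len[OF D D'] strictly_below_neq(2)[OF D']])
    then show "kl_coeff D' D \<bullet> eTe D' \<in> combinations q_poly eCe DC"
      by (rule combinations_scale[OF _ q_poly_coeffs b])
        (use kl_coeff q_poly_coeffs generate_q_field_closed(5)[OF kl_coeff] in auto)
  qed
  have Rc: "?R \<in> carrier H" by (rule combinations_closed[OF R q_poly_coeffs b])
  have "(- 1) \<bullet> ?R \<in> combinations q_poly eCe DC"
    by (rule combinations_scale[OF R q_poly_coeffs b]) (auto simp: generate_q_field_closed(3))
  \<comment> \<open>Subtracting the terms strictly below \<open>D\<close> leaves the leading term, whose sign is its own inverse.\<close>
  then have X: "1 \<bullet> eCe D \<boxplus> (- 1) \<bullet> ?R \<in> combinations q_poly eCe DC"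
    by (intro combinations.step) (use D in \<open>auto simp: generate_q_field_closed(1)\<close>)
  have "1 \<bullet> eCe D \<boxplus> (- 1) \<bullet> ?R = ?s \<bullet> eTe D"
  proof -
    have "1 \<bullet> eCe D \<boxplus> (- 1) \<bullet> ?R = (?s \<bullet> eTe D \<boxplus> ?R) \<boxplus> \<ominus>\<^bsub>H\<^esub> ?R"
      using Rc D eCe_leading_term[OF D] by (simp add: scale_minus_one)
    also have "\<dots> = ?s \<bullet> eTe D \<boxplus> (?R \<boxplus> \<ominus>\<^bsub>H\<^esub> ?R)"
      by (rule a_assoc) (use Rc D in auto)
    finally show ?thesis using Rc D by (simp add: r_neg)
  qed
  with X have "?s \<bullet> eTe D \<in> combinations q_poly eCe DC" by simp
  then have "?s \<bullet> (?s \<bullet> eTe D) \<in> combinations q_poly eCe DC"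
    by (rule combinations_scale[OF _ q_poly_coeffs b]) (auto intro: generate_q_field_closed(5)[OF q_poly_sign])
  moreover have "?s * ?s = 1" by (simp flip: power_mult_distrib)
  ultimately show ?case using D by (simp add: scale_scale)
qed

text \<open>
  In a vanishing combination choose \<open>D\<^sub>0\<close> with nonzero coefficient and \<open>r(D\<^sub>0)\<close> of maximal length. Among
  the cosets with nonzero coefficient only \<open>D\<^sub>0\<close> itself lies above \<open>D\<^sub>0\<close>, so the functional of \<open>D\<^sub>0\<close> isolates its coefficient.
\<close>

lemma eCe_independent:
  assumes F: "finite F" "F \<subseteq> DC" and c: "\<And>D. D \<in> F \<Longrightarrow> c D \<in> \<A>"
    and zero: "(\<Oplus>\<^bsub>H\<^esub>D\<in>F. c D \<bullet> eCe D) = \<zero>\<^bsub>H\<^esub>"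
  shows "\<forall>D \<in> F. c D = 0"
proof (rule ccontr)
  assume "\<not> (\<forall>D \<in> F. c D = 0)"
  then have ne: "{D \<in> F. c D \<noteq> 0} \<noteq> {}" by auto
  let ?M = "Max ((\<lambda>D. \<ell> (rep D)) ` {D \<in> F. c D \<noteq> 0})"
  have fin: "finite ((\<lambda>D. \<ell> (rep D)) ` {D \<in> F. c D \<noteq> 0})" using F(1) by simp
  have "?M \<in> (\<lambda>D. \<ell> (rep D)) ` {D \<in> F. c D \<noteq> 0}"
    by (rule Max_in[OF fin]) (use ne in simp)
  then obtain D0 where D0: "D0 \<in> F" "c D0 \<noteq> 0" "?M = \<ell> (rep D0)" by auto
  have max: "\<not> \<ell> (rep D0) < \<ell> (rep D)" if "D \<in> F" "c D \<noteq> 0" for D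
    using Max_ge[OF fin, of "\<ell> (rep D)"] D0(3) that by auto
  have D0': "D0 \<in> DC" using D0 F by auto
  obtain L where L_add: "\<And>x y. x \<in> carrier H \<Longrightarrow> y \<in> carrier H \<Longrightarrow> L (x \<boxplus> y) = L x + L y"
    and L_scale: "\<And>a x. a \<in> \<A> \<Longrightarrow> x \<in> carrier H \<Longrightarrow> L (a \<bullet> x) = a * L x"
    and LT: "\<And>D'. D' \<in> DC \<Longrightarrow> L (eTe D') = (if D' = D0 then qvar ^ \<ell> (rep D0) else 0)"
    using double_coset_functional[OF D0'] by blast
  have L_sum: "L (\<Oplus>\<^bsub>H\<^esub>i\<in>F'. c' i \<bullet> b i) = (\<Sum>i\<in>F'. c' i * L (b i))"
    if "finite F'" "\<And>i. i \<in> F' \<Longrightarrow> c' i \<in> \<A>" "\<And>i. i \<in> F' \<Longrightarrow> b i \<in> carrier H"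
    for F' :: "'w set set" and c' b
    using L_add L_scale that by (rule linear_finsum)
  have LC: "c D * L (eCe D) = (if D = D0 then c D0 * ((- 1) ^ \<ell> (rep D0) * qvar ^ \<ell> (rep D0)) else 0)"
    if DF: "D \<in> F" for D
  proof (cases "c D = 0")
    case False
    have D: "D \<in> DC" using DF F by auto
    have "L (eCe D) = (\<Sum>D'\<in>below D. kl_coeff D' D * L (eTe D'))"
      unfolding eCe_expansion[OF D]
      by (rule L_sum) (use finite_coset_le coset_coeff_closed[OF D] in auto)
    also have "\<dots> = (\<Sum>D'\<in>below D. if D' = D0 then kl_coeff D0 D * qvar ^ \<ell> (rep D0) else 0)"
      by (rule sum.cong) (auto simp: LT)
    also have "\<dots> = (if D0 \<in> below D then kl_coeff D0 D * qvar ^ \<ell> (rep D0) else 0)"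
      using finite_coset_le by (simp add: sum.delta)
    finally have LCD: "L (eCe D) = (if D0 \<in> below D then kl_coeff D0 D * qvar ^ \<ell> (rep D0) else 0)" .
    show ?thesis
    proof (cases "D = D0")
      case True
      then have "D0 \<in> below D" using below_eq[OF D] by blast
      then show ?thesis using LCD True coset_coeff_self[OF D] by simp
    next
      case neq: False
      have "D0 \<notin> below D"
        using coset_le_len[of D0 D] max[OF DF False] neq D D0' by auto
      then have "L (eCe D) = 0" unfolding LCD by (rule if_not_P)
      then show ?thesis using neq by simp
    qed
  qed (use D0(1,2) in auto)
  have "0 = L (\<Oplus>\<^bsub>H\<^esub>D\<in>F. c D \<bullet> eCe D)"
    unfolding zero using L_scale[of 0 "\<one>\<^bsub>H\<^esub>"] by simp
  also have "\<dots> = (\<Sum>D\<in>F. c D * L (eCe D))"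
    by (rule L_sum[OF F(1) c eCe_closed[OF subsetD[OF F(2)]]])
  also have "\<dots> = (\<Sum>D\<in>F. if D = D0 then c D0 * ((- 1) ^ \<ell> (rep D0) * qvar ^ \<ell> (rep D0)) else 0)"
    by (rule sum.cong[OF refl LC])
  also have "\<dots> = c D0 * ((- 1) ^ \<ell> (rep D0) * qvar ^ \<ell> (rep D0))"
    using F(1) D0(1) by (simp add: sum.delta)
  finally show False using D0(2) by simp
qed

text \<open>
  The elements \<open>e C e\<close> are bar invariant and independent, so the coefficients are
  fixed by \<open>q \<mapsto> q\<^sup>-\<^sup>1\<close>.
\<close>

lemma bar_invariant_zero:
  assumes X: "X \<in> combinations (multiples_int_poly qvar) eCe DC" and bar: "bar X = X"
  shows "X = \<zero>\<^bsub>H\<^esub>"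
proof -
  obtain F c where F: "finite F" "F \<subseteq> DC" and cF: "c \<in> F \<rightarrow> multiples_int_poly qvar"
    and Xs: "X = (\<Oplus>\<^bsub>H\<^esub>D\<in>F. c D \<bullet> eCe D)"
    using combinations_representation[OF X multiples_coeffs eCe_closed multiples_int_poly_closed(2)] by blast
  have cq: "c D \<in> q_poly" if "D \<in> F" for D using cF that qvar_multiples_subset by auto
  have cl: "c D \<in> laurent" if "D \<in> F" for D by (rule q_poly_laurent[OF cq[OF that]])
  have cA: "c D \<in> \<A>" "q_invert (c D) \<in> \<A>" if "D \<in> F" for D
    using cl[OF that] laurent_coeffs laurent_q_invert by blast+
  have b: "eCe D \<in> carrier H" if "D \<in> F" for D using F(2) that by auto
  have Xb: "X = (\<Oplus>\<^bsub>H\<^esub>D\<in>F. q_invert (c D) \<bullet> eCe D)"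
  proof -
    have "X = bar X" by (rule bar[symmetric])
    also have "bar X = (\<Oplus>\<^bsub>H\<^esub>D\<in>F. q_invert (c D) \<bullet> bar (eCe D))"
      unfolding Xs by (rule hom_finsum[OF bar_hom bar_q F(1) cl b])
    also have "\<dots> = (\<Oplus>\<^bsub>H\<^esub>D\<in>F. q_invert (c D) \<bullet> eCe D)"
    proof (rule finsum_cong'[OF refl])
      show "q_invert (c D) \<bullet> bar (eCe D) = q_invert (c D) \<bullet> eCe D" if "D \<in> F" for D
        unfolding bar_eCe[OF subsetD[OF F(2) that]] ..
    qed (use b cA in \<open>auto intro!: smult_closed\<close>)
    finally show ?thesis .
  qed
  have "(\<Oplus>\<^bsub>H\<^esub>D\<in>F. (c D + (- 1) * q_invert (c D)) \<bullet> eCe D)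
      = (\<Oplus>\<^bsub>H\<^esub>D\<in>F. c D \<bullet> eCe D \<boxplus> (- 1) \<bullet> (q_invert (c D) \<bullet> eCe D))"
  proof (rule finsum_cong'[OF refl])
    fix D assume D: "D \<in> F"
    show "(c D + (- 1) * q_invert (c D)) \<bullet> eCe D = c D \<bullet> eCe D \<boxplus> (- 1) \<bullet> (q_invert (c D) \<bullet> eCe D)"
      using cA[OF D] b[OF D] scale_distrib_left[of "c D" "(- 1) * q_invert (c D)" "eCe D"]
        scale_scale[of "- 1" "q_invert (c D)" "eCe D"] by simp
  qed (use cA b in \<open>auto intro!: a_closed smult_closed\<close>)
  also have "\<dots> = X \<boxplus> (\<Oplus>\<^bsub>H\<^esub>D\<in>F. (- 1) \<bullet> (q_invert (c D) \<bullet> eCe D))"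
    unfolding Xs by (rule finsum_addf) (use cA b in \<open>auto intro!: smult_closed\<close>)
  also have "(\<Oplus>\<^bsub>H\<^esub>D\<in>F. (- 1) \<bullet> (q_invert (c D) \<bullet> eCe D)) = (- 1) \<bullet> X"
    unfolding Xb by (rule finsum_smult_ldistr[symmetric]) (use F(1) cA b in \<open>auto intro!: smult_closed\<close>)
  also have "X \<boxplus> (- 1) \<bullet> X = \<zero>\<^bsub>H\<^esub>"
    using combinations_closed[OF X multiples_coeffs eCe_closed] by (simp add: scale_minus_one r_neg)
  finally have "\<forall>D \<in> F. c D + (- 1) * q_invert (c D) = 0"
    by (rule eCe_independent[OF F, rotated]) (use cA in auto)
  then have "c D = 0" if "D \<in> F" for D
    using q_invert_fixed_zero[of "c D"] cF that by auto
  then have "X = (\<Oplus>\<^bsub>H\<^esub>D\<in>F. \<zero>\<^bsub>H\<^esub>)"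
    unfolding Xs by (intro finsum_cong') (use b in auto)
  then show ?thesis by simp
qed

section \<open>Basis and characterisation\<close>

lemma eTe_HJ: "D \<in> DC \<Longrightarrow> eTe D \<in> carrier HJ"
  by (rule HJ_memI) simp

lemma eCe_HJ: "D \<in> DC \<Longrightarrow> eCe D \<in> carrier HJ"
  by (rule HJ_memI) simp

lemma HJ_finsum_scale:
  assumes "finite F" "\<And>i. i \<in> F \<Longrightarrow> c i \<in> \<A>" "\<And>i. i \<in> F \<Longrightarrow> b i \<in> carrier HJ"
  shows "(\<Oplus>\<^bsub>HJ\<^esub>i\<in>F. c i \<odot>\<^bsub>HJ\<^esub> b i) = (\<Oplus>\<^bsub>H\<^esub>i\<in>F. c i \<bullet> b i)"
  unfolding HJ_simps by (rule HJ_finsum) (use assms HJ_scale in auto)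

text \<open>
  An element \<open>e h e\<close> is a combination of the \<open>e T\<^sub>w e\<close>, and these are multiples of the \<open>e T e\<close> at minimal
  representatives.
\<close>

lemma HJ_in_span:
  assumes "x \<in> carrier HJ"
  shows "x \<in> combinations \<A> eCe DC"
proof -
  have b: "eCe D \<in> carrier H" if "D \<in> DC" for D using that by (rule eCe_closed)
  have x: "x \<in> carrier H" "e \<cdot> x \<cdot> e = x" using assms by (simp_all add: HJ_carrier)
  have "e \<cdot> x \<cdot> e \<in> combinations \<A> eCe DC"
    using x(1)
  proof (induction rule: basis_induct)
    case zero
    then show ?case by (simp add: combinations.zero)
  next
    case (add a w x)
    have D: "dcoset w \<in> DC" "w \<in> dcoset w" using add(2) dcoset_DC by simp_all
    have "a \<bullet> (e \<cdot> T w \<cdot> e) = (a * qvar ^ (\<ell> w - \<ell> (rep (dcoset w)))) \<bullet> eTe (dcoset w)"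
      unfolding e_T_e(1)[OF D] by (rule scale_scale) (use D add(1) in auto)
    also have "\<dots> \<in> combinations \<A> eCe DC"
      by (rule combinations_scale[OF eTe_integral_combination[OF D(1)] q_poly_coeffs b])
        (use add(1) q_poly_coeffs in \<open>auto intro!: coeffs_closed(7)\<close>)
    finally have "a \<bullet> (e \<cdot> T w \<cdot> e) \<in> combinations \<A> eCe DC" .
    then have "a \<bullet> (e \<cdot> T w \<cdot> e) \<boxplus> e \<cdot> x \<cdot> e \<in> combinations \<A> eCe DC"
      by (rule combinations_add[OF _ add.IH order.refl b])
    moreover have "e \<cdot> (a \<bullet> T w \<boxplus> x) \<cdot> e = a \<bullet> (e \<cdot> T w \<cdot> e) \<boxplus> e \<cdot> x \<cdot> e"
      using add(1-3) by (simp add: r_distr l_distr)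
    ultimately show ?case by simp
  qed
  then show ?thesis using x(2) by simp
qed

lemma eCe_basis: "module_basis (hecke_coeffs W S J) HJ DC eCe"
  unfolding module_basis_def
proof (intro conjI ballI allI impI)
  show "eCe \<in> DC \<rightarrow> carrier HJ" using eCe_HJ by simp
next
  fix x assume "x \<in> carrier HJ"
  then obtain F c where F: "finite F" "F \<subseteq> DC" "c \<in> F \<rightarrow> \<A>" "x = (\<Oplus>\<^bsub>H\<^esub>D\<in>F. c D \<bullet> eCe D)"
    using combinations_representation[OF HJ_in_span order.refl eCe_closed coeffs_closed(6)] by blast
  moreover have "(\<Oplus>\<^bsub>HJ\<^esub>D\<in>F. c D \<odot>\<^bsub>HJ\<^esub> eCe D) = (\<Oplus>\<^bsub>H\<^esub>D\<in>F. c D \<bullet> eCe D)"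
    by (rule HJ_finsum_scale) (use F eCe_HJ in auto)
  ultimately show "\<exists>F c. finite F \<and> F \<subseteq> DC \<and> c \<in> F \<rightarrow> \<A> \<and> x = (\<Oplus>\<^bsub>HJ\<^esub>D\<in>F. c D \<odot>\<^bsub>HJ\<^esub> eCe D)"
    by (intro exI[of _ F] exI[of _ c]) simp
next
  fix F c D
  assume a: "finite F \<and> F \<subseteq> DC \<and> c \<in> F \<rightarrow> \<A> \<and> (\<Oplus>\<^bsub>HJ\<^esub>D\<in>F. c D \<odot>\<^bsub>HJ\<^esub> eCe D) = \<zero>\<^bsub>HJ\<^esub>"
    and D: "D \<in> F"
  have c: "c D \<in> \<A>" if "D \<in> F" for D using a that by auto
  have "(\<Oplus>\<^bsub>HJ\<^esub>D\<in>F. c D \<odot>\<^bsub>HJ\<^esub> eCe D) = (\<Oplus>\<^bsub>H\<^esub>D\<in>F. c D \<bullet> eCe D)"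
    by (rule HJ_finsum_scale) (use a c eCe_HJ in auto)
  then have "(\<Oplus>\<^bsub>H\<^esub>D\<in>F. c D \<bullet> eCe D) = \<zero>\<^bsub>H\<^esub>" using a by simp
  then have "\<forall>D \<in> F. c D = 0" using eCe_independent[of F c] a c by blast
  then show "c D = \<zero>\<^bsub>hecke_coeffs W S J\<^esub>" using D by simp
qed

lemma eCe_expansion_HJ:
  assumes D: "D \<in> DC"
  shows "eCe D = (\<Oplus>\<^bsub>HJ\<^esub>D'\<in>below D. kl_coeff D' D \<odot>\<^bsub>HJ\<^esub> eTe D')"
proof -
  have "(\<Oplus>\<^bsub>HJ\<^esub>D'\<in>below D. kl_coeff D' D \<odot>\<^bsub>HJ\<^esub> eTe D') = (\<Oplus>\<^bsub>H\<^esub>D'\<in>below D. kl_coeff D' D \<bullet> eTe D')"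
    by (rule HJ_finsum_scale[OF finite_coset_le]) (use coset_coeff_closed[OF D] eTe_HJ in auto)
  then show ?thesis using eCe_expansion[OF D] by simp
qed

lemma HJ_strictly_below_sum:
  assumes "\<And>D'. D' \<in> strictly_below D \<Longrightarrow> \<alpha> D' \<in> multiples_int_poly qvar"
  shows "(\<Oplus>\<^bsub>HJ\<^esub>D'\<in>strictly_below D. \<alpha> D' \<odot>\<^bsub>HJ\<^esub> eTe D') = (\<Oplus>\<^bsub>H\<^esub>D'\<in>strictly_below D. \<alpha> D' \<bullet> eTe D')"
  by (rule HJ_finsum_scale[OF finite_strictly_below]) (use assms multiples_coeffs eTe_HJ in auto)

text \<open>
  \<open>B\<close> and \<open>e C e\<close> have the same leading term, and the difference of the remaining terms has
  coefficients in \<open>q\<int>[q]\<close>. Both elements are bar invariant, so this difference vanishes.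
\<close>

lemma eCe_uniqueness:
  assumes D: "D \<in> DC" and bar: "bar B = B"
    and \<alpha>: "\<And>D'. D' \<in> strictly_below D \<Longrightarrow> \<alpha> D' \<in> multiples_int_poly qvar"
    and B: "B = (- 1) ^ \<ell> (rep D) \<bullet> eTe D \<boxplus> (\<Oplus>\<^bsub>H\<^esub>D'\<in>strictly_below D. \<alpha> D' \<bullet> eTe D')"
  shows "B = eCe D"
proof -
  define \<gamma> where "\<gamma> D' = \<alpha> D' + - kl_coeff D' D" for D'
  have b: "eCe D' \<in> carrier H" if "D' \<in> DC" for D' using that by (rule eCe_closed)
  have \<gamma>: "\<gamma> D' \<in> multiples_int_poly qvar" if "D' \<in> strictly_below D" for D'
    unfolding \<gamma>_def by (intro multiples_int_poly_closed(2,3) \<alpha> coset_coeff_strictly_below D that)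
  have A: "\<gamma> D' \<in> \<A>" "kl_coeff D' D \<in> \<A>" "eTe D' \<in> carrier H" if "D' \<in> strictly_below D" for D'
    using \<gamma>[OF that] coset_coeff_strictly_below[OF D that] multiples_coeffs strictly_below_neq(2)[OF that] by auto
  let ?X = "\<Oplus>\<^bsub>H\<^esub>D'\<in>strictly_below D. \<gamma> D' \<bullet> eTe D'"
  let ?R = "\<Oplus>\<^bsub>H\<^esub>D'\<in>strictly_below D. kl_coeff D' D \<bullet> eTe D'"
  have X: "?X \<in> combinations (multiples_int_poly qvar) eCe DC"
  proof (rule combinations_finsum[OF finite_strictly_below _ multiples_coeffs b])
    fix D' assume D': "D' \<in> strictly_below D"
    show "\<gamma> D' \<bullet> eTe D' \<in> combinations (multiples_int_poly qvar) eCe DC"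
      by (rule combinations_scale[OF eTe_integral_combination[OF strictly_below_neq(2)[OF D']] q_poly_coeffs b])
        (use A[OF D'] multiples_int_poly_closed(4)[OF \<gamma>[OF D']] in auto)
  qed
  have Xc: "?X \<in> carrier H" by (rule combinations_closed[OF X multiples_coeffs b])
  have Rc: "?R \<in> carrier H" by (rule strictly_below_sum_closed) (rule A)
  have "(\<Oplus>\<^bsub>H\<^esub>D'\<in>strictly_below D. \<alpha> D' \<bullet> eTe D') = (\<Oplus>\<^bsub>H\<^esub>D'\<in>strictly_below D. kl_coeff D' D \<bullet> eTe D' \<boxplus> \<gamma> D' \<bullet> eTe D')"
  proof (rule finsum_cong'[OF refl])
    fix D' assume D': "D' \<in> strictly_below D"
    show "\<alpha> D' \<bullet> eTe D' = kl_coeff D' D \<bullet> eTe D' \<boxplus> \<gamma> D' \<bullet> eTe D'"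
      using scale_distrib_left[OF A(2)[OF D'] A(1)[OF D'] A(3)[OF D']] by (simp add: \<gamma>_def)
  qed (use A in \<open>auto intro!: a_closed smult_closed\<close>)
  also have "\<dots> = ?R \<boxplus> ?X"
    by (rule finsum_addf) (use A in \<open>auto intro!: smult_closed\<close>)
  finally have "B = eCe D \<boxplus> ?X"
    unfolding B eCe_leading_term[OF D] using Rc Xc D by (simp add: a_assoc)
  moreover from this have "eCe D \<boxplus> bar ?X = eCe D \<boxplus> ?X"
    using bar bar_eCe[OF D] ring_hom_add[OF bar_hom eCe_closed[OF D] Xc] by simp
  then have "bar ?X \<boxplus> eCe D = ?X \<boxplus> eCe D"
    using Xc eCe_closed[OF D] by (simp add: a_comm)
  then have "bar ?X = ?X" using add.right_cancel[OF eCe_closed[OF D] bar_closed[OF Xc] Xc] by simp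
  then have "?X = \<zero>\<^bsub>H\<^esub>" by (rule bar_invariant_zero[OF X])
  ultimately show ?thesis using eCe_closed[OF D] by simp
qed

lemma eCe_characterisation:
  assumes D: "D \<in> DC"
  shows "B \<in> carrier HJ \<and> bar B = B \<and>
      (\<exists>\<alpha>. (\<forall>D' \<in> DC. coset_less W S D' D \<longrightarrow> \<alpha> D' \<in> multiples_int_poly qvar) \<and>
           B = (- 1) ^ cox_length W S (rep D) \<odot>\<^bsub>HJ\<^esub> eTe D \<oplus>\<^bsub>HJ\<^esub>
               (\<Oplus>\<^bsub>HJ\<^esub>D'\<in>strictly_below D. \<alpha> D' \<odot>\<^bsub>HJ\<^esub> eTe D'))
      \<longleftrightarrow> B = eCe D" (is "?lhs \<longleftrightarrow> _")
proof
  assume l: ?lhs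
  then obtain \<alpha> where \<alpha>0: "\<forall>D' \<in> DC. coset_less W S D' D \<longrightarrow> \<alpha> D' \<in> multiples_int_poly qvar"
    and B: "B = (- 1) ^ cox_length W S (rep D) \<odot>\<^bsub>HJ\<^esub> eTe D \<oplus>\<^bsub>HJ\<^esub>
               (\<Oplus>\<^bsub>HJ\<^esub>D'\<in>strictly_below D. \<alpha> D' \<odot>\<^bsub>HJ\<^esub> eTe D')"
    by (elim conjE exE)
  have \<alpha>: "\<alpha> D' \<in> multiples_int_poly qvar" if "D' \<in> strictly_below D" for D'
    using \<alpha>0 that by simp
  have "B = (- 1) ^ cox_length W S (rep D) \<bullet> eTe D \<boxplus> (\<Oplus>\<^bsub>H\<^esub>D'\<in>strictly_below D. \<alpha> D' \<bullet> eTe D')"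
    using B HJ_strictly_below_sum[OF \<alpha>] by (simp only: HJ_simps)
  moreover have "bar B = B" using l by (elim conjE)
  ultimately show "B = eCe D" using eCe_uniqueness[OF D _ \<alpha>] by simp
next
  assume B: "B = eCe D"
  have "B = (- 1) ^ cox_length W S (rep D) \<odot>\<^bsub>HJ\<^esub> eTe D \<oplus>\<^bsub>HJ\<^esub>
               (\<Oplus>\<^bsub>HJ\<^esub>D'\<in>strictly_below D. kl_coeff D' D \<odot>\<^bsub>HJ\<^esub> eTe D')"
    using B eCe_leading_term[OF D] HJ_strictly_below_sum[OF coset_coeff_strictly_below[OF D]] by (simp only: HJ_simps)
  moreover have "\<forall>D' \<in> DC. coset_less W S D' D \<longrightarrow> kl_coeff D' D \<in> multiples_int_poly qvar"
    using coset_coeff_strictly_below[OF D] by simp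
  moreover have "B \<in> carrier HJ" "bar B = B" unfolding B by (rule eCe_HJ[OF D], rule bar_eCe[OF D])
  ultimately show ?lhs by (intro conjI exI[of _ "\<lambda>D'. kl_coeff D' D"])
qed

end

theorem proposition4p5:
  fixes W :: "('w, 'm) monoid_scheme" and S J :: "'w set"
    and H :: "(int poly fract, 'h) module" and T C :: "'w \<Rightarrow> 'h"
    and bar dagger :: "'h \<Rightarrow> 'h" and p :: "'w \<Rightarrow> 'w \<Rightarrow> int poly fract"
  assumes "kazhdan_lusztig W S J H T bar C p dagger"
  shows
    "let A = hecke_coeffs W S J;
         HJ = parabolic_hecke W S J H T;
         \<D> = double_cosets W J;
         r = min_rep W S;
         e = hecke_idem W S J H T;
         eTe = (\<lambda>D. e \<otimes>\<^bsub>H\<^esub> T (r D) \<otimes>\<^bsub>H\<^esub> e);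
         eCe = (\<lambda>D. e \<otimes>\<^bsub>H\<^esub> dagger (C (r D)) \<otimes>\<^bsub>H\<^esub> e)
     in
       module_basis A HJ \<D> eCe \<and>
       (\<forall>D \<in> \<D>.
          eCe D = (\<Oplus>\<^bsub>HJ\<^esub>D'\<in>{D' \<in> \<D>. coset_le W S D' D}. coset_coeff W S p D' D \<odot>\<^bsub>HJ\<^esub> eTe D')) \<and>
       (\<forall>D \<in> \<D>. \<forall>B.
          B \<in> carrier HJ \<and> bar B = B \<and>
          (\<exists>\<alpha>. (\<forall>D' \<in> \<D>. coset_less W S D' D \<longrightarrow> \<alpha> D' \<in> multiples_int_poly qvar) \<and>
               B = (- 1) ^ cox_length W S (r D) \<odot>\<^bsub>HJ\<^esub> eTe D \<oplus>\<^bsub>HJ\<^esub>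
                   (\<Oplus>\<^bsub>HJ\<^esub>D'\<in>{D' \<in> \<D>. coset_less W S D' D}. \<alpha> D' \<odot>\<^bsub>HJ\<^esub> eTe D'))
          \<longleftrightarrow> B = eCe D)"
  using kazhdan_lusztig.eCe_basis[OF assms] kazhdan_lusztig.eCe_expansion_HJ[OF assms]
    kazhdan_lusztig.eCe_characterisation[OF assms]
  unfolding Let_def by (intro conjI ballI allI)

end
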